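(* Let $n\ge 2$ be an integer, let $r_0,r_1,r_2$ be rational functions, and let $h$ be a meromorphic solution of $$h''+r_1(z)h'+r_0(z)h=r_2(z).$$ Let $P(z,f)$ be a differential polynomial in $f$ whose coefficients are small functions of $f$, and let $f$ be a transcendental meromorphic solution of $$f^n+P(z,f)=h(z).$$ Then one of the following holds: (1) $\rho(h)$ is an integer, $f$ is of the form $f(z)=q(z)e^{\alpha(z)}$, where $q$ is a rational function and $\alpha$ is a non-constant polynomial, and $$T(r,h)=nT(r,f)+S(r,f).$$ Furthermore, if $r_1$ and $r_0$ are polynomials, then $q$ is a constant. (2) If $n\ge j+1$ and $\gamma_P\le n-j$ for some integer $j\ge 1$, then $$T(r,f)\le \frac{2}{j}\overline{N}\left(r,\frac{1}{f}\right)+N(r,f)+\frac{2}{j}\overline{N}(r,f)+S(r,f).$$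
   Context: Standard Nevanlinna theory notation is used: $T(r,f)$ is the characteristic function, $N(r,f)$ the integrated counting function of poles (with multiplicity), $\overline{N}(r,f)$ the same ignoring multiplicity, $N(r,1/f)$, $\overline{N}(r,1/f)$ the corresponding functions for zeros; $\rho(f)$ denotes the order of $f$. $S(r,f)$ denotes any quantity with $S(r,f)=o(T(r,f))$ as $r\to\infty$ outside a possible exceptional set of finite linear measure. A meromorphic function $a$ is a small function of $f$ if $T(r,a)=S(r,f)$. A differential polynomial in $f$ is a finite sum $P(z,f)=\sum_{j=1}^{\ell}M_j[f]$ of differential monomials $M_j[f]=a_j f^{n_{0j}}(f')^{n_{1j}}\cdots(f^{(k)})^{n_{kj}}$ with non-negative integers $n_{sj}$ and coefficients $a_j$; its degree is $\gamma_P=\max_{1\le j\le \ell}\sum_{s=0}^k n_{sj}$. *)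

theory Defs
  imports "HOL-Complex_Analysis.Complex_Analysis" "HOL-Library.Liminf_Limsup"
begin

text \<open>Meromorphic functions on C are represented by functions complex => complex that are
  nicely meromorphic on UNIV (no removable singularities; value 0 at poles).
  Identities between meromorphic functions are required to hold outside a discrete set
  (eventually w.r.t. the cosparse filter).\<close>

definition pole_mult :: "(complex \<Rightarrow> complex) \<Rightarrow> complex \<Rightarrow> nat" where
  "pole_mult f z = (if is_pole f z then nat (- zorder f z) else 0)"

definition pole_count :: "(complex \<Rightarrow> complex) \<Rightarrow> real \<Rightarrow> real" where
  "pole_count f t = real (\<Sum>z\<in>{z. cmod z \<le> t \<and> is_pole f z}. pole_mult f z)"

definition pole_count_bar :: "(complex \<Rightarrow> complex) \<Rightarrow> real \<Rightarrow> real" where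
  "pole_count_bar f t = real (card {z. cmod z \<le> t \<and> is_pole f z})"

definition integrated_count :: "(real \<Rightarrow> real) \<Rightarrow> real \<Rightarrow> real" where
  "integrated_count n r = integral {0..r} (\<lambda>t. (n t - n 0) / t) + n 0 * ln r"

definition N_count :: "(complex \<Rightarrow> complex) \<Rightarrow> real \<Rightarrow> real" where
  "N_count f r = integrated_count (pole_count f) r"

definition N_count_bar :: "(complex \<Rightarrow> complex) \<Rightarrow> real \<Rightarrow> real" where
  "N_count_bar f r = integrated_count (pole_count_bar f) r"

definition log_plus :: "real \<Rightarrow> real" where
  "log_plus x = max 0 (ln x)"

definition proximity :: "(complex \<Rightarrow> complex) \<Rightarrow> real \<Rightarrow> real" where
  "proximity f r = (1 / (2 * pi)) *
     integral {0..2*pi} (\<lambda>\<theta>. log_plus (cmod (f (of_real r * exp (\<i> * of_real \<theta>)))))"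

definition char_T :: "(complex \<Rightarrow> complex) \<Rightarrow> real \<Rightarrow> real" where
  "char_T f r = proximity f r + N_count f r"

definition nev_order :: "(complex \<Rightarrow> complex) \<Rightarrow> ereal" where
  "nev_order f = Limsup at_top (\<lambda>r. ereal (ln (char_T f r) / ln r))"

definition is_S :: "(complex \<Rightarrow> complex) \<Rightarrow> (real \<Rightarrow> real) \<Rightarrow> bool" where
  "is_S f s \<longleftrightarrow> (\<exists>E. E \<in> sets lborel \<and> emeasure lborel E < \<infinity> \<and>
     (\<forall>\<epsilon>>0. \<exists>R. \<forall>r\<ge>R. r \<notin> E \<longrightarrow> \<bar>s r\<bar> \<le> \<epsilon> * char_T f r))"

definition small_function :: "(complex \<Rightarrow> complex) \<Rightarrow> (complex \<Rightarrow> complex) \<Rightarrow> bool" where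
  "small_function f a \<longleftrightarrow> a nicely_meromorphic_on UNIV \<and> is_S f (char_T a)"

definition rational_function :: "(complex \<Rightarrow> complex) \<Rightarrow> bool" where
  "rational_function r \<longleftrightarrow> (\<exists>p q :: complex poly. q \<noteq> 0 \<and>
     (\<forall>\<^sub>\<approx>z\<in>UNIV. r z = poly p z / poly q z))"

definition is_polynomial_fun :: "(complex \<Rightarrow> complex) \<Rightarrow> bool" where
  "is_polynomial_fun r \<longleftrightarrow> (\<exists>p :: complex poly. \<forall>\<^sub>\<approx>z\<in>UNIV. r z = poly p z)"

definition transcendental_meromorphic :: "(complex \<Rightarrow> complex) \<Rightarrow> bool" where
  "transcendental_meromorphic f \<longleftrightarrow> f nicely_meromorphic_on UNIV \<and> \<not> rational_function f"

definition diff_poly ::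
  "nat \<Rightarrow> nat \<Rightarrow> (nat \<Rightarrow> complex \<Rightarrow> complex) \<Rightarrow> (nat \<Rightarrow> nat \<Rightarrow> nat)
     \<Rightarrow> (complex \<Rightarrow> complex) \<Rightarrow> complex \<Rightarrow> complex" where
  "diff_poly l k a e f z = (\<Sum>j<l. a j z * (\<Prod>s\<le>k. ((deriv ^^ s) f z) ^ e j s))"

definition diff_poly_degree :: "nat \<Rightarrow> nat \<Rightarrow> (nat \<Rightarrow> nat \<Rightarrow> nat) \<Rightarrow> nat" where
  "diff_poly_degree l k e = Max (insert 0 ((\<lambda>j. \<Sum>s\<le>k. e j s) ` {..<l}))"

end

theory Submission
  imports Defs
begin

text \<open>
  Write \<open>u = f' / f\<close> and \<open>L = D\<^sup>2 + r1 D + r0\<close>. Then \<open>L (f ^ n) = f ^ n * \<psi>\<close> with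
  \<open>\<psi> = n u' + (n u)\<^sup>2 + n r1 u + r0\<close>, so applying \<open>L\<close> to the equation gives
  \<open>f ^ n * \<psi> = r2 - L (P)\<close>, whose right-hand side has degree at most \<open>n - j\<close> in \<open>f\<close>.
  If \<open>\<psi>\<close> is not identically zero, dividing by \<open>f ^ (n - j)\<close> where \<open>cmod f \<ge> 1\<close> bounds \<open>j * m(r, f)\<close> by
  \<open>m(r, 1 / \<psi>)\<close>, hence by \<open>N(r, \<psi>)\<close>, and all but finitely many poles of \<open>\<psi>\<close> are at most double
  and lie at zeros and poles of \<open>f\<close>. If \<open>\<psi> = 0\<close>, then \<open>u\<close> solves a Riccati equation with
  rational coefficients: \<open>f\<close> has zeros and poles only at poles of \<open>r0\<close> and \<open>r1\<close>, the lemma on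
  the logarithmic derivative for \<open>u\<close> makes \<open>u\<close> rational, and so \<open>f = q e\<^sup>\<alpha>\<close>.

  The lemma on the logarithmic derivative comes from the Poisson--Jensen formula. Small error terms
  are handled as Landau symbols along the filter of sets whose complement in some half-line has finite measure.
\<close>


subsection \<open>Circle means and the Poisson formula\<close>

text \<open>The analysis takes place on circles free of zeros and poles, where all integrands are
  continuous; the remaining radii are countable and vanish in the exceptional set. Accordingly T is
  shown to be monotone along such radii only, which is all that the growth lemma asks for. In the
  estimate of the logarithmic derivative the obstacle is a zero or pole \<open>a\<close> close to
  the circle: the mean of \<open>1 / cmod (z - a)\<close> is unbounded there, that of
  \<open>1 / sqrt (cmod (z - a))\<close> is not, so a square root is taken before averaging. The
  class of coefficients is deliberately wide: it asks for small proximity and lets N be O(T),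
  because the poles of f'/f are not negligible. They are counted later, through
  \<open>\<psi>\<close>: they are simple poles of \<open>u\<close>, which gives the factor 2 and the
  reduced counting functions. Two exceptional sets need care: \<open>is_S\<close> wants a single one
  for all epsilon, found by a diagonal choice, and the order is a limsup over all radii, so its
  upper bound must be carried to every large radius. If the degree of P is at least
  \<open>n\<close>, no \<open>j\<close> is admissible and the second alternative is vacuous.\<close>

definition circ_mean :: "(complex \<Rightarrow> real) \<Rightarrow> real \<Rightarrow> real" where
  "circ_mean u r = 1 / (2 * pi) * integral {0..2*pi} (\<lambda>t. u (of_real r * cis t))"

definition poisson_kernel :: "real \<Rightarrow> complex \<Rightarrow> complex \<Rightarrow> real" where
  "poisson_kernel R z w = (R\<^sup>2 - (cmod z)\<^sup>2) / (cmod (w - z))\<^sup>2"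

lemma proximity_eq_circ_mean: "proximity f r = circ_mean (\<lambda>z. log_plus (cmod (f z))) r"
  by (simp add: proximity_def circ_mean_def cis_conv_exp mult.commute)

lemma continuous_on_circle:
  assumes "continuous_on (sphere 0 r) u" "r \<ge> 0"
  shows "continuous_on A (\<lambda>t. u (of_real r * cis t))"
  by (rule continuous_on_compose2[OF assms(1)]) (use assms(2) in \<open>auto simp: norm_mult intro!: continuous_intros\<close>)

lemma integrable_on_circle:
  fixes u :: "complex \<Rightarrow> 'a :: banach"
  assumes "continuous_on (sphere 0 r) u" "r \<ge> 0"
  shows "(\<lambda>t. u (of_real r * cis t)) integrable_on {0..2*pi}"
  by (intro integrable_continuous_interval continuous_on_circle assms)

lemma circ_mean_mono:
  assumes "continuous_on (sphere 0 r) u" "continuous_on (sphere 0 r) v" "r \<ge> 0"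
    "\<And>z. cmod z = r \<Longrightarrow> u z \<le> v z"
  shows "circ_mean u r \<le> circ_mean v r"
  unfolding circ_mean_def
  by (intro mult_left_mono integral_le integrable_on_circle assms) (use assms in \<open>auto simp: norm_mult\<close>)

lemma circ_mean_cong:
  assumes "\<And>z. cmod z = r \<Longrightarrow> u z = v z" "r \<ge> 0"
  shows "circ_mean u r = circ_mean v r"
  unfolding circ_mean_def using assms by (simp add: norm_mult)

lemma circ_mean_add:
  assumes "continuous_on (sphere 0 r) u" "continuous_on (sphere 0 r) v" "r \<ge> 0"
  shows "circ_mean (\<lambda>z. u z + v z) r = circ_mean u r + circ_mean v r"
  unfolding circ_mean_def
  by (subst integral_add) (intro integrable_on_circle assms | simp add: add_divide_distrib)+

lemma circ_mean_diff:
  assumes "continuous_on (sphere 0 r) u" "continuous_on (sphere 0 r) v" "r \<ge> 0"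
  shows "circ_mean (\<lambda>z. u z - v z) r = circ_mean u r - circ_mean v r"
  unfolding circ_mean_def
  by (subst integral_diff) (intro integrable_on_circle assms | simp add: diff_divide_distrib)+

lemma circ_mean_cmult: "circ_mean (\<lambda>z. c * u z) r = c * circ_mean u r"
  unfolding circ_mean_def by simp

lemma circ_mean_const [simp]: "circ_mean (\<lambda>z. c) r = c"
  unfolding circ_mean_def by simp

lemma circ_mean_sum:
  assumes "finite I" "\<And>i. i \<in> I \<Longrightarrow> continuous_on (sphere 0 r) (u i)" "r \<ge> 0"
  shows "circ_mean (\<lambda>z. \<Sum>i\<in>I. u i z) r = (\<Sum>i\<in>I. circ_mean (u i) r)"
  unfolding circ_mean_def
  by (subst integral_sum) (auto intro!: integrable_on_circle assms simp: sum_distrib_left sum_divide_distrib)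

lemma circ_mean_nonneg:
  assumes "\<And>z. cmod z = r \<Longrightarrow> u z \<ge> 0" "r \<ge> 0"
  shows "circ_mean u r \<ge> 0"
proof (cases "(\<lambda>t. u (of_real r * cis t)) integrable_on {0..2*pi}")
  case True
  then have "integral {0..2*pi} (\<lambda>t. u (of_real r * cis t)) \<ge> 0"
    by (intro integral_nonneg) (use assms in \<open>auto simp: norm_mult\<close>)
  then show ?thesis by (simp add: circ_mean_def)
qed (simp add: circ_mean_def not_integrable_integral)

lemma has_integral_circ:
  assumes "(g has_contour_integral I) (circlepath 0 r)"
  shows "((\<lambda>t. g (of_real r * cis t) * (of_real r * cis t)) has_integral I / \<i>) {0..2*pi}"
proof -
  have "((\<lambda>t. g (0 + of_real r * cis t) * of_real r * \<i> * cis t) has_integral I) {0..2*pi}"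
    using assms unfolding circlepath_def
    by (subst (asm) has_contour_integral_part_circlepath_iff) auto
  from has_integral_mult_right[OF this, of "1/\<i>"] show ?thesis
    by (simp add: field_simps)
qed

text \<open>For \<open>a \<noteq> 0\<close> the only zero is the mirror image of \<open>a\<close> in
  the circle of radius \<open>R\<close>, which lies outside the closed disc.\<close>

lemma blaschke_numerator_nonzero:
  assumes "cmod a < R" "cmod z \<le> R"
  shows "of_real (R\<^sup>2) - cnj a * z \<noteq> 0"
proof
  have R: "R > 0" using assms(1) by (smt (verit) norm_ge_zero)
  assume "of_real (R\<^sup>2) - cnj a * z = 0"
  hence "cmod (of_real (R\<^sup>2)) = cmod (cnj a * z)" by simp
  hence "R\<^sup>2 = cmod a * cmod z" by (simp add: norm_mult norm_power)
  moreover have "cmod a * cmod z \<le> cmod a * R" by (intro mult_left_mono assms) auto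
  moreover have "cmod a * R < R * R" using assms R by simp
  ultimately show False by (simp add: power2_eq_square)
qed

text \<open>The Cauchy kernel \<open>1 / (w - z)\<close> reproduces \<open>G z\<close>. Adding
  \<open>cnj z / (R^2 - cnj z * w)\<close>, which is holomorphic in the closed disc and so
  integrates to 0, changes nothing, and on the circle the two kernels together, times
  \<open>w\<close>, are the Poisson kernel.\<close>

lemma poisson_formula_complex:
  assumes G: "G holomorphic_on cball 0 R" and z: "cmod z < R"
  shows "((\<lambda>t. G (of_real R * cis t) * of_real (poisson_kernel R z (of_real R * cis t)))
           has_integral of_real (2 * pi) * G z) {0..2*pi}"
proof -
  have R: "R > 0" using z by (smt (verit) norm_ge_zero)
  note nz = blaschke_numerator_nonzero[OF z]
  have gen: "w * (1 / a + c / (w * b)) = (w * b + c * a) / (a * b)" if "a \<noteq> 0" "b \<noteq> 0" "w \<noteq> 0" for a b c w :: complex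
    using that by (simp add: field_simps)
  have 1: "((\<lambda>u. G u / (u - z)) has_contour_integral (2 * of_real pi * \<i> * G z)) (circlepath 0 R)"
    by (rule Cauchy_integral_circlepath_simple) (use assms in auto)
  have 2: "((\<lambda>u. G u * cnj z / (of_real (R\<^sup>2) - cnj z * u)) has_contour_integral 0) (circlepath 0 R)"
    by (rule Cauchy_theorem_convex_simple[of _ "cball 0 R"])
       (use nz R in \<open>auto intro!: holomorphic_intros G\<close>)
  have 3: "((\<lambda>t. (G (of_real R * cis t) / (of_real R * cis t - z) +
       G (of_real R * cis t) * cnj z / (of_real (R\<^sup>2) - cnj z * (of_real R * cis t))) * (of_real R * cis t))
       has_integral (2 * of_real pi * \<i> * G z + 0) / \<i>) {0..2*pi}"
    by (rule has_integral_circ[OF has_contour_integral_add[OF 1 2]])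
  have "(G w / (w - z) + G w * cnj z / (of_real (R\<^sup>2) - cnj z * w)) * w = G w * of_real (poisson_kernel R z w)"
    if w: "w = of_real R * cis t" for w t
  proof -
    have w': "cmod w = R" using w R by (simp add: norm_mult)
    have w0: "w \<noteq> 0" "w \<noteq> z" using w' R z by auto
    have c: "of_real (R\<^sup>2) - cnj z * w = w * cnj (w - z)"
      using complex_norm_square[of w] w' by (simp add: algebra_simps)
    have "(G w / (w - z) + G w * cnj z / (of_real (R\<^sup>2) - cnj z * w)) * w =
          G w * (w * (1 / (w - z) + cnj z / (w * cnj (w - z))))"
      unfolding c by (simp add: algebra_simps)
    also have "w * (1 / (w - z) + cnj z / (w * cnj (w - z))) =
               (w * cnj (w - z) + cnj z * (w - z)) / ((w - z) * cnj (w - z))"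
      using w0 by (intro gen) auto
    also have "w * cnj (w - z) + cnj z * (w - z) = w * cnj w - z * cnj z" by (simp add: algebra_simps)
    also have "\<dots> = of_real (R\<^sup>2 - (cmod z)\<^sup>2)"
      using complex_norm_square[of w] complex_norm_square[of z] w' by simp
    also have "(w - z) * cnj (w - z) = of_real ((cmod (w - z))\<^sup>2)"
      by (simp only: complex_norm_square)
    finally show ?thesis by (simp add: poisson_kernel_def)
  qed
  moreover have "(2 * of_real pi * \<i> * G z + 0) / \<i> = of_real (2 * pi) * G z" by simp
  ultimately show ?thesis using 3 by (simp only:)
qed

lemma poisson_formula:
  assumes G: "G holomorphic_on cball 0 R" and z: "cmod z < R"
  shows "circ_mean (\<lambda>w. Re (G w) * poisson_kernel R z w) R = Re (G z)"
proof -
  have "((\<lambda>t. Re (G (of_real R * cis t) * of_real (poisson_kernel R z (of_real R * cis t))))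
           has_integral Re (of_real (2 * pi) * G z)) {0..2*pi}"
    by (intro has_integral_Re poisson_formula_complex assms)
  hence "integral {0..2*pi} (\<lambda>t. Re (G (of_real R * cis t)) * poisson_kernel R z (of_real R * cis t)) =
     2 * pi * Re (G z)"
    by (simp add: integral_unique)
  thus ?thesis by (simp add: circ_mean_def)
qed

lemma circ_mean_Re_holomorphic:
  assumes "G holomorphic_on cball 0 R" "R > 0"
  shows "circ_mean (\<lambda>w. Re (G w)) R = Re (G 0)"
proof -
  have "circ_mean (\<lambda>w. Re (G w) * poisson_kernel R 0 w) R = Re (G 0)"
    using assms by (intro poisson_formula) auto
  moreover have "circ_mean (\<lambda>w. Re (G w) * poisson_kernel R 0 w) R = circ_mean (\<lambda>w. Re (G w)) R"
    by (rule circ_mean_cong) (use assms in \<open>auto simp: poisson_kernel_def\<close>)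
  ultimately show ?thesis by simp
qed

lemma circ_mean_poisson_kernel:
  assumes "cmod z < R"
  shows "circ_mean (poisson_kernel R z) R = 1"
  using poisson_formula[of "\<lambda>_. 1" R z] assms by simp

lemma poisson_kernel_nonneg: "cmod z \<le> R \<Longrightarrow> poisson_kernel R z w \<ge> 0"
  by (auto simp: poisson_kernel_def intro!: divide_nonneg_nonneg power_mono)

lemma poisson_kernel_le:
  assumes "cmod z < R" "cmod w = R"
  shows "poisson_kernel R z w \<le> (R + cmod z) / (R - cmod z)"
proof -
  have "R - cmod z \<le> cmod (w - z)" using norm_triangle_ineq2[of w z] assms by simp
  hence "poisson_kernel R z w \<le> (R\<^sup>2 - (cmod z)\<^sup>2) / (R - cmod z)\<^sup>2"
    unfolding poisson_kernel_def using assms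
    by (intro divide_left_mono power_mono mult_pos_pos) auto
  also have "\<dots> = (R + cmod z) / (R - cmod z)"
    using assms by (simp add: power2_eq_square divide_simps) (simp add: algebra_simps)
  finally show ?thesis .
qed

lemma continuous_on_poisson_kernel:
  assumes "cmod z < R"
  shows "continuous_on (sphere 0 R) (poisson_kernel R z)"
  unfolding poisson_kernel_def using assms by (intro continuous_intros) auto

text \<open>Only the real part of \<open>G\<close> enters: on the circle \<open>cnj (G w)\<close> contributes the conjugate of a
  contour integral of a function that is holomorphic in the disc.\<close>

lemma deriv_bound_by_Re_mean:
  assumes G: "G holomorphic_on cball 0 R" and z: "cmod z < R"
  shows "cmod (deriv G z) \<le> 2 * R / (R - cmod z)\<^sup>2 * circ_mean (\<lambda>w. \<bar>Re (G w)\<bar>) R"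
proof -
  have R: "R > 0" using z by (smt (verit) norm_ge_zero)
  note nz = blaschke_numerator_nonzero[OF z]
  have contG: "continuous_on (cball 0 R) G" using G holomorphic_on_imp_continuous_on by blast
  have holG: "G holomorphic_on ball 0 R" using G by (rule holomorphic_on_subset) auto
  note C = Cauchy_derivative_integral_circlepath[OF contG holG, of z]
  define J where "J = contour_integral (circlepath 0 R) (\<lambda>u. G u / (u - z)\<^sup>2)"
  have dG: "deriv G z = 1 / (2 * of_real pi * \<i>) * J"
    unfolding J_def using C(2) z by (intro DERIV_imp_deriv) auto
  have 1: "((\<lambda>u. G u / (u - z)\<^sup>2) has_contour_integral J) (circlepath 0 R)"
    unfolding J_def using C(1) z by (intro has_contour_integral_integral) auto
  have 2: "((\<lambda>u. G u * of_real (R\<^sup>2) / (of_real (R\<^sup>2) - cnj z * u)\<^sup>2) has_contour_integral 0) (circlepath 0 R)"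
    by (rule Cauchy_theorem_convex_simple[of _ "cball 0 R"])
       (use nz R in \<open>auto intro!: holomorphic_intros G\<close>)
  note 1 = has_integral_circ[OF 1]
  note 2 = has_integral_cnj[THEN iffD2, OF has_integral_circ[OF 2]]
  note 3 = has_integral_add[OF 1 2]
  have eq: "G w / (w - z)\<^sup>2 * w + cnj (G w * of_real (R\<^sup>2) / (of_real (R\<^sup>2) - cnj z * w)\<^sup>2 * w) =
             of_real (2 * Re (G w)) * w / (w - z)\<^sup>2"
    if w: "w = of_real R * cis t" for w t
  proof -
    have w': "cmod w = R" using w R by (simp add: norm_mult)
    have w0: "w \<noteq> 0" "w \<noteq> z" using w' R z by auto
    have c: "of_real (R\<^sup>2) - z * cnj w = cnj w * (w - z)"
      using complex_norm_square[of w] w' by (simp add: algebra_simps)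
    have "cnj (G w * of_real (R\<^sup>2) / (of_real (R\<^sup>2) - cnj z * w)\<^sup>2 * w) =
           cnj (G w) * of_real (R\<^sup>2) / (of_real (R\<^sup>2) - z * cnj w)\<^sup>2 * cnj w"
      by simp
    also have "\<dots> = cnj (G w) * (w * cnj w) / (cnj w * (w - z))\<^sup>2 * cnj w"
      unfolding c using complex_norm_square[of w] w' by simp
    also have "\<dots> = cnj (G w) * w / (w - z)\<^sup>2"
      using w0 by (simp add: power2_eq_square)
    finally show ?thesis
      using complex_add_cnj[of "G w"] by (simp add: add_divide_distrib [symmetric] ring_distribs [symmetric])
  qed
  have 4: "((\<lambda>t. of_real (2 * Re (G (of_real R * cis t))) * (of_real R * cis t) / (of_real R * cis t - z)\<^sup>2)
      has_integral J / \<i>) {0..2*pi}"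
    using 3 unfolding o_def eq[OF refl] by simp
  define w where "w = (\<lambda>t. of_real R * cis t)"
  have "cmod (J / \<i>) \<le> integral {0..2*pi} (\<lambda>t. 2 * R / (R - cmod z)\<^sup>2 * \<bar>Re (G (w t))\<bar>)"
  proof (rule integral_norm_bound_integral[where f = "\<lambda>t. of_real (2 * Re (G (w t))) * (w t) / (w t - z)\<^sup>2", 
          THEN order_trans[rotated]])
    show "cmod (J / \<i>) \<le> cmod (integral {0..2*pi} (\<lambda>t. of_real (2 * Re (G (w t))) * (w t) / (w t - z)\<^sup>2))"
      using integral_unique[OF 4] by (simp add: w_def)
    show "(\<lambda>t. of_real (2 * Re (G (w t))) * (w t) / (w t - z)\<^sup>2) integrable_on {0..2*pi}"
      using 4 unfolding w_def by blast
    show "(\<lambda>t. 2 * R / (R - cmod z)\<^sup>2 * \<bar>Re (G (w t))\<bar>) integrable_on {0..2*pi}"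
      unfolding w_def
      by (rule integrable_on_circle[where u = "\<lambda>z'. 2 * R / (R - cmod z)\<^sup>2 * \<bar>Re (G z')\<bar>"])
         (use R z in \<open>auto intro!: continuous_intros continuous_on_subset[OF contG]\<close>)
    fix t
    have wt: "cmod (w t) = R" using R by (simp add: w_def norm_mult)
    have "R - cmod z \<le> cmod (w t - z)" using norm_triangle_ineq2[of "w t" z] wt by simp
    hence "2 * \<bar>Re (G (w t))\<bar> * R / (cmod (w t - z))\<^sup>2 \<le> 2 * \<bar>Re (G (w t))\<bar> * R / (R - cmod z)\<^sup>2"
      using z R by (intro divide_left_mono power_mono mult_pos_pos) auto
    thus "cmod (of_real (2 * Re (G (w t))) * (w t) / (w t - z)\<^sup>2) \<le> 2 * R / (R - cmod z)\<^sup>2 * \<bar>Re (G (w t))\<bar>"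
      using wt by (simp add: norm_divide norm_mult norm_power abs_mult mult_ac)
  qed
  also have "\<dots> = 2 * R / (R - cmod z)\<^sup>2 * (2 * pi * circ_mean (\<lambda>w. \<bar>Re (G w)\<bar>) R)"
    by (simp add: circ_mean_def w_def)
  finally have "cmod J \<le> 2 * R / (R - cmod z)\<^sup>2 * (2 * pi * circ_mean (\<lambda>w. \<bar>Re (G w)\<bar>) R)"
    by (simp add: norm_divide norm_mult)
  thus ?thesis unfolding dG by (simp add: norm_mult norm_divide field_simps)
qed

subsection \<open>Blaschke factors and the Poisson--Jensen formula\<close>

text \<open>The reciprocal of the usual Blaschke factor of the disc of radius \<open>R\<close>: it
  has a simple pole at \<open>a\<close>, modulus 1 on the circle and modulus at least 1 inside. Its
  power \<open>zorder g a\<close> therefore cancels a zero or pole of \<open>g\<close> at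
  \<open>a\<close> without changing \<open>cmod g\<close> on the circle.\<close>

definition blaschke :: "real \<Rightarrow> complex \<Rightarrow> complex \<Rightarrow> complex" where
  "blaschke R a z = (of_real (R\<^sup>2) - cnj a * z) / (of_real R * (z - a))"

lemma blaschke_nonzero:
  assumes "cmod a < R" "cmod z \<le> R" "z \<noteq> a"
  shows "blaschke R a z \<noteq> 0"
  using blaschke_numerator_nonzero[OF assms(1,2)] assms
  by (auto simp: blaschke_def)

lemma norm_blaschke_circle:
  assumes "cmod a < R" "cmod z = R"
  shows "cmod (blaschke R a z) = 1"
proof -
  have R: "R > 0" using assms(1) by (smt (verit) norm_ge_zero)
  have "of_real (R\<^sup>2) - cnj a * z = z * cnj (z - a)"
    using complex_norm_square[of z] assms by (simp add: algebra_simps)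
  hence "cmod (of_real (R\<^sup>2) - cnj a * z) = R * cmod (z - a)"
    using assms by (simp add: norm_mult del: complex_cnj_diff)
  moreover have "cmod (z - a) \<noteq> 0" using assms by auto
  ultimately show ?thesis using R by (simp add: blaschke_def norm_divide norm_mult)
qed

text \<open>The difference of the squared moduli of numerator and denominator factors as
  \<open>(R^2 - (cmod a)^2) * (R^2 - (cmod z)^2)\<close>. This sign later allows zeros to be dropped
  from upper bounds.\<close>

lemma norm_blaschke_ge_1:
  assumes "cmod a < R" "cmod z \<le> R" "z \<noteq> a"
  shows "cmod (blaschke R a z) \<ge> 1"
proof -
  have R: "R > 0" using assms(1) by (smt (verit) norm_ge_zero)
  have "complex_of_real ((cmod (of_real (R\<^sup>2) - cnj a * z))\<^sup>2 - (R * cmod (z - a))\<^sup>2) =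
        of_real ((R\<^sup>2 - (cmod a)\<^sup>2) * (R\<^sup>2 - (cmod z)\<^sup>2))"
    unfolding of_real_diff of_real_mult power_mult_distrib complex_norm_square
    by (simp add: algebra_simps power2_eq_square)
  hence "(cmod (of_real (R\<^sup>2) - cnj a * z))\<^sup>2 - (R * cmod (z - a))\<^sup>2 = (R\<^sup>2 - (cmod a)\<^sup>2) * (R\<^sup>2 - (cmod z)\<^sup>2)"
    using of_real_eq_iff by blast
  moreover have "\<dots> \<ge> 0" using assms by (intro mult_nonneg_nonneg) (auto intro!: power_mono)
  ultimately have "(R * cmod (z - a))\<^sup>2 \<le> (cmod (of_real (R\<^sup>2) - cnj a * z))\<^sup>2" by simp
  hence "R * cmod (z - a) \<le> cmod (of_real (R\<^sup>2) - cnj a * z)"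
    by (rule power2_le_imp_le) auto
  thus ?thesis using R assms by (simp add: blaschke_def norm_divide norm_mult divide_simps)
qed

lemma analytic_blaschke:
  assumes "z \<noteq> a" "R > 0"
  shows "blaschke R a analytic_on {z}"
  unfolding blaschke_def using assms by (auto intro!: analytic_intros)

lemma ln_powi: "ln (x powi n) = of_int n * ln x" if "x > 0" for x :: real
  using that by (cases "n \<ge> 0") (auto simp: power_int_def ln_realpow ln_inverse)

text \<open>The existence theorem for logarithms is applied on an open disc, so the closed disc is
  enlarged slightly: by compactness it has a positive distance \<open>d\<close> from the complement
  of the open set where \<open>F\<close> is holomorphic and zero-free.\<close>

lemma holomorphic_logarithm_on_cball:
  assumes "F analytic_on cball 0 R" "\<And>z. cmod z \<le> R \<Longrightarrow> F z \<noteq> 0" "R > 0"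
  obtains G where "G holomorphic_on cball 0 R" "\<And>z. cmod z \<le> R \<Longrightarrow> exp (G z) = F z"
proof -
  obtain T where T: "open T" "cball 0 R \<subseteq> T" "F holomorphic_on T"
    using assms(1) unfolding analytic_on_holomorphic by blast
  define U where "U = T \<inter> F -` (-{0})"
  have U: "open U" unfolding U_def
    using T by (intro continuous_open_preimage holomorphic_on_imp_continuous_on) auto
  have "cball 0 R \<inter> (-U) = {}" using T assms(2) by (auto simp: U_def)
  then obtain d where d: "d > 0" "\<And>x y. x \<in> cball 0 R \<Longrightarrow> y \<in> -U \<Longrightarrow> d \<le> dist x y"
    using separate_compact_closed[of "cball 0 R" "-U"] U by (auto simp: closed_def)
  have sub: "ball 0 (R + d) \<subseteq> U"
  proof
    fix z :: complex assume z: "z \<in> ball 0 (R + d)"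
    show "z \<in> U"
    proof (cases "cmod z \<le> R")
      case True thus ?thesis using T assms(2) by (auto simp: U_def)
    next
      case False
      \<comment> \<open>The radial projection of \<open>z\<close> to the circle, at distance
        \<open>cmod z - R < d\<close> from \<open>z\<close>.\<close>
      define x where "x = of_real (R / cmod z) * z"
      have "cmod z > R" "cmod z > 0" using False assms(3) by linarith+
      hence "cmod x = R" using assms(3) by (auto simp: x_def norm_mult norm_divide)
      moreover have "dist x z < d"
      proof -
        have "x - z = of_real (R / cmod z - 1) * z" by (simp add: x_def algebra_simps)
        hence "dist x z = \<bar>R / cmod z - 1\<bar> * cmod z" by (simp add: dist_norm norm_mult del: of_real_diff of_real_divide)
        also have "\<dots> = cmod z - R" using \<open>cmod z > R\<close> \<open>cmod z > 0\<close> by (auto simp: abs_if field_simps)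
        finally show ?thesis using z by simp
      qed
      ultimately show ?thesis using d(2)[of x z] by (auto simp: not_le)
    qed
  qed
  have "F holomorphic_on ball 0 (R + d)" "\<And>z. z \<in> ball 0 (R + d) \<Longrightarrow> F z \<noteq> 0"
    using sub T by (auto simp: U_def intro: holomorphic_on_subset)
  then obtain G where G: "G holomorphic_on ball 0 (R + d)" "\<And>z. z \<in> ball 0 (R + d) \<Longrightarrow> exp (G z) = F z"
    using holomorphic_logarithm_exists[of "ball 0 (R + d)" F 0] assms(3) d(1) by auto
  show ?thesis
  proof (rule that)
    show "G holomorphic_on cball 0 R" using d(1) by (intro holomorphic_on_subset[OF G(1)]) auto
  qed (use G(2) d(1) in auto)
qed

lemma meromorphic_local_form:
  assumes "g meromorphic_on {a}" "frequently (\<lambda>z. g z \<noteq> 0) (at a)"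
  shows "zor_poly g a analytic_on {a}" "zor_poly g a a \<noteq> 0"
    "eventually (\<lambda>z. g z = zor_poly g a z * (z - a) powi zorder g a) (at a)"
proof -
  have "zor_poly g a a \<noteq> 0 \<and> (\<exists>r. r>0 \<and> zor_poly g a holomorphic_on cball a r
    \<and> (\<forall>w\<in>cball a r - {a}. g w  = zor_poly g a w * (w-a) powi zorder g a \<and> zor_poly g a w \<noteq>0))"
    using assms by (intro zorder_exist) (auto simp: meromorphic_at_iff)
  then obtain r where r: "zor_poly g a a \<noteq> 0" "r > 0" "zor_poly g a holomorphic_on cball a r"
     "\<And>w. w\<in>cball a r - {a} \<Longrightarrow> g w  = zor_poly g a w * (w-a) powi zorder g a" by blast
  show "zor_poly g a analytic_on {a}"
    unfolding analytic_at using r by (intro exI[of _ "ball a r"]) (auto intro: holomorphic_on_subset)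
  show "zor_poly g a a \<noteq> 0" by fact
  have "eventually (\<lambda>w. w \<in> ball a r - {a}) (at a)" using r by (intro eventually_at_in_open) auto
  thus "eventually (\<lambda>z. g z = zor_poly g a z * (z - a) powi zorder g a) (at a)"
    by eventually_elim (use r in auto)
qed

text \<open>After multiplication with the Blaschke factors all zeros and poles in the disc are
  cancelled; once the removable singularities are filled, the product is analytic and zero-free and
  has a logarithm \<open>G\<close>. Points of \<open>S\<close> where \<open>g\<close> has order 0 do
  no harm, as their exponent is 0.\<close>

lemma blaschke_factorization:
  assumes g: "g meromorphic_on cball 0 R" and R: "R > 0" and S: "finite S" "S \<subseteq> ball 0 R"
    and reg: "\<And>z. cmod z \<le> R \<Longrightarrow> z \<notin> S \<Longrightarrow> g analytic_on {z} \<and> g z \<noteq> 0"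
  obtains G where "G holomorphic_on cball 0 R"
    "\<And>z. cmod z \<le> R \<Longrightarrow> z \<notin> S \<Longrightarrow> exp (G z) = g z * (\<Prod>a\<in>S. blaschke R a z powi zorder g a)"
proof -
  define g0 where "g0 = (\<lambda>z. g z * (\<Prod>a\<in>S. blaschke R a z powi zorder g a))"
  define F where "F = remove_sings g0"
  have ana0: "g0 analytic_on {z}" "g0 z \<noteq> 0" if z: "cmod z \<le> R" "z \<notin> S" for z
  proof -
    have nz: "blaschke R a z \<noteq> 0" if "a \<in> S" for a
      using that S z by (intro blaschke_nonzero) auto
    show "g0 analytic_on {z}" unfolding g0_def
      using reg[OF z] R z nz by (intro analytic_intros analytic_blaschke) auto
    show "g0 z \<noteq> 0" unfolding g0_def using reg[OF z] nz S by auto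
  qed
  have F_out: "F analytic_on {z}" "F z = g0 z" "F z \<noteq> 0" if z: "cmod z \<le> R" "z \<notin> S" for z
    using ana0[OF z] by (auto simp: F_def analytic_at_imp_no_pole
      intro!: remove_sings_analytic_at isolated_singularity_at_analytic isContD[OF analytic_at_imp_isCont])
  have F_in: "F analytic_on {b} \<and> F b \<noteq> 0" if b: "b \<in> S" for b
  proof -
    have bR: "cmod b < R" using b S by auto
    have "eventually (\<lambda>z. z \<in> ball 0 R - S - {b}) (at b)"
    proof -
      have "eventually (\<lambda>z. z \<in> ball 0 R - {b}) (at b)" using bR by (intro eventually_at_in_open) auto
      moreover have "eventually (\<lambda>z. z \<notin> S - {b}) (at b)"
      proof -
        have "open (- (S - {b}))" using S by (intro open_Compl finite_imp_closed) auto
        hence "eventually (\<lambda>z. z \<in> - (S - {b})) (at b)" by (rule eventually_at_in_open') auto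
        thus ?thesis by eventually_elim auto
      qed
      ultimately show ?thesis by eventually_elim auto
    qed
    note ev = this
    have gb: "g meromorphic_on {b}" using g by (rule meromorphic_on_subset) (use bR in auto)
    have "eventually (\<lambda>z. g z \<noteq> 0) (at b)"
      using ev by eventually_elim (use reg in auto)
    hence fr: "frequently (\<lambda>z. g z \<noteq> 0) (at b)"
      by (simp add: eventually_frequently)
    note lf = meromorphic_local_form[OF gb fr]
    \<comment> \<open>The analytic continuation of \<open>g0\<close> to \<open>b\<close>: the power
      of \<open>z - b\<close> in the local form of \<open>g\<close> cancels against the denominator
      of the Blaschke factor of \<open>b\<close>.\<close>
    define K where "K = (\<lambda>z. zor_poly g b z * ((of_real (R\<^sup>2) - cnj b * z) / of_real R) powi zorder g b *
                      (\<Prod>a\<in>S-{b}. blaschke R a z powi zorder g a))"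
    have nz: "blaschke R a b \<noteq> 0" if "a \<in> S - {b}" for a
      using that S bR by (intro blaschke_nonzero) auto
    have nz2: "(of_real (R\<^sup>2) - cnj b * b) / of_real R \<noteq> 0"
      using blaschke_numerator_nonzero[OF bR, of b] bR R by simp
    have K: "K analytic_on {b}" unfolding K_def
      using nz nz2 lf R by (intro analytic_intros analytic_blaschke) auto
    have Kb: "K b \<noteq> 0" unfolding K_def using nz nz2 lf S by auto
    have "eventually (\<lambda>z. g0 z = K z) (at b)"
      using lf(3) ev
    proof eventually_elim
      case (elim z)
      have "g0 z = zor_poly g b z * ((z - b) powi zorder g b * blaschke R b z powi zorder g b) * (\<Prod>a\<in>S-{b}. blaschke R a z powi zorder g a)"
        unfolding g0_def using elim b S by (simp add: prod.remove[of S b] mult_ac)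
      also have "(z - b) powi zorder g b * blaschke R b z powi zorder g b = ((z - b) * blaschke R b z) powi zorder g b"
        by (simp add: power_int_mult_distrib)
      also have "(z - b) * blaschke R b z = (of_real (R\<^sup>2) - cnj b * z) / of_real R"
        using elim by (simp add: blaschke_def)
      finally show ?case by (simp add: K_def)
    qed
    hence lim: "g0 \<midarrow>b\<rightarrow> K b"
      using isContD[OF analytic_at_imp_isCont[OF K]] by (simp add: filterlim_cong)
    have "isolated_singularity_at g0 b"
      using isolated_singularity_at_cong[OF \<open>eventually (\<lambda>z. g0 z = K z) (at b)\<close> refl] isolated_singularity_at_analytic[OF K] by simp
    hence "F analytic_on {b}" unfolding F_def using lim by (rule remove_sings_analytic_at)
    moreover have "F b = K b" unfolding F_def using lim by (rule remove_sings_eqI)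
    ultimately show ?thesis using Kb by simp
  qed
  have "F analytic_on cball 0 R"
    by (subst analytic_on_analytic_at) (use F_in F_out(1) in \<open>auto, metis\<close>)
  moreover have "F z \<noteq> 0" if "cmod z \<le> R" for z using F_in F_out that by blast
  ultimately obtain G where "G holomorphic_on cball 0 R" "\<And>z. cmod z \<le> R \<Longrightarrow> exp (G z) = F z"
    using holomorphic_logarithm_on_cball R by blast
  thus ?thesis using that[of G] F_out(2) by (simp add: g0_def)
qed

context
  fixes g :: "complex \<Rightarrow> complex" and R :: real and S :: "complex set"
  assumes g: "g meromorphic_on cball 0 R" and R: "R > 0" and S: "finite S" "S \<subseteq> ball 0 R"
    and reg: "\<And>z. cmod z \<le> R \<Longrightarrow> z \<notin> S \<Longrightarrow> g analytic_on {z} \<and> g z \<noteq> 0"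
begin

lemma circle_notin: "cmod w = R \<Longrightarrow> w \<notin> S"
  using S by auto

lemma ln_norm_factorization:
  assumes "cmod z \<le> R" "z \<notin> S" "exp w = g z * (\<Prod>a\<in>S. blaschke R a z powi zorder g a)"
  shows "Re w = ln (cmod (g z)) + (\<Sum>a\<in>S. zorder g a * ln (cmod (blaschke R a z)))"
proof -
  have nz: "blaschke R a z \<noteq> 0" if "a \<in> S" for a
    using that S assms by (intro blaschke_nonzero) auto
  have "Re w = ln (cmod (exp w))" by simp
  also have "\<dots> = ln (cmod (g z) * (\<Prod>a\<in>S. cmod (blaschke R a z) powi zorder g a))"
    unfolding assms(3) by (simp add: norm_mult prod_norm[symmetric] norm_power_int)
  also have "\<dots> = ln (cmod (g z)) + ln (\<Prod>a\<in>S. cmod (blaschke R a z) powi zorder g a)"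
    using nz reg[OF assms(1,2)] by (intro ln_mult_pos prod_pos) auto
  also have "ln (\<Prod>a\<in>S. cmod (blaschke R a z) powi zorder g a) = (\<Sum>a\<in>S. ln (cmod (blaschke R a z) powi zorder g a))"
    using nz S by (intro ln_prod) auto
  finally show ?thesis using nz by (simp add: ln_powi)
qed

lemma Re_factorization_circle:
  assumes "cmod z = R" "exp w = g z * (\<Prod>a\<in>S. blaschke R a z powi zorder g a)"
  shows "Re w = ln (cmod (g z))"
proof -
  have "z \<notin> S" using assms S by auto
  hence "Re w = ln (cmod (g z)) + (\<Sum>a\<in>S. zorder g a * ln (cmod (blaschke R a z)))"
    using assms by (intro ln_norm_factorization) auto
  also have "(\<Sum>a\<in>S. zorder g a * ln (cmod (blaschke R a z))) = 0"
    using S assms by (intro sum.neutral) (auto simp: norm_blaschke_circle subset_iff)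
  finally show ?thesis by simp
qed

lemma poisson_jensen:
  assumes z: "cmod z < R" "z \<notin> S"
  shows "ln (cmod (g z)) = circ_mean (\<lambda>w. ln (cmod (g w)) * poisson_kernel R z w) R -
           (\<Sum>a\<in>S. zorder g a * ln (cmod (blaschke R a z)))"
proof -
  obtain G where G: "G holomorphic_on cball 0 R"
    "\<And>z. cmod z \<le> R \<Longrightarrow> z \<notin> S \<Longrightarrow> exp (G z) = g z * (\<Prod>a\<in>S. blaschke R a z powi zorder g a)"
    using blaschke_factorization[OF g R S reg] by blast
  have "circ_mean (\<lambda>w. ln (cmod (g w)) * poisson_kernel R z w) R = circ_mean (\<lambda>w. Re (G w) * poisson_kernel R z w) R"
  proof (rule circ_mean_cong)
    fix w :: complex assume "cmod w = R"
    thus "ln (cmod (g w)) * poisson_kernel R z w = Re (G w) * poisson_kernel R z w"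
      using Re_factorization_circle[of w "G w"] G(2)[of w] circle_notin by auto
  qed (use R in auto)
  also have "\<dots> = Re (G z)" using G z by (intro poisson_formula)
  also have "\<dots> = ln (cmod (g z)) + (\<Sum>a\<in>S. zorder g a * ln (cmod (blaschke R a z)))"
    using z G by (intro ln_norm_factorization) auto
  finally show ?thesis by simp
qed

text \<open>With 0 in \<open>S\<close> a zero, a pole and a regular point at the origin are treated
  alike. Since \<open>ln 0 = 0\<close>, the summand of the origin is
  \<open>zorder g 0 * ln R\<close>, as it should be.\<close>

lemma jensen_formula_aux:
  assumes 0: "0 \<in> S"
  shows "circ_mean (\<lambda>w. ln (cmod (g w))) R = ln (cmod (zor_poly g 0 0)) + (\<Sum>a\<in>S. zorder g a * (ln R - ln (cmod a)))"
proof -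
  obtain G where G: "G holomorphic_on cball 0 R"
    "\<And>z. cmod z \<le> R \<Longrightarrow> z \<notin> S \<Longrightarrow> exp (G z) = g z * (\<Prod>a\<in>S. blaschke R a z powi zorder g a)"
    using blaschke_factorization[OF g R S reg] by blast
  have "circ_mean (\<lambda>w. ln (cmod (g w))) R = circ_mean (\<lambda>w. Re (G w)) R"
  proof (rule circ_mean_cong)
    fix w :: complex assume "cmod w = R"
    thus "ln (cmod (g w)) = Re (G w)"
      using Re_factorization_circle[of w "G w"] G(2)[of w] circle_notin by auto
  qed (use R in auto)
  also have "\<dots> = Re (G 0)" using G R by (intro circ_mean_Re_holomorphic)
  finally have mean: "circ_mean (\<lambda>w. ln (cmod (g w))) R = Re (G 0)" .
  have ev: "eventually (\<lambda>z. z \<in> ball 0 R - S) (at 0)"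
  proof -
    have "eventually (\<lambda>z. z \<in> (ball 0 R - (S - {0})) - {0}) (at 0)" using S R
      by (intro eventually_at_in_open) (auto intro: finite_imp_closed open_Diff)
    thus ?thesis by eventually_elim auto
  qed
  have g0: "g meromorphic_on {0}" using g by (rule meromorphic_on_subset) (use R in auto)
  have "eventually (\<lambda>z. g z \<noteq> 0) (at 0)" using ev by eventually_elim (use reg in auto)
  hence fr: "frequently (\<lambda>z. g z \<noteq> 0) (at 0)" by (simp add: eventually_frequently)
  note lf = meromorphic_local_form[OF g0 fr]
  define K where "K = (\<lambda>z. zor_poly g 0 z * of_real R powi zorder g 0 * (\<Prod>a\<in>S-{0}. blaschke R a z powi zorder g a))"
  have nz: "blaschke R a 0 \<noteq> 0" if "a \<in> S - {0}" for a
    using that S R by (intro blaschke_nonzero) auto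
  have K: "K analytic_on {0}" unfolding K_def
    using nz lf R by (intro analytic_intros analytic_blaschke) auto
  have "eventually (\<lambda>z. exp (G z) = K z) (at 0)"
    using lf(3) ev
  proof eventually_elim
    case (elim z)
    have "z \<noteq> 0" using elim 0 by auto
    have "exp (G z) = zor_poly g 0 z * (z powi zorder g 0 * blaschke R 0 z powi zorder g 0) * (\<Prod>a\<in>S-{0}. blaschke R a z powi zorder g a)"
      using elim G(2)[of z] S 0 by (simp add: prod.remove[of S 0] mult_ac)
    also have "z powi zorder g 0 * blaschke R 0 z powi zorder g 0 = (z * blaschke R 0 z) powi zorder g 0"
      by (simp add: power_int_mult_distrib)
    also have "z * blaschke R 0 z = of_real R"
      using \<open>z \<noteq> 0\<close> R by (simp add: blaschke_def power2_eq_square)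
    finally show ?case by (simp add: K_def)
  qed
  moreover have "(\<lambda>z. exp (G z)) \<midarrow>0\<rightarrow> exp (G 0)"
  proof -
    have "isCont G 0" using G(1) R
      by (intro continuous_on_interior[OF holomorphic_on_imp_continuous_on]) auto
    thus ?thesis by (intro tendsto_exp isContD)
  qed
  moreover have "K \<midarrow>0\<rightarrow> K 0" using isContD[OF analytic_at_imp_isCont[OF K]] .
  ultimately have "exp (G 0) = K 0"
    using tendsto_cong[of "\<lambda>z. exp (G z)" K "at 0" "exp (G 0)"] tendsto_unique[of "at 0" K "exp (G 0)" "K 0"] by simp
  hence "Re (G 0) = ln (cmod (K 0))" by (metis ln_exp norm_exp_eq_Re)
  also have "cmod (K 0) = cmod (zor_poly g 0 0) * (R powi zorder g 0 * (\<Prod>a\<in>S-{0}. cmod (blaschke R a 0) powi zorder g a))"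
    using R by (simp add: K_def norm_mult prod_norm[symmetric] norm_power_int mult_ac)
  also have "ln \<dots> = ln (cmod (zor_poly g 0 0)) + ln (R powi zorder g 0 * (\<Prod>a\<in>S-{0}. cmod (blaschke R a 0) powi zorder g a))"
    using nz R lf by (intro ln_mult_pos mult_pos_pos prod_pos) auto
  also have "ln (R powi zorder g 0 * (\<Prod>a\<in>S-{0}. cmod (blaschke R a 0) powi zorder g a)) =
      ln (R powi zorder g 0) + ln (\<Prod>a\<in>S-{0}. cmod (blaschke R a 0) powi zorder g a)"
    using nz R by (intro ln_mult_pos prod_pos) auto
  also have "ln (\<Prod>a\<in>S-{0}. cmod (blaschke R a 0) powi zorder g a) = (\<Sum>a\<in>S-{0}. ln (cmod (blaschke R a 0) powi zorder g a))"
    using nz S by (intro ln_prod) auto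
  also have "\<dots> = (\<Sum>a\<in>S-{0}. zorder g a * (ln R - ln (cmod a)))"
  proof (intro sum.cong refl)
    fix a assume a: "a \<in> S - {0}"
    have "cmod (blaschke R a 0) = R / cmod a"
      using R a by (simp add: blaschke_def norm_divide norm_mult power2_eq_square)
    thus "ln (cmod (blaschke R a 0) powi zorder g a) = zorder g a * (ln R - ln (cmod a))"
      using R a by (simp add: ln_powi ln_div)
  qed
  also have "ln (R powi zorder g 0) = zorder g 0 * (ln R - ln (cmod 0))"
    using R by (simp add: ln_powi)
  also have "zorder g 0 * (ln R - ln (cmod 0)) + (\<Sum>a\<in>S-{0}. zorder g a * (ln R - ln (cmod a))) =
             (\<Sum>a\<in>S. zorder g a * (ln R - ln (cmod a)))"
    using S 0 by (simp add: sum.remove[of S 0])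
  finally show ?thesis using mean by simp
qed

text \<open>Logarithmic differentiation of the Blaschke factorization expresses
  \<open>deriv g z / g z\<close> as \<open>deriv G z\<close> minus the logarithmic derivatives of
  the Blaschke factors. The first is controlled by the mean of \<open>cmod (Re (G w))\<close> on the
  circle, where \<open>Re (G w) = ln (cmod (g w))\<close>; the latter are explicit.\<close>

lemma logarithmic_derivative_bound:
  assumes z: "cmod z < R" "z \<notin> S"
  shows "cmod (deriv g z / g z) \<le> 2 * R / (R - cmod z)\<^sup>2 * circ_mean (\<lambda>w. \<bar>ln (cmod (g w))\<bar>) R +
           (\<Sum>a\<in>S. \<bar>real_of_int (zorder g a)\<bar> * (1 / cmod (z - a) + 1 / (R - cmod z)))"
proof -
  obtain G where G: "G holomorphic_on cball 0 R"
    "\<And>z. cmod z \<le> R \<Longrightarrow> z \<notin> S \<Longrightarrow> exp (G z) = g z * (\<Prod>a\<in>S. blaschke R a z powi zorder g a)"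
    using blaschke_factorization[OF g R S reg] by blast
  have mean: "circ_mean (\<lambda>w. \<bar>ln (cmod (g w))\<bar>) R = circ_mean (\<lambda>w. \<bar>Re (G w)\<bar>) R"
  proof (rule circ_mean_cong)
    fix w :: complex assume "cmod w = R"
    thus "\<bar>ln (cmod (g w))\<bar> = \<bar>Re (G w)\<bar>"
      using Re_factorization_circle[of w "G w"] G(2)[of w] circle_notin by auto
  qed (use R in auto)
  have nz: "blaschke R a z \<noteq> 0" if "a \<in> S" for a
    using that S z by (intro blaschke_nonzero) auto
  define B' where "B' = (\<lambda>a. blaschke R a z * (- cnj a / (of_real (R\<^sup>2) - cnj a * z) - 1 / (z - a)))"
  have B: "(blaschke R a has_field_derivative B' a) (at z)" if "a \<in> S" for a
  proof -
    have n0: "of_real (R\<^sup>2) - cnj a * z \<noteq> 0" "z - a \<noteq> 0"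
      using that S z blaschke_numerator_nonzero[of a R z] by auto
    have "(blaschke R a has_field_derivative
        ((- cnj a) * (of_real R * (z - a)) - (of_real (R\<^sup>2) - cnj a * z) * of_real R) /
          ((of_real R * (z - a)) * (of_real R * (z - a)))) (at z)"
      unfolding blaschke_def using n0 R by (auto intro!: derivative_eq_intros)
    also have "((- cnj a) * (of_real R * (z - a)) - (of_real (R\<^sup>2) - cnj a * z) * of_real R) /
          ((of_real R * (z - a)) * (of_real R * (z - a))) = B' a"
    proof -
      have alg: "((- c) * (r * b) - n * r) / ((r * b) * (r * b)) = n / (r * b) * (- c / n - 1 / b)"
        if "n \<noteq> 0" "b \<noteq> 0" "r \<noteq> 0" for c r b n :: complex
        using that by (simp add: field_simps)
      show ?thesis unfolding B'_def blaschke_def using n0 R by (intro alg) auto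
    qed
    finally show ?thesis .
  qed
  define P where "P = (\<lambda>w. \<Prod>a\<in>S. blaschke R a w powi zorder g a)"
  have P0: "P z \<noteq> 0" using nz S by (auto simp: P_def)
  have P: "(P has_field_derivative P z * (\<Sum>a\<in>S. (of_int (zorder g a) * blaschke R a z powi (zorder g a - 1) * B' a) / (blaschke R a z powi zorder g a))) (at z)"
    unfolding P_def using nz by (intro has_field_derivative_prod' DERIV_power_int B) auto
  have "(\<Sum>a\<in>S. (of_int (zorder g a) * blaschke R a z powi (zorder g a - 1) * B' a) / (blaschke R a z powi zorder g a)) =
      (\<Sum>a\<in>S. of_int (zorder g a) * (- cnj a / (of_real (R\<^sup>2) - cnj a * z) - 1 / (z - a)))" (is "_ = ?s")
    using nz by (intro sum.cong refl) (simp add: B'_def power_int_diff)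
  with P have P: "(P has_field_derivative P z * ?s) (at z)" by simp
  have zb: "z \<in> ball 0 R - S" using z by auto
  have op: "open (ball 0 R - S)" using S by (intro open_Diff finite_imp_closed) auto
  have gz: "(g has_field_derivative deriv g z) (at z)"
    using reg[of z] z analytic_on_imp_differentiable_at DERIV_deriv_iff_field_differentiable by fastforce
  have Gz: "(G has_field_derivative deriv G z) (at z)"
    using G(1) z by (intro holomorphic_derivI[of G "ball 0 R"]) (auto intro: holomorphic_on_subset)
  have "((\<lambda>w. exp (G w)) has_field_derivative exp (G z) * deriv G z) (at z)"
    using Gz by (auto intro!: derivative_eq_intros)
  moreover have "((\<lambda>w. exp (G w)) has_field_derivative deriv g z * P z + g z * (P z * ?s)) (at z)"
  proof (rule has_field_derivative_transform_within_open[OF _ op zb])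
    show "((\<lambda>w. g w * P w) has_field_derivative deriv g z * P z + g z * (P z * ?s)) (at z)"
      using DERIV_mult[OF gz P] by (simp add: algebra_simps)
  qed (use G(2) in \<open>auto simp: P_def\<close>)
  ultimately have "exp (G z) * deriv G z = deriv g z * P z + g z * (P z * ?s)"
    by (rule DERIV_unique)
  moreover have "exp (G z) = g z * P z" using G(2) z by (simp add: P_def)
  ultimately have "(g z * P z) * deriv G z = (g z * P z) * (deriv g z / g z + ?s)"
    using reg[of z] z by (simp add: field_simps)
  hence "deriv G z = deriv g z / g z + ?s" using reg[of z] z P0 by simp
  hence "cmod (deriv g z / g z) \<le> cmod (deriv G z) + cmod ?s"
    using norm_triangle_ineq4[of "deriv g z / g z + ?s" ?s] by (simp only: add_diff_cancel_right')
  also have "cmod (deriv G z) \<le> 2 * R / (R - cmod z)\<^sup>2 * circ_mean (\<lambda>w. \<bar>ln (cmod (g w))\<bar>) R"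
    unfolding mean by (intro deriv_bound_by_Re_mean G z)
  also have "cmod ?s \<le> (\<Sum>a\<in>S. \<bar>real_of_int (zorder g a)\<bar> * (1 / cmod (z - a) + 1 / (R - cmod z)))"
  proof (intro sum_norm_le)
    fix a assume a: "a \<in> S"
    have "cmod (- cnj a / (of_real (R\<^sup>2) - cnj a * z)) \<le> 1 / (R - cmod z)"
    proof -
      have "R * (R - cmod z) \<le> cmod (of_real (R\<^sup>2)) - cmod (cnj a * z)"
        using mult_right_mono[of "cmod a" R "cmod z"] a S
        by (auto simp: norm_mult norm_power power2_eq_square right_diff_distrib)
      also have "\<dots> \<le> cmod (of_real (R\<^sup>2) - cnj a * z)" by (rule norm_triangle_ineq2)
      finally have "R * (R - cmod z) \<le> cmod (of_real (R\<^sup>2) - cnj a * z)" .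
      hence "cmod a / cmod (of_real (R\<^sup>2) - cnj a * z) \<le> R / (R * (R - cmod z))"
        using a S R z by (intro frac_le) auto
      thus ?thesis using R z by (simp add: norm_divide)
    qed
    hence "cmod (- cnj a / (of_real (R\<^sup>2) - cnj a * z) - 1 / (z - a)) \<le> 1 / (R - cmod z) + 1 / cmod (z - a)"
      by (intro norm_triangle_le_diff add_mono) (auto simp: norm_divide)
    thus "cmod (of_int (zorder g a) * (- cnj a / (of_real (R\<^sup>2) - cnj a * z) - 1 / (z - a)))
       \<le> \<bar>real_of_int (zorder g a)\<bar> * (1 / cmod (z - a) + 1 / (R - cmod z))"
      unfolding norm_mult by (simp add: mult_left_mono)
  qed
  finally show ?thesis by simp
qed

end

text \<open>If 0 is not in \<open>S\<close>, then \<open>g\<close> is analytic and nonzero there, so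
  inserting 0 adds a summand with \<open>zorder g 0 = 0\<close>.\<close>

lemma jensen_formula:
  assumes g: "g meromorphic_on cball 0 R" and R: "R > 0" and S: "finite S" "S \<subseteq> ball 0 R"
    and reg: "\<And>z. cmod z \<le> R \<Longrightarrow> z \<notin> S \<Longrightarrow> g analytic_on {z} \<and> g z \<noteq> 0"
  shows "circ_mean (\<lambda>w. ln (cmod (g w))) R = ln (cmod (zor_poly g 0 0)) + (\<Sum>a\<in>S. zorder g a * (ln R - ln (cmod a)))"
proof -
  have "circ_mean (\<lambda>w. ln (cmod (g w))) R = ln (cmod (zor_poly g 0 0)) + (\<Sum>a\<in>insert 0 S. zorder g a * (ln R - ln (cmod a)))"
    using assms by (intro jensen_formula_aux) auto
  moreover have "zorder g 0 = 0" if "0 \<notin> S"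
    using reg[of 0] that R zorder_eq_0_iff[of g 0] analytic_at_neq_imp_eventually_neq[of g 0 0] eventually_frequently[of "at (0::complex)"]
    by auto
  ultimately show ?thesis using S by (cases "0 \<in> S") (auto simp: insert_absorb)
qed

section \<open>Circle means of functions of the distance to a point\<close>

lemma circ_mean_ln_zero_free:
  assumes "F analytic_on cball 0 R" "\<And>z. cmod z \<le> R \<Longrightarrow> F z \<noteq> 0" "R > 0"
  shows "circ_mean (\<lambda>z. ln (cmod (F z))) R = ln (cmod (F 0))"
proof -
  obtain G where G: "G holomorphic_on cball 0 R" "\<And>z. cmod z \<le> R \<Longrightarrow> exp (G z) = F z"
    using holomorphic_logarithm_on_cball[OF assms] by blast
  have *: "ln (cmod (F z)) = Re (G z)" if "cmod z \<le> R" for z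
    using G(2)[OF that] by (metis ln_exp norm_exp_eq_Re)
  have "circ_mean (\<lambda>z. ln (cmod (F z))) R = circ_mean (\<lambda>z. Re (G z)) R"
    by (rule circ_mean_cong) (use * assms in auto)
  also have "\<dots> = Re (G 0)" using G assms by (intro circ_mean_Re_holomorphic)
  finally show ?thesis using *[of 0] assms by simp
qed

text \<open>On the circle \<open>cmod z = r\<close> one has \<open>z = r\<^sup>2 / cnj z\<close>, so a factor \<open>z - a\<close> with \<open>a\<close> inside
  may be traded for the zero-free \<open>1 - cnj a * z / r\<^sup>2\<close>.\<close>

lemma norm_diff_on_circle:
  assumes "cmod z = r" "r > 0"
  shows "cmod (z - a) = r * cmod (1 - cnj a * z / of_real (r\<^sup>2))"
proof -
  have "of_real (r\<^sup>2) - cnj a * z = z * cnj (z - a)"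
    using complex_norm_square[of z] assms by (simp add: algebra_simps)
  hence "cmod (of_real (r\<^sup>2) - cnj a * z) = r * cmod (z - a)"
    using assms by (simp add: norm_mult del: complex_cnj_diff)
  moreover have "1 - cnj a * z / of_real (r\<^sup>2) = (of_real (r\<^sup>2) - cnj a * z) / of_real (r\<^sup>2)"
    using assms by (simp add: field_simps)
  ultimately show ?thesis using assms by (simp add: norm_divide norm_mult norm_power power2_eq_square del: of_real_power)
qed

text \<open>For \<open>a\<close> outside the disc, \<open>z - a\<close> is zero-free. For
  \<open>a\<close> inside, it has on the circle the modulus of \<open>r\<close> times a zero-free
  function with value 1 at the origin. In both cases the mean is the value at 0.\<close>

lemma circ_mean_ln_dist:
  assumes r: "r > 0" and a: "cmod a \<noteq> r"
  shows "circ_mean (\<lambda>z. ln (cmod (z - a))) r = ln (max r (cmod a))"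
proof (cases "cmod a < r")
  case True
  have nz: "1 - cnj a * z / of_real (r\<^sup>2) \<noteq> 0" if "cmod z \<le> r" for z
    using blaschke_numerator_nonzero[OF True that] r by (simp add: field_simps)
  have "circ_mean (\<lambda>z. ln (cmod (z - a))) r = circ_mean (\<lambda>z. ln r + ln (cmod (1 - cnj a * z / of_real (r\<^sup>2)))) r"
  proof (rule circ_mean_cong)
    fix z :: complex assume z: "cmod z = r"
    show "ln (cmod (z - a)) = ln r + ln (cmod (1 - cnj a * z / of_real (r\<^sup>2)))"
      unfolding norm_diff_on_circle[OF z r] using nz[of z] z r by (intro ln_mult_pos) auto
  qed (use r in auto)
  also have "\<dots> = ln r + circ_mean (\<lambda>z. ln (cmod (1 - cnj a * z / of_real (r\<^sup>2)))) r"
    by (subst circ_mean_add) (use nz r in \<open>auto intro!: continuous_intros\<close>)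
  also have "circ_mean (\<lambda>z. ln (cmod (1 - cnj a * z / of_real (r\<^sup>2)))) r = ln (cmod (1 - cnj a * 0 / of_real (r\<^sup>2)))"
    by (rule circ_mean_ln_zero_free) (use nz r in \<open>auto intro!: analytic_intros\<close>)
  finally show ?thesis using True by simp
next
  case False
  hence ar: "cmod a > r" using a by simp
  have "circ_mean (\<lambda>z. ln (cmod (z - a))) r = ln (cmod (0 - a))"
    by (rule circ_mean_ln_zero_free) (use ar r in \<open>auto intro!: analytic_intros\<close>)
  thus ?thesis using ar by simp
qed

text \<open>\<open>F\<close> takes values in the right half plane, so the principal branch of \<open>1 / sqrt F\<close> has argument
  at most \<open>pi / 4\<close> and its modulus is at most \<open>sqrt 2\<close> times its real part.\<close>

lemma circ_mean_inverse_sqrt: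
  assumes F: "F analytic_on cball 0 r" "\<And>z. cmod z \<le> r \<Longrightarrow> Re (F z) > 0" "F 0 = 1" and r: "r > 0"
  shows "circ_mean (\<lambda>z. 1 / sqrt (cmod (F z))) r \<le> sqrt 2"
proof -
  define H where "H = (\<lambda>z. exp (- Ln (F z) / 2))"
  have Fh: "F holomorphic_on cball 0 r" using F(1) analytic_imp_holomorphic by blast
  have Fn: "F z \<notin> \<real>\<^sub>\<le>\<^sub>0" if "cmod z \<le> r" for z
    using F(2)[OF that] by (auto simp: complex_nonpos_Reals_iff)
  have Hh: "H holomorphic_on cball 0 r" unfolding H_def
    using Fn by (intro holomorphic_intros Fh) auto
  have contF: "continuous_on (sphere 0 r) F"
    by (rule holomorphic_on_imp_continuous_on, rule holomorphic_on_subset[OF Fh]) auto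
  have contH: "continuous_on (sphere 0 r) H"
    by (rule holomorphic_on_imp_continuous_on, rule holomorphic_on_subset[OF Hh]) auto
  have "circ_mean (\<lambda>z. 1 / sqrt (cmod (F z))) r \<le> circ_mean (\<lambda>z. sqrt 2 * Re (H z)) r"
  proof (rule circ_mean_mono)
    show "continuous_on (sphere 0 r) (\<lambda>z. 1 / sqrt (cmod (F z)))"
      using Fn by (intro continuous_intros contF) force
    show "continuous_on (sphere 0 r) (\<lambda>z. sqrt 2 * Re (H z))" by (intro continuous_intros contH)
    fix z :: complex assume z: "cmod z = r"
    have p: "Re (F z) > 0" using F(2) z by simp
    hence F0: "F z \<noteq> 0" by auto
    have "\<bar>Im (Ln (F z))\<bar> < pi / 2" using p Re_Ln_pos_lt[OF F0] by simp
    hence "cos (pi / 4) \<le> cos (\<bar>Im (Ln (F z)) / 2\<bar>)"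
      by (intro cos_monotone_0_pi_le) auto
    hence c: "sqrt 2 / 2 \<le> cos (Im (Ln (F z)) / 2)" unfolding cos_abs_real by (simp add: cos_45)
    have "exp (- ln (cmod (F z)) / 2) = 1 / sqrt (cmod (F z))"
      using F0 by (simp add: exp_minus inverse_eq_divide ln_sqrt[symmetric])
    hence "Re (H z) = 1 / sqrt (cmod (F z)) * cos (Im (Ln (F z)) / 2)"
      using F0 by (simp add: H_def Re_exp)
    hence "1 / sqrt (cmod (F z)) * (sqrt 2 / 2) \<le> Re (H z)" using c F0 by (simp add: divide_simps)
    hence "sqrt 2 * (1 / sqrt (cmod (F z)) * (sqrt 2 / 2)) \<le> sqrt 2 * Re (H z)" by (intro mult_left_mono) auto
    thus "1 / sqrt (cmod (F z)) \<le> sqrt 2 * Re (H z)" by simp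
  qed (use r in auto)
  also have "\<dots> = sqrt 2 * Re (H 0)"
    by (subst circ_mean_cmult, subst circ_mean_Re_holomorphic) (use Hh r in auto)
  also have "H 0 = 1" using F(3) by (simp add: H_def)
  finally show ?thesis by simp
qed

text \<open>The point is the uniformity in \<open>a\<close>: with exponent 1 instead of 1/2 the
  means would blow up as \<open>a\<close> approaches the circle. In both cases \<open>z - a\<close>
  is replaced by a constant times \<open>1 - w\<close> with \<open>cmod w < 1\<close>, which has
  positive real part.\<close>

lemma circ_mean_inverse_sqrt_dist:
  assumes r: "r > 0" and a: "cmod a \<noteq> r"
  shows "circ_mean (\<lambda>z. 1 / sqrt (cmod (z - a))) r \<le> sqrt 2 / sqrt r"
proof -
  have Re_pos: "Re (1 - w) > 0" if "cmod w < 1" for w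
    using that complex_Re_le_cmod[of w] by simp
  show ?thesis
  proof (cases "cmod a < r")
    case True
    have "cmod (cnj a * z / of_real (r\<^sup>2)) < 1" if "cmod z \<le> r" for z
    proof -
      have "cmod a * cmod z \<le> cmod a * r" using that by (intro mult_left_mono) auto
      also have "\<dots> < r * r" using True r by simp
      finally show ?thesis using r by (simp add: norm_divide norm_mult norm_power power2_eq_square)
    qed
    hence "Re (1 - cnj a * z / of_real (r\<^sup>2)) > 0" if "cmod z \<le> r" for z
      using that by (intro Re_pos)
    hence "circ_mean (\<lambda>z. 1 / sqrt (cmod (1 - cnj a * z / of_real (r\<^sup>2)))) r \<le> sqrt 2"
      by (rule circ_mean_inverse_sqrt[rotated]) (use r in \<open>auto intro!: analytic_intros\<close>)
    moreover have "circ_mean (\<lambda>z. 1 / sqrt (cmod (z - a))) r =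
         circ_mean (\<lambda>z. 1 / sqrt r * (1 / sqrt (cmod (1 - cnj a * z / of_real (r\<^sup>2))))) r"
    proof (rule circ_mean_cong)
      fix z :: complex assume z: "cmod z = r"
      show "1 / sqrt (cmod (z - a)) = 1 / sqrt r * (1 / sqrt (cmod (1 - cnj a * z / of_real (r\<^sup>2))))"
        unfolding norm_diff_on_circle[OF z r] by (simp add: real_sqrt_mult)
    qed (use r in auto)
    ultimately have "circ_mean (\<lambda>z. 1 / sqrt (cmod (z - a))) r \<le> 1 / sqrt r * sqrt 2"
      unfolding circ_mean_cmult using r by (simp only: mult_left_mono real_sqrt_ge_0_iff zero_le_divide_1_iff less_imp_le)
    thus ?thesis by simp
  next
    case False
    hence ar: "cmod a > r" using a by simp
    hence a0: "cmod a > 0" using r by linarith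
    have "cmod (z / a) < 1" if "cmod z \<le> r" for z
      using that ar a0 by (simp add: norm_divide)
    hence "circ_mean (\<lambda>z. 1 / sqrt (cmod (1 - z / a))) r \<le> sqrt 2"
      using r Re_pos a0 by (intro circ_mean_inverse_sqrt) (auto intro!: analytic_intros)
    moreover have "circ_mean (\<lambda>z. 1 / sqrt (cmod (z - a))) r =
         circ_mean (\<lambda>z. 1 / sqrt (cmod a) * (1 / sqrt (cmod (1 - z / a)))) r"
    proof (rule circ_mean_cong)
      fix z :: complex
      have "z - a = - a * (1 - z / a)" using a0 by (simp add: field_simps)
      hence "cmod (z - a) = cmod a * cmod (1 - z / a)" by (metis norm_minus_cancel norm_mult)
      thus "1 / sqrt (cmod (z - a)) = 1 / sqrt (cmod a) * (1 / sqrt (cmod (1 - z / a)))"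
        by (simp add: real_sqrt_mult)
    qed (use r in auto)
    ultimately have "circ_mean (\<lambda>z. 1 / sqrt (cmod (z - a))) r \<le> 1 / sqrt (cmod a) * sqrt 2"
      unfolding circ_mean_cmult using a0 by (simp only: mult_left_mono real_sqrt_ge_0_iff zero_le_divide_1_iff less_imp_le)
    also have "\<dots> \<le> 1 / sqrt r * sqrt 2" using ar r a0 by (intro mult_right_mono divide_left_mono) auto
    finally show ?thesis by simp
  qed
qed

subsection \<open>Counting functions\<close>

text \<open>Since \<open>ln 0 = 0\<close>, a weight at the origin contributes \<open>w 0 * ln r\<close>, which is the convention for
  integrated counting functions.\<close>

definition log_count :: "(complex \<Rightarrow> real) \<Rightarrow> real \<Rightarrow> real" where
  "log_count w r = (\<Sum>z | cmod z \<le> r \<and> w z \<noteq> 0. w z * (ln r - ln (cmod z)))"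

definition locally_finite_support :: "(complex \<Rightarrow> real) \<Rightarrow> bool" where
  "locally_finite_support w \<longleftrightarrow> (\<forall>r. finite {z. cmod z \<le> r \<and> w z \<noteq> 0})"

lemma log_count_superset:
  assumes "finite S" "\<And>z. cmod z \<le> r \<Longrightarrow> w z \<noteq> 0 \<Longrightarrow> z \<in> S" "S \<subseteq> cball 0 r"
  shows "log_count w r = (\<Sum>z\<in>S. w z * (ln r - ln (cmod z)))"
  unfolding log_count_def by (rule sum.mono_neutral_left) (use assms in auto)

lemma has_integral_inverse_restrict:
  fixes a r :: real
  assumes "0 < a" "a \<le> r"
  shows "((\<lambda>t. if a \<le> t then 1 / t else 0) has_integral (ln r - ln a)) {0..r}"
proof -
  have "((\<lambda>t. 1 / t) has_integral (ln r - ln a)) {a..r}"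
    by (rule fundamental_theorem_of_calculus)
       (use assms in \<open>auto intro!: derivative_eq_intros simp: has_real_derivative_iff_has_vector_derivative[symmetric]\<close>)
  hence "((\<lambda>t. if t \<in> {a..r} then 1 / t else 0) has_integral (ln r - ln a)) {0..r}"
    using assms by (subst has_integral_restrict) auto
  thus ?thesis by (rule has_integral_eq[rotated]) auto
qed

text \<open>A point \<open>z \<noteq> 0\<close> enters the integrand as \<open>1 / t\<close> from
  \<open>t = cmod z\<close> on and integrates to \<open>ln r - ln (cmod z)\<close>. The weight of
  the origin is removed by \<open>n 0\<close> and restored by \<open>n 0 * ln r\<close>.\<close>

lemma integrated_count_eq_log_count:
  assumes w: "locally_finite_support w" and r: "r > 0"
  shows "integrated_count (\<lambda>t. \<Sum>z | cmod z \<le> t \<and> w z \<noteq> 0. w z) r = log_count w r"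
proof -
  define A where "A = {z. cmod z \<le> r \<and> w z \<noteq> 0}"
  define n where "n = (\<lambda>t. \<Sum>z | cmod z \<le> t \<and> w z \<noteq> 0. w z)"
  have A: "finite A" using w by (simp add: A_def locally_finite_support_def)
  have n0: "n 0 = w 0"
  proof -
    have "{z. cmod z \<le> 0 \<and> w z \<noteq> 0} = (if w 0 = 0 then {} else {0})" by auto
    thus ?thesis unfolding n_def by simp
  qed
  have "((\<lambda>t. \<Sum>z\<in>A - {0}. w z * (if cmod z \<le> t then 1 / t else 0)) has_integral
          (\<Sum>z\<in>A - {0}. w z * (ln r - ln (cmod z)))) {0..r}"
    using A by (intro has_integral_sum has_integral_mult_right has_integral_inverse_restrict) (auto simp: A_def)
  moreover have "(\<Sum>z\<in>A - {0}. w z * (if cmod z \<le> t then 1 / t else 0)) = (n t - n 0) / t" if t: "t \<in> {0..r}" for t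
  proof -
    have fin: "finite {z. cmod z \<le> t \<and> w z \<noteq> 0}" using w by (simp add: locally_finite_support_def)
    have "n t = (\<Sum>z\<in>insert 0 {z. cmod z \<le> t \<and> w z \<noteq> 0}. w z)"
      unfolding n_def by (rule sum.mono_neutral_left) (use fin t in auto)
    also have "\<dots> = w 0 + (\<Sum>z\<in>{z. cmod z \<le> t \<and> w z \<noteq> 0} - {0}. w z)"
      using fin by (simp add: sum.insert_remove)
    finally have "(n t - n 0) / t = (\<Sum>z\<in>{z. cmod z \<le> t \<and> w z \<noteq> 0} - {0}. w z) / t" by (simp add: n0)
    also have "\<dots> = (\<Sum>z\<in>{z. cmod z \<le> t \<and> w z \<noteq> 0} - {0}. w z * (if cmod z \<le> t then 1 / t else 0))"
      unfolding sum_divide_distrib by (intro sum.cong) auto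
    also have "\<dots> = (\<Sum>z\<in>A - {0}. w z * (if cmod z \<le> t then 1 / t else 0))"
      using t A by (intro sum.mono_neutral_left) (auto simp: A_def)
    finally show ?thesis by simp
  qed
  ultimately have "((\<lambda>t. (n t - n 0) / t) has_integral (\<Sum>z\<in>A - {0}. w z * (ln r - ln (cmod z)))) {0..r}"
    by (rule has_integral_eq[rotated]) auto
  hence "integral {0..r} (\<lambda>t. (n t - n 0) / t) = (\<Sum>z\<in>A - {0}. w z * (ln r - ln (cmod z)))"
    by (rule integral_unique)
  hence "integrated_count n r = (\<Sum>z\<in>insert 0 A. w z * (ln r - ln (cmod z)))"
    using A by (simp add: integrated_count_def n0 sum.insert_remove)
  also have "\<dots> = log_count w r"
    by (rule log_count_superset[symmetric]) (use A r in \<open>auto simp: A_def\<close>)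
  finally show ?thesis by (simp add: n_def)
qed

lemma locally_finite_support_mono:
  assumes "locally_finite_support w" "\<And>z. w z = 0 \<Longrightarrow> v z = 0"
  shows "locally_finite_support v"
  unfolding locally_finite_support_def
proof
  fix r
  show "finite {z. cmod z \<le> r \<and> v z \<noteq> 0}"
    by (rule finite_subset[of _ "{z. cmod z \<le> r \<and> w z \<noteq> 0}"])
       (use assms in \<open>auto simp: locally_finite_support_def\<close>)
qed

lemma locally_finite_support_add:
  assumes "locally_finite_support w" "locally_finite_support v"
  shows "locally_finite_support (\<lambda>z. w z + v z)"
  unfolding locally_finite_support_def
proof
  fix r
  show "finite {z. cmod z \<le> r \<and> w z + v z \<noteq> 0}"
    by (rule finite_subset[of _ "{z. cmod z \<le> r \<and> w z \<noteq> 0} \<union> {z. cmod z \<le> r \<and> v z \<noteq> 0}"])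
       (use assms in \<open>auto simp: locally_finite_support_def\<close>)
qed

lemma locally_finite_support_cmult:
  "locally_finite_support w \<Longrightarrow> locally_finite_support (\<lambda>z. c * w z)"
  by (erule locally_finite_support_mono) auto

lemma locally_finite_supportD:
  "locally_finite_support w \<Longrightarrow> finite {z. cmod z \<le> r \<and> w z \<noteq> 0}"
  by (simp add: locally_finite_support_def)

lemma log_count_add:
  assumes "locally_finite_support w" "locally_finite_support v"
  shows "log_count (\<lambda>z. w z + v z) r = log_count w r + log_count v r"
proof -
  let ?S = "{z. cmod z \<le> r \<and> w z \<noteq> 0} \<union> {z. cmod z \<le> r \<and> v z \<noteq> 0}"
  have S: "finite ?S" using assms by (auto simp: locally_finite_support_def)
  have "log_count (\<lambda>z. w z + v z) r = (\<Sum>z\<in>?S. (w z + v z) * (ln r - ln (cmod z)))"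
    using S by (intro log_count_superset) auto
  moreover have "log_count w r = (\<Sum>z\<in>?S. w z * (ln r - ln (cmod z)))"
    using S by (intro log_count_superset) auto
  moreover have "log_count v r = (\<Sum>z\<in>?S. v z * (ln r - ln (cmod z)))"
    using S by (intro log_count_superset) auto
  ultimately show ?thesis by (simp only: sum.distrib distrib_right)
qed

lemma log_count_cmult: "log_count (\<lambda>z. c * w z) r = c * log_count w r"
  by (cases "c = 0") (auto simp: log_count_def sum_distrib_left mult_ac)

text \<open>At the origin the convention \<open>ln 0 = 0\<close> leaves \<open>ln r\<close>, which
  is why \<open>r\<close> has to be at least 1.\<close>

lemma ln_diff_norm_nonneg: "r \<ge> 1 \<Longrightarrow> cmod z \<le> r \<Longrightarrow> ln r - ln (cmod z) \<ge> 0"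
  by (cases "z = 0") auto

lemma log_count_mono:
  assumes "locally_finite_support v" "\<And>z. w z \<le> v z" "\<And>z. 0 \<le> w z" "r \<ge> 1"
  shows "log_count w r \<le> log_count v r"
proof -
  let ?S = "{z. cmod z \<le> r \<and> v z \<noteq> 0}"
  have S: "finite ?S" using assms(1) by (rule locally_finite_supportD)
  have vz: "w z = 0" if "v z = 0" for z using assms(2,3)[of z] that by simp
  have "log_count w r = (\<Sum>z\<in>?S. w z * (ln r - ln (cmod z)))"
    using S vz by (intro log_count_superset) auto
  also have "\<dots> \<le> (\<Sum>z\<in>?S. v z * (ln r - ln (cmod z)))"
    using assms ln_diff_norm_nonneg by (intro sum_mono mult_right_mono) auto
  finally show ?thesis by (simp add: log_count_def)
qed

lemma log_count_nonneg:
  assumes "\<And>z. 0 \<le> w z" "r \<ge> 1"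
  shows "log_count w r \<ge> 0"
  unfolding log_count_def using assms ln_diff_norm_nonneg by (intro sum_nonneg mult_nonneg_nonneg) auto

text \<open>The form with \<open>max r (cmod z)\<close> is the one that circle means of Blaschke
  factors produce when the characteristic is shown to be monotone.\<close>

lemma log_count_diff:
  assumes w: "locally_finite_support w" and r: "0 < r" "r \<le> R"
  shows "log_count w R - log_count w r =
    (\<Sum>z | cmod z \<le> R \<and> w z \<noteq> 0. w z * (ln R - ln (max r (cmod z))))"
proof -
  let ?A = "{z. cmod z \<le> r \<and> w z \<noteq> 0}" and ?B = "{z. cmod z \<le> R \<and> w z \<noteq> 0}"
  have fin: "finite ?B" using w by (rule locally_finite_supportD)
  have "log_count w r = (\<Sum>z\<in>?B. if cmod z \<le> r then w z * (ln r - ln (cmod z)) else 0)"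
    unfolding log_count_def using fin r by (intro sum.mono_neutral_cong_left) auto
  hence "log_count w R - log_count w r = (\<Sum>z\<in>?B. w z * (ln R - ln (cmod z)) - (if cmod z \<le> r then w z * (ln r - ln (cmod z)) else 0))"
    by (simp add: log_count_def sum_subtractf)
  also have "\<dots> = (\<Sum>z\<in>?B. w z * (ln R - ln (max r (cmod z))))"
    by (intro sum.cong) (auto simp: algebra_simps max_def)
  finally show ?thesis .
qed

text \<open>Every point in the smaller disc has weight at least \<open>ln R - ln r\<close> in the
  integrated count at \<open>R\<close>. This converts bounds for N into bounds for the number of
  points.\<close>

lemma count_le_log_count:
  assumes w: "locally_finite_support w" "\<And>z. w z \<ge> 0" and r: "1 \<le> r" "r < R"
  shows "(\<Sum>z | cmod z \<le> r \<and> w z \<noteq> 0. w z) * (ln R - ln r) \<le> log_count w R"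
proof -
  have fin: "finite {z. cmod z \<le> R \<and> w z \<noteq> 0}" using w(1) by (rule locally_finite_supportD)
  have "(\<Sum>z | cmod z \<le> r \<and> w z \<noteq> 0. w z) * (ln R - ln r) =
        (\<Sum>z | cmod z \<le> r \<and> w z \<noteq> 0. w z * (ln R - ln (max r (cmod z))))"
    unfolding sum_distrib_right by (intro sum.cong) (auto simp: max_def)
  also have "\<dots> \<le> (\<Sum>z | cmod z \<le> R \<and> w z \<noteq> 0. w z * (ln R - ln (max r (cmod z))))"
  proof (intro sum_mono2 mult_nonneg_nonneg w(2))
    fix z assume "z \<in> {z. cmod z \<le> R \<and> w z \<noteq> 0} - {z. cmod z \<le> r \<and> w z \<noteq> 0}"
    hence "0 < max r (cmod z)" "max r (cmod z) \<le> R" using r by auto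
    hence "ln (max r (cmod z)) \<le> ln R" by (subst ln_le_cancel_iff) auto
    thus "0 \<le> ln R - ln (max r (cmod z))" by simp
  qed (use fin r in auto)
  also have "\<dots> = log_count w R - log_count w r"
    using w r by (intro log_count_diff[symmetric]) auto
  also have "\<dots> \<le> log_count w R" using log_count_nonneg[of w r] w r by simp
  finally show ?thesis .
qed

lemma log_count_finite_support:
  assumes "finite {z. w z \<noteq> 0}"
  shows "(\<lambda>r. log_count w r) \<in> O(\<lambda>r. ln r)"
proof (rule bigoI[where c = "\<Sum>z | w z \<noteq> 0. \<bar>w z\<bar> * (1 + \<bar>ln (cmod z)\<bar>)"])
  show "eventually (\<lambda>r. norm (log_count w r) \<le> (\<Sum>z | w z \<noteq> 0. \<bar>w z\<bar> * (1 + \<bar>ln (cmod z)\<bar>)) * norm (ln r)) at_top"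
    using eventually_ge_at_top[of "exp 1"]
  proof eventually_elim
    case (elim r)
    hence "r > 0" using exp_gt_zero[of 1] by linarith
    hence ln1: "ln r \<ge> 1" using elim ln_ge_iff by auto
    have "norm (log_count w r) \<le> (\<Sum>z | cmod z \<le> r \<and> w z \<noteq> 0. norm (w z * (ln r - ln (cmod z))))"
      unfolding log_count_def by (rule norm_sum)
    also have "\<dots> \<le> (\<Sum>z | w z \<noteq> 0. norm (w z * (ln r - ln (cmod z))))"
      using assms by (intro sum_mono2) auto
    also have "\<dots> \<le> (\<Sum>z | w z \<noteq> 0. \<bar>w z\<bar> * (1 + \<bar>ln (cmod z)\<bar>) * ln r)"
    proof (intro sum_mono)
      fix z
      have "\<bar>ln r - ln (cmod z)\<bar> \<le> \<bar>ln r\<bar> + \<bar>ln (cmod z)\<bar> * 1" by simp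
      also have "\<dots> \<le> ln r + \<bar>ln (cmod z)\<bar> * ln r" using ln1 by (intro add_mono mult_left_mono) auto
      finally have "\<bar>ln r - ln (cmod z)\<bar> \<le> (1 + \<bar>ln (cmod z)\<bar>) * ln r" by (simp add: algebra_simps)
      thus "norm (w z * (ln r - ln (cmod z))) \<le> \<bar>w z\<bar> * (1 + \<bar>ln (cmod z)\<bar>) * ln r"
        by (simp add: abs_mult mult_left_mono mult.assoc)
    qed
    finally show ?case using ln1 by (simp add: sum_distrib_right)
  qed
qed

section \<open>Counting functions of poles and the calculus of pole multiplicities\<close>

lemma finite_poles_cball:
  assumes "f meromorphic_on UNIV"
  shows "finite {z. cmod z \<le> r \<and> is_pole f z}"
proof -
  have "{z. is_pole f z} sparse_in UNIV"
    using meromorphic_on_imp_not_pole_cosparse[OF assms] by (simp add: eventually_cosparse)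
  hence "{z. is_pole f z} sparse_in (cball 0 r)" by (rule sparse_in_subset) auto
  hence "finite (cball 0 r \<inter> {z. is_pole f z})" by (rule sparse_in_compact_finite) auto
  thus ?thesis by (rule finite_subset[rotated]) auto
qed

lemma pole_mult_eq_0_iff:
  assumes "f meromorphic_on {z}"
  shows "pole_mult f z = 0 \<longleftrightarrow> \<not>is_pole f z"
  using assms isolated_pole_imp_neg_zorder[of f z] by (auto simp: pole_mult_def meromorphic_at_iff)

lemma meromorphic_on_UNIV_at: "f meromorphic_on UNIV \<Longrightarrow> f meromorphic_on {z}"
  by (rule meromorphic_on_subset) auto

lemma locally_finite_support_pole_mult:
  assumes "f meromorphic_on UNIV"
  shows "locally_finite_support (\<lambda>z. real (pole_mult f z))"
  unfolding locally_finite_support_def using finite_poles_cball[OF assms] pole_mult_eq_0_iff[OF meromorphic_on_UNIV_at[OF assms]]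
  by simp

lemma locally_finite_support_pole:
  assumes "f meromorphic_on UNIV"
  shows "locally_finite_support (\<lambda>z. of_bool (is_pole f z))"
  unfolding locally_finite_support_def using finite_poles_cball[OF assms] by simp

lemma N_count_eq:
  assumes "f meromorphic_on UNIV" "r > 0"
  shows "N_count f r = log_count (\<lambda>z. real (pole_mult f z)) r"
proof -
  have "pole_count f = (\<lambda>t. \<Sum>z | cmod z \<le> t \<and> real (pole_mult f z) \<noteq> 0. real (pole_mult f z))"
    using pole_mult_eq_0_iff[OF meromorphic_on_UNIV_at[OF assms(1)]] by (simp add: pole_count_def fun_eq_iff)
  thus ?thesis using integrated_count_eq_log_count[OF locally_finite_support_pole_mult[OF assms(1)] assms(2)]
    by (simp add: N_count_def)
qed

lemma N_count_bar_eq: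
  assumes "f meromorphic_on UNIV" "r > 0"
  shows "N_count_bar f r = log_count (\<lambda>z. of_bool (is_pole f z)) r"
proof -
  have "pole_count_bar f = (\<lambda>t. \<Sum>z | cmod z \<le> t \<and> (of_bool (is_pole f z) :: real) \<noteq> 0. of_bool (is_pole f z))"
    by (simp add: pole_count_bar_def fun_eq_iff)
  thus ?thesis using integrated_count_eq_log_count[OF locally_finite_support_pole[OF assms(1)] assms(2)]
    by (simp add: N_count_bar_def)
qed

lemma N_count_nonneg: "f meromorphic_on UNIV \<Longrightarrow> r \<ge> 1 \<Longrightarrow> N_count f r \<ge> 0"
  by (simp add: N_count_eq log_count_nonneg)

lemma N_count_finite_poles:
  assumes "f meromorphic_on UNIV" "finite {z. is_pole f z}"
  shows "N_count f \<in> O(\<lambda>r. ln r)"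
proof -
  have "(\<lambda>r. log_count (\<lambda>z. real (pole_mult f z)) r) \<in> O(\<lambda>r. ln r)"
    using assms pole_mult_eq_0_iff[OF meromorphic_on_UNIV_at[OF assms(1)]] by (intro log_count_finite_support) simp
  moreover have "eventually (\<lambda>r. N_count f r = log_count (\<lambda>z. real (pole_mult f z)) r) at_top"
    using eventually_gt_at_top[of 0] by eventually_elim (use assms N_count_eq in auto)
  ultimately show ?thesis by (simp add: landau_o.big.in_cong)
qed

text \<open>A description free of case distinctions between poles, regular points and functions
  vanishing near \<open>z\<close>: sums, products and derivatives can then be treated by computing
  with the analytic functions \<open>F\<close>.\<close>

lemma pole_mult_le_iff:
  assumes f: "f meromorphic_on {z}"
  shows "pole_mult f z \<le> k \<longleftrightarrow>
    (\<exists>F. F analytic_on {z} \<and> eventually (\<lambda>w. f w * (w - z) ^ k = F w) (at z))"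
proof
  assume k: "pole_mult f z \<le> k"
  show "\<exists>F. F analytic_on {z} \<and> eventually (\<lambda>w. f w * (w - z) ^ k = F w) (at z)"
  proof (cases "frequently (\<lambda>w. f w \<noteq> 0) (at z)")
    case False
    hence "eventually (\<lambda>w. f w * (w - z) ^ k = 0) (at z)"
      by (simp add: not_frequently eventually_mono)
    thus ?thesis by (intro exI[of _ "\<lambda>_. 0"]) auto
  next
    case True
    note lf = meromorphic_local_form[OF f True]
    have ge: "zorder f z + int k \<ge> 0"
    proof (cases "is_pole f z")
      case False
      hence "zorder f z \<ge> 0"
        using neg_zorder_imp_is_pole[of f z] True f by (force simp: meromorphic_at_iff)
      thus ?thesis by simp
    qed (use k in \<open>auto simp: pole_mult_def\<close>)
    show ?thesis
    proof (intro exI[of _ "\<lambda>w. zor_poly f z w * (w - z) ^ nat (zorder f z + int k)"] conjI)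
      show "(\<lambda>w. zor_poly f z w * (w - z) ^ nat (zorder f z + int k)) analytic_on {z}"
        using lf by (intro analytic_intros) auto
      have "eventually (\<lambda>w. w \<noteq> z) (at z)" by (simp add: eventually_at_filter)
      with lf(3) show "eventually (\<lambda>w. f w * (w - z) ^ k = zor_poly f z w * (w - z) ^ nat (zorder f z + int k)) (at z)"
      proof eventually_elim
        case (elim w)
        have "(w - z) ^ nat (zorder f z + int k) = (w - z) powi (zorder f z + int k)"
          using ge by (simp add: power_int_def)
        also have "\<dots> = (w - z) powi zorder f z * (w - z) ^ k"
          using elim by (subst power_int_add) auto
        finally show ?case using elim by simp
      qed
    qed
  qed
next
  assume "\<exists>F. F analytic_on {z} \<and> eventually (\<lambda>w. f w * (w - z) ^ k = F w) (at z)"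
  then obtain F where F: "F analytic_on {z}" "eventually (\<lambda>w. f w * (w - z) ^ k = F w) (at z)" by blast
  show "pole_mult f z \<le> k"
  proof (rule ccontr)
    assume "\<not> pole_mult f z \<le> k"
    hence p: "is_pole f z" "- zorder f z > int k" by (auto simp: pole_mult_def split: if_splits)
    have ev: "eventually (\<lambda>w. f w \<noteq> 0) (at z)" using p(1) f
      by (simp add: meromorphic_at_iff non_zero_neighbour_pole)
    have "eventually (\<lambda>w. w \<noteq> z) (at z)" by (simp add: eventually_at_filter)
    hence ev2: "eventually (\<lambda>w. (w - z) ^ k \<noteq> 0) (at z)" by eventually_elim simp
    have mero: "(\<lambda>w. (w - z) ^ k) meromorphic_on {z}" by (intro meromorphic_intros)
    have "zorder (\<lambda>w. (w - z) ^ k) z = int k"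
      by (rule zorder_eqI[of UNIV _ "\<lambda>_. 1"]) auto
    hence "zorder (\<lambda>w. f w * (w - z) ^ k) z = zorder f z + int k"
      using zorder_mult[OF f _ mero] ev ev2 by (simp add: eventually_frequently)
    moreover have "eventually (\<lambda>w. f w * (w - z) ^ k \<noteq> 0) (at z)"
      using ev ev2 by eventually_elim simp
    moreover have "(\<lambda>w. f w * (w - z) ^ k) meromorphic_on {z}" by (intro meromorphic_intros f)
    ultimately have "is_pole (\<lambda>w. f w * (w - z) ^ k) z"
      using p(2) by (intro zorder_neg_imp_is_pole) auto
    hence "is_pole F z" using is_pole_cong[OF F(2) refl] by simp
    thus False using F(1) analytic_at_imp_no_pole by blast
  qed
qed

lemma pole_mult_add:
  assumes "f meromorphic_on {z}" "g meromorphic_on {z}" "pole_mult f z \<le> k" "pole_mult g z \<le> k"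
  shows "pole_mult (\<lambda>w. f w + g w) z \<le> k"
proof -
  obtain F where F: "F analytic_on {z}" "eventually (\<lambda>w. f w * (w - z) ^ k = F w) (at z)"
    using assms pole_mult_le_iff by blast
  obtain G where G: "G analytic_on {z}" "eventually (\<lambda>w. g w * (w - z) ^ k = G w) (at z)"
    using assms pole_mult_le_iff by blast
  have "(\<lambda>w. F w + G w) analytic_on {z}" using F G by (intro analytic_intros)
  moreover have "eventually (\<lambda>w. (f w + g w) * (w - z) ^ k = F w + G w) (at z)"
    using F(2) G(2) by eventually_elim (simp add: ring_distribs)
  moreover have "(\<lambda>w. f w + g w) meromorphic_on {z}" using assms by (intro meromorphic_intros)
  ultimately show ?thesis using pole_mult_le_iff by blast
qed

lemma pole_mult_mult:
  assumes "f meromorphic_on {z}" "g meromorphic_on {z}"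
  shows "pole_mult (\<lambda>w. f w * g w) z \<le> pole_mult f z + pole_mult g z"
proof -
  obtain F where F: "F analytic_on {z}" "eventually (\<lambda>w. f w * (w - z) ^ pole_mult f z = F w) (at z)"
    using assms pole_mult_le_iff by blast
  obtain G where G: "G analytic_on {z}" "eventually (\<lambda>w. g w * (w - z) ^ pole_mult g z = G w) (at z)"
    using assms pole_mult_le_iff by blast
  have "(\<lambda>w. F w * G w) analytic_on {z}" using F G by (intro analytic_intros)
  moreover have "eventually (\<lambda>w. (f w * g w) * (w - z) ^ (pole_mult f z + pole_mult g z) = F w * G w) (at z)"
    using F(2) G(2)
  proof eventually_elim
    case (elim w)
    show ?case unfolding elim[symmetric] by (simp add: power_add mult_ac)
  qed
  moreover have "(\<lambda>w. f w * g w) meromorphic_on {z}" using assms by (intro meromorphic_intros)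
  ultimately show ?thesis using pole_mult_le_iff by blast
qed

lemma pole_mult_cong:
  assumes "eventually (\<lambda>w. f w = g w) (at z)"
  shows "pole_mult f z = pole_mult g z"
  using is_pole_cong[OF assms refl] zorder_cong[OF assms refl] by (simp add: pole_mult_def)

lemma pole_mult_analytic: "f analytic_on {z} \<Longrightarrow> pole_mult f z = 0"
  by (simp add: pole_mult_def analytic_at_imp_no_pole)

text \<open>Differentiating \<open>f w = F w / (w - z)^k\<close> gives
  \<open>deriv f w * (w - z)^(k + 1) = deriv F w * (w - z) - k * F w\<close>, whose right-hand side
  is analytic.\<close>

lemma pole_mult_deriv:
  assumes f: "f meromorphic_on {z}"
  shows "pole_mult (deriv f) z \<le> pole_mult f z + 1"
proof -
  define k where "k = pole_mult f z"
  obtain F where F: "F analytic_on {z}" "eventually (\<lambda>w. f w * (w - z) ^ k = F w) (at z)"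
    using f pole_mult_le_iff[of f z k] k_def by blast
  obtain U where U: "open U" "z \<in> U" "\<And>w. w \<in> U - {z} \<Longrightarrow> f w * (w - z) ^ k = F w"
    using F(2) unfolding eventually_at_topological by blast
  obtain V where V: "open V" "z \<in> V" "F holomorphic_on V"
    using F(1) unfolding analytic_at by blast
  define W where "W = (U \<inter> V) - {z}"
  have W: "open W" using U V by (auto simp: W_def)
  have "eventually (\<lambda>w. w \<in> W) (at z)"
    unfolding W_def using U V by (intro eventually_at_in_open) auto
  hence "eventually (\<lambda>w. deriv f w * (w - z) ^ (k + 1) = deriv F w * (w - z) - of_nat k * F w) (at z)"
  proof eventually_elim
    case (elim w)
    have wz: "w \<noteq> z" using elim by (auto simp: W_def)
    have dF: "(F has_field_derivative deriv F w) (at w)"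
      using V elim by (intro holomorphic_derivI[of F V]) (auto simp: W_def)
    have "((\<lambda>w. F w / (w - z) ^ k) has_field_derivative
       (deriv F w * (w - z) ^ k - F w * (of_nat k * (w - z) ^ (k - 1))) / ((w - z) ^ k * (w - z) ^ k)) (at w)"
      using wz dF by (auto intro!: derivative_eq_intros)
    hence "(f has_field_derivative
       (deriv F w * (w - z) ^ k - F w * (of_nat k * (w - z) ^ (k - 1))) / ((w - z) ^ k * (w - z) ^ k)) (at w)"
    proof (rule has_field_derivative_transform_within_open[OF _ W elim])
      fix x assume x: "x \<in> W"
      hence "f x * (x - z) ^ k = F x" "x \<noteq> z" using U(3) by (auto simp: W_def)
      thus "F x / (x - z) ^ k = f x" by (simp add: field_simps)
    qed
    hence "deriv f w = (deriv F w * (w - z) ^ k - F w * (of_nat k * (w - z) ^ (k - 1))) / ((w - z) ^ k * (w - z) ^ k)"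
      by (rule DERIV_imp_deriv)
    moreover have "(p * (x * y) - q * (c * y)) / ((x * y) * (x * y)) * (x * (x * y)) = p * x - c * q"
      if "x \<noteq> 0" "y \<noteq> 0" for p q c x y :: complex
      using that by (simp add: field_simps)
    ultimately show ?case using wz by (cases k) simp_all
  qed
  moreover have "(\<lambda>w. deriv F w * (w - z) - of_nat k * F w) analytic_on {z}"
    using F(1) by (intro analytic_intros) auto
  moreover have "deriv f meromorphic_on {z}" using f by (rule meromorphic_on_deriv)
  ultimately show ?thesis using pole_mult_le_iff[of "deriv f" z "k + 1"] by (auto simp: k_def)
qed

text \<open>At a pole the multiplicity is at least 1, so raising it by 1 at most doubles it;
  elsewhere the derivative has no pole either. A multiplicative bound is what passes to counting
  functions.\<close>

lemma pole_mult_deriv_le_double: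
  assumes f: "f meromorphic_on {z}"
  shows "pole_mult (deriv f) z \<le> 2 * pole_mult f z"
proof (cases "is_pole f z")
  case True
  hence "pole_mult f z \<noteq> 0" using pole_mult_eq_0_iff[OF f] by simp
  thus ?thesis using pole_mult_deriv[OF f] by simp
next
  case False
  hence "pole_mult (deriv f) z = 0"
    using is_pole_deriv_iff[OF f] pole_mult_eq_0_iff[OF meromorphic_on_deriv[OF f]] by simp
  thus ?thesis by simp
qed

text \<open>Splits the signed order in Jensen's formula into the contributions of zeros and of
  poles, that is, of the counting functions of \<open>1 / g\<close> and \<open>g\<close>.\<close>

lemma zorder_eq_pole_mults:
  assumes g: "g meromorphic_on {z}" "eventually (\<lambda>w. g w \<noteq> 0) (at z)"
  shows "zorder g z = int (pole_mult (\<lambda>w. inverse (g w)) z) - int (pole_mult g z)"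
proof -
  have inv: "zorder (\<lambda>w. inverse (g w)) z = - zorder g z"
    using zorder_power_int[of g z "-1"] g by (simp add: eventually_frequently power_int_minus)
  have mi: "(\<lambda>w. inverse (g w)) meromorphic_on {z}" using g by (intro meromorphic_intros)
  consider "zorder g z < 0" | "zorder g z > 0" | "zorder g z = 0" by linarith
  thus ?thesis
  proof cases
    case 1
    hence "is_pole g z" using zorder_neg_imp_is_pole g by blast
    moreover from this have "\<not>is_pole (\<lambda>w. inverse (g w)) z"
      using pole_is_not_zero[of g z] by (simp add: is_pole_inverse_iff)
    ultimately show ?thesis using 1 unfolding pole_mult_def by simp
  next
    case 2
    hence "isolated_zero g z" using zorder_pos_imp_isolated_zero g by blast
    moreover from this have "is_pole (\<lambda>w. inverse (g w)) z" "\<not>is_pole g z"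
      using is_pole_inverse_iff pole_is_not_zero by blast+
    ultimately show ?thesis using 2 inv by (simp add: pole_mult_def)
  next
    case 3
    have "\<not>is_pole g z" using 3 isolated_pole_imp_neg_zorder[of g z] g by (auto simp: meromorphic_at_iff)
    moreover have "\<not>is_pole (\<lambda>w. inverse (g w)) z"
      using 3 inv isolated_pole_imp_neg_zorder[of "\<lambda>w. inverse (g w)" z] mi by (auto simp: meromorphic_at_iff)
    ultimately show ?thesis using 3 by (simp add: pole_mult_def)
  qed
qed

section \<open>Logarithmic derivatives near a point\<close>

lemma logderiv_local_form:
  assumes f: "f meromorphic_on {z}" "eventually (\<lambda>w. f w \<noteq> 0) (at z)"
  obtains H where "H analytic_on {z}"
    "eventually (\<lambda>w. deriv f w / f w = of_int (zorder f z) / (w - z) + H w) (at z)"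
proof -
  define P where "P = zor_poly f z"
  define m where "m = zorder f z"
  have fr: "frequently (\<lambda>w. f w \<noteq> 0) (at z)" using f(2) by (simp add: eventually_frequently)
  note lf = meromorphic_local_form[OF f(1) fr, folded P_def m_def]
  obtain U where U: "open U" "z \<in> U" "\<And>w. w \<in> U - {z} \<Longrightarrow> f w = P w * (w - z) powi m"
    using lf(3) unfolding eventually_at_topological by blast
  obtain V where V: "open V" "z \<in> V" "P holomorphic_on V"
    using lf(1) unfolding analytic_at by blast
  have "eventually (\<lambda>w. P w \<noteq> 0) (at z)"
    using lf(1,2) by (simp add: analytic_at_neq_imp_eventually_neq)
  moreover define W where "W = (U \<inter> V) - {z}"
  have W: "open W" using U V by (auto simp: W_def)
  have "eventually (\<lambda>w. w \<in> W) (at z)"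
    unfolding W_def using U V by (intro eventually_at_in_open) auto
  ultimately have "eventually (\<lambda>w. deriv f w / f w = of_int m / (w - z) + deriv P w / P w) (at z)"
  proof eventually_elim
    case (elim w)
    have wz: "w \<noteq> z" using elim by (auto simp: W_def)
    have dP: "(P has_field_derivative deriv P w) (at w)"
      using V elim by (intro holomorphic_derivI[of P V]) (auto simp: W_def)
    have "((\<lambda>w. P w * (w - z) powi m) has_field_derivative
       deriv P w * (w - z) powi m + of_int m * (w - z) powi (m - 1) * P w) (at w)"
      using wz dP by (auto intro!: derivative_eq_intros)
    hence "(f has_field_derivative
       deriv P w * (w - z) powi m + of_int m * (w - z) powi (m - 1) * P w) (at w)"
      by (rule has_field_derivative_transform_within_open[OF _ W elim(2)]) (use U(3) in \<open>auto simp: W_def\<close>)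
    hence "deriv f w = deriv P w * (w - z) powi m + of_int m * (w - z) powi (m - 1) * P w"
      by (rule DERIV_imp_deriv)
    moreover have "f w = P w * (w - z) powi m" using elim U(3) by (auto simp: W_def)
    moreover have "(p * x + m * (x / y) * q) / (q * x) = m / y + p / q" if "x \<noteq> 0" "y \<noteq> 0" "q \<noteq> 0" for p q x y m :: complex
      using that by (simp add: field_simps)
    moreover have "(w - z) powi (m - 1) = (w - z) powi m / (w - z)" using wz by (simp add: power_int_diff)
    ultimately show ?case using wz elim(1) by simp
  qed
  moreover have "(\<lambda>w. deriv P w / P w) analytic_on {z}"
    using lf by (intro analytic_intros) auto
  ultimately show ?thesis using that by (auto simp: m_def)
qed

text \<open>Whatever the order of \<open>f\<close> at \<open>z\<close>, the logarithmic derivative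
  has at most a simple pole. This is the source of the counting functions without multiplicity in
  the second alternative.\<close>

lemma pole_mult_logderiv:
  assumes f: "f meromorphic_on {z}" "eventually (\<lambda>w. f w \<noteq> 0) (at z)"
  shows "pole_mult (\<lambda>w. deriv f w / f w) z \<le> of_bool (is_pole f z) + of_bool (is_pole (\<lambda>w. inverse (f w)) z)"
proof -
  obtain H where H: "H analytic_on {z}"
    "eventually (\<lambda>w. deriv f w / f w = of_int (zorder f z) / (w - z) + H w) (at z)"
    using logderiv_local_form[OF f] by blast
  have mero: "(\<lambda>w. deriv f w / f w) meromorphic_on {z}" by (intro meromorphic_intros f)
  show ?thesis
  proof (cases "is_pole f z \<or> is_pole (\<lambda>w. inverse (f w)) z")
    case True
    have "eventually (\<lambda>w. w \<noteq> z) (at z)" by (simp add: eventually_at_filter)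
    with H(2) have "eventually (\<lambda>w. deriv f w / f w * (w - z) ^ 1 = of_int (zorder f z) + H w * (w - z)) (at z)"
    proof eventually_elim
      case (elim w)
      thus ?case by (simp only: elim(1)) (simp add: field_simps)
    qed
    moreover have "(\<lambda>w. of_int (zorder f z) + H w * (w - z)) analytic_on {z}"
      using H by (intro analytic_intros)
    ultimately have "pole_mult (\<lambda>w. deriv f w / f w) z \<le> 1"
      using pole_mult_le_iff[OF mero] by blast
    also have "1 \<le> of_bool (is_pole f z) + (of_bool (is_pole (\<lambda>w. inverse (f w)) z) :: nat)"
      using True by auto
    finally show ?thesis .
  next
    case False
    hence "zorder f z = 0" using zorder_eq_pole_mults[OF f] by (simp add: pole_mult_def)
    hence "eventually (\<lambda>w. deriv f w / f w = H w) (at z)" using H(2) by simp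
    hence "pole_mult (\<lambda>w. deriv f w / f w) z = pole_mult H z" by (rule pole_mult_cong)
    thus ?thesis using pole_mult_analytic[OF H(1)] by simp
  qed
qed

subsection \<open>Exceptional sets of finite measure\<close>

definition nev_filter :: "real filter" where
  "nev_filter = Abs_filter (\<lambda>P. \<exists>E. E \<in> sets lborel \<and> emeasure lborel E < \<infinity> \<and> (\<exists>R. \<forall>r\<ge>R. r \<notin> E \<longrightarrow> P r))"

lemma eventually_nev_filter:
  "eventually P nev_filter \<longleftrightarrow> (\<exists>E. E \<in> sets lborel \<and> emeasure lborel E < \<infinity> \<and> (\<exists>R. \<forall>r\<ge>R. r \<notin> E \<longrightarrow> P r))"
  unfolding nev_filter_def
proof (rule eventually_Abs_filter, rule is_filter.intro, goal_cases)
  case 1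
  show ?case by (intro exI[of _ "{}"]) auto
next
  case (2 P Q)
  then obtain E1 R1 E2 R2 where
    *: "E1 \<in> sets lborel" "emeasure lborel E1 < \<infinity>" "\<And>r. r \<ge> R1 \<Longrightarrow> r \<notin> E1 \<Longrightarrow> P r"
       "E2 \<in> sets lborel" "emeasure lborel E2 < \<infinity>" "\<And>r. r \<ge> R2 \<Longrightarrow> r \<notin> E2 \<Longrightarrow> Q r" by blast
  have "emeasure lborel (E1 \<union> E2) \<le> emeasure lborel E1 + emeasure lborel E2"
    using * by (intro emeasure_subadditive)
  also have "\<dots> < \<infinity>" using * by simp
  finally show ?case using * by (intro exI[of _ "E1 \<union> E2"] conjI exI[of _ "max R1 R2"]) auto
next
  case (3 P Q)
  thus ?case by meson
qed

lemma nev_filter_le_at_top: "nev_filter \<le> at_top"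
proof (rule filter_leI)
  fix P :: "real \<Rightarrow> bool" assume "eventually P at_top"
  thus "eventually P nev_filter"
    unfolding eventually_nev_filter eventually_at_top_linorder by (intro exI[of _ "{}"]) auto
qed

lemma eventually_nev_filter_at_top: "eventually P at_top \<Longrightarrow> eventually P nev_filter"
  using nev_filter_le_at_top by (rule filter_leD)

lemma emeasure_lborel_Ici: "emeasure lborel {a::real..} = \<infinity>"
proof (rule ccontr)
  assume "emeasure lborel {a..} \<noteq> \<infinity>"
  then obtain x where x: "emeasure lborel {a..} = ennreal x" "x \<ge> 0" by (cases "emeasure lborel {a..}") auto
  have "emeasure lborel {a..a + (x + 1)} \<le> emeasure lborel {a..}" by (intro emeasure_mono) auto
  thus False using x by simp
qed

lemma frequently_at_top_if_eventually_nev: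
  assumes "eventually P nev_filter"
  obtains r where "r \<ge> r0" "P r"
proof -
  obtain E R where E: "E \<in> sets lborel" "emeasure lborel E < \<infinity>" "\<And>r. r \<ge> R \<Longrightarrow> r \<notin> E \<Longrightarrow> P r"
    using assms unfolding eventually_nev_filter by blast
  have "\<not> {max r0 R..} \<subseteq> E"
  proof
    assume "{max r0 R..} \<subseteq> E"
    hence "emeasure lborel {max r0 R..} \<le> emeasure lborel E" using E by (intro emeasure_mono) auto
    thus False using E(2) by (simp add: emeasure_lborel_Ici top_unique)
  qed
  then obtain r where "r \<in> {max r0 R..}" "r \<notin> E" by blast
  thus ?thesis using E(3)[of r] by (intro that[of r]) auto
qed

lemma nev_filter_neq_bot [simp]: "nev_filter \<noteq> bot"
proof
  assume "nev_filter = bot"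
  hence "eventually (\<lambda>_. False) nev_filter" by simp
  thus False by (rule frequently_at_top_if_eventually_nev) auto
qed

text \<open>The interval from \<open>2 * r\<close> to \<open>3 * r\<close> has length
  \<open>r\<close>, which eventually exceeds the measure of the exceptional set.\<close>

lemma eventually_nev_point_in_interval:
  assumes "eventually P nev_filter"
  obtains r0 where "r0 > 0" "\<And>r. r \<ge> r0 \<Longrightarrow> \<exists>s. 2 * r \<le> s \<and> s \<le> 3 * r \<and> P s"
proof -
  obtain E R where E: "E \<in> sets lborel" "emeasure lborel E < \<infinity>" "\<And>r. r \<ge> R \<Longrightarrow> r \<notin> E \<Longrightarrow> P r"
    using assms unfolding eventually_nev_filter by blast
  obtain x where x: "emeasure lborel E = ennreal x" "x \<ge> 0" using E(2) by (cases "emeasure lborel E") auto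
  show ?thesis
  proof (rule that[of "max (x + 1) R"])
    fix r assume r: "r \<ge> max (x + 1) R"
    have "\<not> {2*r..3*r} \<subseteq> E"
    proof
      assume "{2*r..3*r} \<subseteq> E"
      hence "emeasure lborel {2*r..3*r} \<le> emeasure lborel E" using E by (intro emeasure_mono) auto
      thus False using x r by simp
    qed
    then obtain s where "s \<in> {2*r..3*r}" "s \<notin> E" by blast
    thus "\<exists>s. 2 * r \<le> s \<and> s \<le> 3 * r \<and> P s" using E(3)[of s] r x by (intro exI[of _ s]) auto
  qed (use x in auto)
qed

lemma countable_bad_radii:
  assumes "\<forall>\<^sub>\<approx>z\<in>UNIV. P z"
  shows "countable (cmod ` {z. \<not>P z})"
proof -
  have "{z. \<not>P z} sparse_in UNIV" using assms by (simp add: eventually_cosparse)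
  from sparse_imp_countable[OF open_UNIV this] show ?thesis by simp
qed

text \<open>A sparse set is countable, so the radii of the circles that meet it form a null set.
  Properties holding off a discrete set may thus be assumed on entire circles.\<close>

lemma eventually_nev_circle:
  assumes "\<forall>\<^sub>\<approx>z\<in>UNIV. P z"
  shows "eventually (\<lambda>r. \<forall>z. cmod z = r \<longrightarrow> P z) nev_filter"
  unfolding eventually_nev_filter
  using countable_bad_radii[OF assms]
  by (intro exI[of _ "cmod ` {z. \<not>P z}"] conjI exI[of _ 0]) (auto simp: emeasure_lborel_countable intro: sets.countable)

lemma good_radius_exists:
  assumes "\<forall>\<^sub>\<approx>z\<in>UNIV. P z" "a < b"
  obtains r where "a < r" "r < b" "\<And>z. cmod z = r \<Longrightarrow> P z"
proof -
  have "uncountable {a<..<b}" using assms(2) by (simp add: uncountable_open_interval)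
  hence "\<not> {a<..<b} \<subseteq> cmod ` {z. \<not>P z}" using countable_bad_radii[OF assms(1)] countable_subset by blast
  then obtain r where "r \<in> {a<..<b}" "r \<notin> cmod ` {z. \<not>P z}" by blast
  thus ?thesis by (intro that[of r]) auto
qed

text \<open>Borel's growth lemma. The exceptional radii with \<open>2 ^ k \<le> T r < 2 ^ (k + 1)\<close> lie in an interval of
  length \<open>2 / 2 ^ k\<close>.\<close>

lemma borel_growth:
  fixes T :: "real \<Rightarrow> real"
  assumes mono: "mono_on G T" and ge1: "\<And>r. r \<in> G \<Longrightarrow> T r \<ge> 1"
  obtains E where "E \<in> sets lborel" "emeasure lborel E < \<infinity>"
    "\<And>r R. r \<in> G \<Longrightarrow> r \<notin> E \<Longrightarrow> R \<in> G \<Longrightarrow> r < R \<Longrightarrow> R \<le> r + 1 / T r \<Longrightarrow> T R \<le> 2 * T r"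
proof -
  \<comment> \<open>The exceptional radii, sorted by the dyadic size of \<open>T r\<close>. The
    radius \<open>R\<close> also ranges over \<open>G\<close>, the set on which \<open>T\<close> is
    monotone.\<close>
  define B where "B = (\<lambda>k::nat. {r \<in> G. 2 ^ k \<le> T r \<and> T r < 2 ^ Suc k \<and> (\<exists>R\<in>G. r < R \<and> R \<le> r + 1 / T r \<and> T R > 2 * T r)})"
  \<comment> \<open>For empty \<open>B k\<close> the centre \<open>x k\<close> is arbitrary;
    \<open>I k\<close> still has length \<open>2 / 2 ^ k\<close>, and the lengths remain
    summable.\<close>
  define x where "x = (\<lambda>k. SOME r. r \<in> B k)"
  define I where "I = (\<lambda>k. {x k - (1/2) ^ k .. x k + (1/2) ^ k})"
  define E where "E = (\<Union>k. I k)"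
  \<comment> \<open>Otherwise \<open>s\<close> lies beyond the radius \<open>R\<close> at which
    \<open>T\<close> has more than doubled, so \<open>T s > 2 * T r\<close>, which is at least
    \<open>2 ^ Suc k\<close>, against \<open>s \<in> B k\<close>.\<close>
  have close: "s < r + (1/2) ^ k" if "r \<in> B k" "s \<in> B k" "r < s" for r s k
  proof (rule ccontr)
    assume "\<not> s < r + (1/2) ^ k"
    hence s: "s \<ge> r + (1/2) ^ k" by simp
    from that(1) obtain R where R: "R \<in> G" "r < R" "R \<le> r + 1 / T r" "T R > 2 * T r" by (auto simp: B_def)
    have Tr: "2 ^ k \<le> T r" using that(1) by (auto simp: B_def)
    have "1 / T r \<le> 1 / 2 ^ k" using Tr by (intro divide_left_mono mult_pos_pos) (auto intro: less_le_trans[of 0 "2^k"])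
    hence "R \<le> s" using R s by (simp add: power_one_over)
    hence "T R \<le> T s" using mono R(1) that(2) by (auto simp: B_def mono_on_def)
    moreover have "T s < 2 ^ Suc k" using that(2) by (auto simp: B_def)
    ultimately show False using R(4) Tr by simp
  qed
  have sub: "B k \<subseteq> I k" for k
  proof
    fix r assume r: "r \<in> B k"
    hence xk: "x k \<in> B k" unfolding x_def by (rule someI)
    have "r < x k + (1/2) ^ k" using close[OF xk r] by (cases "x k < r") (auto intro: le_less_trans simp: not_less add_pos_nonneg less_add_same_cancel1)
    moreover have "x k < r + (1/2) ^ k" using close[OF r xk] by (cases "r < x k") (auto intro: le_less_trans simp: not_less)
    ultimately show "r \<in> I k" by (simp add: I_def)
  qed
  show ?thesis
  proof (rule that[of E])
    show "E \<in> sets lborel" unfolding E_def I_def by auto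
    have "emeasure lborel E \<le> (\<Sum>k. emeasure lborel (I k))"
      unfolding E_def by (intro emeasure_subadditive_countably) (auto simp: I_def)
    also have "\<dots> = (\<Sum>k. ennreal (2 * (1/2) ^ k))"
      by (intro suminf_cong) (simp add: I_def)
    also have "\<dots> = ennreal (\<Sum>k. 2 * (1/2) ^ k)"
      by (intro suminf_ennreal2 summable_mult summable_geometric) auto
    also have "\<dots> < \<infinity>" by simp
    finally show "emeasure lborel E < \<infinity>" .
    fix r R assume *: "r \<in> G" "r \<notin> E" "R \<in> G" "r < R" "R \<le> r + 1 / T r"
    define n where "n = (LEAST n. T r < 2 ^ n)"
    have "\<exists>n. T r < 2 ^ n" using real_arch_pow[of 2 "T r"] by auto
    hence n: "T r < 2 ^ n" unfolding n_def by (rule LeastI_ex)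
    have "n \<noteq> 0" using n ge1[OF *(1)] by (cases n) auto
    then obtain k where k: "n = Suc k" by (cases n) auto
    have "\<not> T r < 2 ^ k" using not_less_Least[of k "\<lambda>n. T r < 2 ^ n"] k by (simp add: n_def)
    moreover have "r \<notin> B k" using sub[of k] *(2) by (auto simp: E_def)
    ultimately show "T R \<le> 2 * T r" using * n k by (auto simp: B_def not_less)
  qed
qed

subsection \<open>Proximity functions\<close>

lemma log_plus_eq: "x \<ge> 0 \<Longrightarrow> log_plus x = ln (max 1 x)"
  by (cases "x = 0") (auto simp: log_plus_def max_def ln_ge_zero_iff not_le)

lemma log_plus_nonneg [simp]: "log_plus x \<ge> 0"
  by (simp add: log_plus_def)

lemma log_plus_mono: "0 \<le> x \<Longrightarrow> x \<le> y \<Longrightarrow> log_plus x \<le> log_plus y"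
  by (simp add: log_plus_eq)

lemma ln_le_log_plus: "ln x \<le> log_plus x"
  by (simp add: log_plus_def)

lemma log_plus_mult:
  assumes "x \<ge> 0" "y \<ge> 0"
  shows "log_plus (x * y) \<le> log_plus x + log_plus y"
proof -
  have "log_plus (x * y) \<le> ln (max 1 x * max 1 y)"
  proof -
    have "x * y \<le> max 1 x * max 1 y" using assms by (intro mult_mono) auto
    moreover have "1 * 1 \<le> max 1 x * max 1 y" by (intro mult_mono) auto
    ultimately show ?thesis using assms by (simp only: log_plus_eq mult_nonneg_nonneg) (subst ln_le_cancel_iff, auto intro!: mult_pos_pos)
  qed
  also have "\<dots> = log_plus x + log_plus y" using assms by (subst ln_mult_pos) (auto simp: log_plus_eq)
  finally show ?thesis .
qed

text \<open>Each summand is at most the product of all \<open>max 1 (x i)\<close>, whose logarithm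
  is the sum of the \<open>log_plus (x i)\<close>; the number of summands contributes the
  constant.\<close>

lemma log_plus_sum:
  assumes "finite I" "\<And>i. i \<in> I \<Longrightarrow> x i \<ge> 0"
  shows "log_plus (\<Sum>i\<in>I. x i) \<le> (\<Sum>i\<in>I. log_plus (x i)) + ln (max 1 (card I))"
proof (cases "I = {}")
  case True
  thus ?thesis by (simp add: log_plus_def)
next
  case False
  hence c: "card I \<ge> 1" using assms(1) by (simp add: Suc_leI card_gt_0_iff)
  have P: "max 1 (x i) \<le> (\<Prod>i\<in>I. max 1 (x i))" if "i \<in> I" for i
  proof -
    have "1 \<le> (\<Prod>j\<in>I-{i}. max 1 (x j))" by (intro prod_ge_1) auto
    hence "max 1 (x i) * 1 \<le> max 1 (x i) * (\<Prod>j\<in>I-{i}. max 1 (x j))" by (intro mult_left_mono) auto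
    thus ?thesis using assms(1) that by (simp add: prod.remove[of I i])
  qed
  have P1: "1 \<le> (\<Prod>i\<in>I. max 1 (x i))" by (intro prod_ge_1) auto
  have "(\<Sum>i\<in>I. x i) \<le> (\<Sum>i\<in>I. \<Prod>i\<in>I. max 1 (x i))"
    by (intro sum_mono) (use P in fastforce)
  hence "(\<Sum>i\<in>I. x i) \<le> card I * (\<Prod>i\<in>I. max 1 (x i))" by simp
  moreover have "1 * 1 \<le> card I * (\<Prod>i\<in>I. max 1 (x i))" using P1 c by (intro mult_mono) auto
  ultimately have "log_plus (\<Sum>i\<in>I. x i) \<le> ln (card I * (\<Prod>i\<in>I. max 1 (x i)))"
    using assms by (subst log_plus_eq) (auto intro!: sum_nonneg ln_mono)
  also have "\<dots> = ln (card I) + ln (\<Prod>i\<in>I. max 1 (x i))"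
    using c P1 by (subst ln_mult_pos) auto
  also have "ln (\<Prod>i\<in>I. max 1 (x i)) = (\<Sum>i\<in>I. ln (max 1 (x i)))"
    using assms by (intro ln_prod) auto
  also have "\<dots> = (\<Sum>i\<in>I. log_plus (x i))" using assms by (intro sum.cong) (auto simp: log_plus_eq)
  also have "ln (card I) = ln (max 1 (card I))" using c by (simp add: max_def)
  finally show ?thesis by simp
qed

lemma log_plus_add:
  assumes "x \<ge> 0" "y \<ge> 0"
  shows "log_plus (x + y) \<le> log_plus x + log_plus y + ln 2"
  using log_plus_sum[of "UNIV :: bool set" "\<lambda>b. if b then x else y"] assms by (simp add: UNIV_bool add_ac)

lemma log_plus_power: "x \<ge> 0 \<Longrightarrow> log_plus (x ^ n) = n * log_plus x"
  by (cases "x \<ge> 1") (auto simp: log_plus_eq max_def ln_realpow power_le_one_iff one_le_power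
     not_le intro: antisym dest: power_le_one[of x n])

lemma ln_eq_log_plus_diff: "x > 0 \<Longrightarrow> ln x = log_plus x - log_plus (inverse x)"
  by (auto simp: log_plus_def ln_inverse)

lemma abs_ln_eq_log_plus: "x > 0 \<Longrightarrow> \<bar>ln x\<bar> = log_plus x + log_plus (inverse x)"
  by (auto simp: log_plus_def ln_inverse)

lemma continuous_on_log_plus [continuous_intros]:
  assumes "continuous_on A f" "\<And>x. x \<in> A \<Longrightarrow> f x \<ge> 0"
  shows "continuous_on A (\<lambda>x. log_plus (f x))"
proof -
  have "continuous_on A (\<lambda>x. ln (max 1 (f x)))" by (intro continuous_intros assms(1)) auto
  thus ?thesis by (rule continuous_on_eq) (use assms(2) in \<open>auto simp: log_plus_eq\<close>)
qed

lemma continuous_on_sphere_if_analytic: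
  assumes "\<And>z. cmod z = r \<Longrightarrow> f analytic_on {z}"
  shows "continuous_on (sphere 0 r) f"
proof -
  have "f analytic_on sphere 0 r" by (subst analytic_on_analytic_at) (use assms in auto)
  thus ?thesis by (intro holomorphic_on_imp_continuous_on analytic_imp_holomorphic)
qed

lemma proximity_nonneg: "r \<ge> 0 \<Longrightarrow> proximity f r \<ge> 0"
  unfolding proximity_eq_circ_mean by (intro circ_mean_nonneg) auto

definition good_circle :: "(complex \<Rightarrow> complex) \<Rightarrow> real \<Rightarrow> bool" where
  "good_circle g r \<longleftrightarrow> r > 0 \<and> (\<forall>z. cmod z = r \<longrightarrow> g analytic_on {z} \<and> g z \<noteq> 0)"

lemma cosparse_analytic_nonzero:
  assumes "g meromorphic_on UNIV" "\<forall>\<^sub>\<approx>z\<in>UNIV. g z \<noteq> 0"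
  shows "\<forall>\<^sub>\<approx>z\<in>UNIV. g analytic_on {z} \<and> g z \<noteq> 0"
  using meromorphic_on_imp_analytic_cosparse[OF assms(1)] assms(2) by eventually_elim auto

lemma eventually_good_circle:
  assumes "g meromorphic_on UNIV" "\<forall>\<^sub>\<approx>z\<in>UNIV. g z \<noteq> 0"
  shows "eventually (good_circle g) nev_filter"
  using eventually_nev_circle[OF cosparse_analytic_nonzero[OF assms]]
    eventually_nev_filter_at_top[OF eventually_gt_at_top[of 0]]
  by eventually_elim (auto simp: good_circle_def)

lemma good_circle_exists:
  assumes "g meromorphic_on UNIV" "\<forall>\<^sub>\<approx>z\<in>UNIV. g z \<noteq> 0" "0 \<le> a" "a < b"
  obtains r where "a < r" "r < b" "good_circle g r"
proof -
  obtain r where "a < r" "r < b" "\<And>z. cmod z = r \<Longrightarrow> g analytic_on {z} \<and> g z \<noteq> 0"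
    using good_radius_exists[OF cosparse_analytic_nonzero[OF assms(1,2)] assms(4)] by blast
  thus ?thesis using assms(3) by (intro that[of r]) (auto simp: good_circle_def)
qed

lemma good_circle_inverse: "good_circle g r \<Longrightarrow> good_circle (\<lambda>z. inverse (g z)) r"
  unfolding good_circle_def by (auto intro!: analytic_intros)

section \<open>Means over two concentric circles, and concavity of the logarithm\<close>

lemma circ_mean_swap:
  assumes "continuous_on (sphere 0 r \<times> sphere 0 R) (\<lambda>(z, w). K z w)" "r \<ge> 0" "R \<ge> 0"
  shows "circ_mean (\<lambda>z. circ_mean (\<lambda>w. K z w) R) r = circ_mean (\<lambda>w. circ_mean (\<lambda>z. K z w) r) R"
proof -
  have "continuous_on (cbox (0, 0) (2*pi, 2*pi)) (\<lambda>(s, t). K (of_real r * cis s) (of_real R * cis t))"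
  proof -
    have "continuous_on (cbox (0, 0) (2*pi, 2*pi)) (\<lambda>x. (\<lambda>(z, w). K z w) (of_real r * cis (fst x), of_real R * cis (snd x)))"
      by (rule continuous_on_compose2[OF assms(1)])
         (use assms in \<open>auto simp: norm_mult intro!: continuous_intros\<close>)
    thus ?thesis by (simp add: case_prod_unfold)
  qed
  from integral_swap_continuous[OF this] show ?thesis
    by (simp add: circ_mean_def)
qed

text \<open>For unimodular \<open>c\<close> and \<open>d\<close> one has
  \<open>cmod (R * c - r * d) = cmod (R * d - r * c)\<close>. Averaging the kernel over the inner
  variable is therefore the same as averaging over the outer one, where the mean is 1.\<close>

lemma circ_mean_poisson_kernel_swap:
  assumes "0 < r" "r < R" "cmod w = R"
  shows "circ_mean (\<lambda>z. poisson_kernel R z w) r = 1"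
proof -
  define c where "c = w / of_real R"
  have c: "cmod c = 1" "w = of_real R * c" using assms by (auto simp: c_def norm_divide)
  have sym: "cmod (of_real R * c - of_real r * d) = cmod (of_real R * d - of_real r * c)" if "cmod d = 1" for d
  proof -
    have cc: "c * cnj c = 1" "d * cnj d = 1" using c that complex_norm_square[of c] complex_norm_square[of d] by auto
    have "complex_of_real ((cmod (of_real R * c - of_real r * d))\<^sup>2) =
       of_real R * of_real R * (c * cnj c) + of_real r * of_real r * (d * cnj d) - of_real R * of_real r * (c * cnj d + d * cnj c)"
      unfolding complex_norm_square by (simp add: algebra_simps)
    also have "\<dots> = of_real R * of_real R * (d * cnj d) + of_real r * of_real r * (c * cnj c) - of_real R * of_real r * (d * cnj c + c * cnj d)"
      unfolding cc by simp
    also have "\<dots> = complex_of_real ((cmod (of_real R * d - of_real r * c))\<^sup>2)"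
      unfolding complex_norm_square by (simp add: algebra_simps)
    finally have "(cmod (of_real R * c - of_real r * d))\<^sup>2 = (cmod (of_real R * d - of_real r * c))\<^sup>2"
      using of_real_eq_iff by blast
    thus ?thesis by (simp add: power2_eq_iff_nonneg)
  qed
  have "circ_mean (\<lambda>z. poisson_kernel R z w) r = circ_mean (poisson_kernel R (of_real r * c)) R"
    unfolding circ_mean_def poisson_kernel_def using sym c assms by (simp add: norm_mult)
  also have "\<dots> = 1" using assms c by (intro circ_mean_poisson_kernel) (simp add: norm_mult)
  finally show ?thesis .
qed

text \<open>The value is exactly what a simple pole at \<open>a\<close> adds to N between the radii
  \<open>r\<close> and \<open>R\<close>.\<close>

lemma circ_mean_ln_blaschke:
  assumes "0 < r" "r < R" "cmod a < R" "cmod a \<noteq> r"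
  shows "circ_mean (\<lambda>z. ln (cmod (blaschke R a z))) r = ln R - ln (max r (cmod a))"
proof -
  have nz: "of_real (R\<^sup>2) - cnj a * z \<noteq> 0" if "cmod z \<le> r" for z
    using assms that by (intro blaschke_numerator_nonzero) auto
  have za: "z \<noteq> a" if "cmod z = r" for z using that assms by auto
  have "circ_mean (\<lambda>z. ln (cmod (blaschke R a z))) r =
        circ_mean (\<lambda>z. ln (cmod (of_real (R\<^sup>2) - cnj a * z)) - (ln R + ln (cmod (z - a)))) r"
  proof (rule circ_mean_cong)
    fix z :: complex assume z: "cmod z = r"
    have "cmod (of_real (R\<^sup>2) - cnj a * z) > 0" "cmod (z - a) > 0" using nz[of z] za[OF z] z by auto
    thus "ln (cmod (blaschke R a z)) = ln (cmod (of_real (R\<^sup>2) - cnj a * z)) - (ln R + ln (cmod (z - a)))"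
      using assms unfolding blaschke_def norm_divide norm_mult
      by (subst ln_divide_pos) (auto simp: ln_mult_pos)
  qed (use assms in auto)
  also have "\<dots> = circ_mean (\<lambda>z. ln (cmod (of_real (R\<^sup>2) - cnj a * z))) r - circ_mean (\<lambda>z. ln R + ln (cmod (z - a))) r"
    by (rule circ_mean_diff) (use assms nz za in \<open>auto intro!: continuous_intros\<close>)
  also have "circ_mean (\<lambda>z. ln R + ln (cmod (z - a))) r = ln R + circ_mean (\<lambda>z. ln (cmod (z - a))) r"
    by (subst circ_mean_add) (use assms za in \<open>auto intro!: continuous_intros\<close>)
  also have "circ_mean (\<lambda>z. ln (cmod (z - a))) r = ln (max r (cmod a))"
    using assms by (intro circ_mean_ln_dist)
  also have "circ_mean (\<lambda>z. ln (cmod (of_real (R\<^sup>2) - cnj a * z))) r = ln (cmod (of_real (R\<^sup>2) - cnj a * 0))"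
    by (rule circ_mean_ln_zero_free) (use assms nz in \<open>auto intro!: analytic_intros\<close>)
  also have "\<dots> = 2 * ln R" using assms by (simp add: norm_power ln_realpow)
  finally show ?thesis by simp
qed

text \<open>Jensen's inequality for the concave function \<open>ln (1 + x)\<close>, obtained by
  integrating the bound by its tangent at the mean \<open>M\<close>.\<close>

lemma circ_mean_ln_concave:
  assumes "continuous_on (sphere 0 r) X" "\<And>z. cmod z = r \<Longrightarrow> X z \<ge> 0" "r \<ge> 0"
  shows "circ_mean (\<lambda>z. ln (1 + X z)) r \<le> ln (1 + circ_mean X r)"
proof -
  define M where "M = circ_mean X r"
  have M: "M \<ge> 0" unfolding M_def using assms by (intro circ_mean_nonneg) auto
  have "circ_mean (\<lambda>z. ln (1 + X z)) r \<le> circ_mean (\<lambda>z. ln (1 + M) + (1 / (1 + M)) * (X z - M)) r"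
  proof (rule circ_mean_mono)
    show "continuous_on (sphere 0 r) (\<lambda>z. ln (1 + X z))"
      using assms by (intro continuous_intros) force+
    fix z :: complex assume "cmod z = r"
    hence X: "X z \<ge> 0" by (rule assms)
    have "ln ((1 + X z) / (1 + M)) \<le> (1 + X z) / (1 + M) - 1"
      using M X by (intro ln_le_minus_one) auto
    moreover have "ln ((1 + X z) / (1 + M)) = ln (1 + X z) - ln (1 + M)"
      using M X by (intro ln_divide_pos) auto
    moreover have "(1 + X z) / (1 + M) - 1 = (1 / (1 + M)) * (X z - M)" using M by (simp add: field_simps)
    ultimately show "ln (1 + X z) \<le> ln (1 + M) + (1 / (1 + M)) * (X z - M)" by linarith
  qed (use assms M in \<open>auto intro!: continuous_intros\<close>)
  also have "\<dots> = ln (1 + M) + (1 / (1 + M)) * circ_mean (\<lambda>z. X z - M) r"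
    by (subst circ_mean_add) (use assms M in \<open>auto intro!: continuous_intros simp: circ_mean_cmult simp del: times_divide_eq_left\<close>)
  also have "circ_mean (\<lambda>z. X z - M) r = 0"
    by (subst circ_mean_diff) (use assms in \<open>auto simp: M_def\<close>)
  finally show ?thesis by (simp add: M_def)
qed

subsection \<open>Jensen's formula and monotonicity of the characteristic\<close>

lemma char_T_nonneg: "f meromorphic_on UNIV \<Longrightarrow> r \<ge> 1 \<Longrightarrow> char_T f r \<ge> 0"
  unfolding char_T_def using proximity_nonneg[of r f] N_count_nonneg[of f r] by simp

context
  fixes g :: "complex \<Rightarrow> complex"
  assumes g: "g meromorphic_on UNIV" and g_nz: "\<forall>\<^sub>\<approx>z\<in>UNIV. g z \<noteq> 0"
begin

definition sing_set :: "real \<Rightarrow> complex set" where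
  "sing_set R = {z. cmod z \<le> R \<and> \<not>(g analytic_on {z} \<and> g z \<noteq> 0)}"

lemma finite_sing_set: "finite (sing_set R)"
proof -
  have "{z. \<not>(g analytic_on {z} \<and> g z \<noteq> 0)} sparse_in UNIV"
    using cosparse_analytic_nonzero[OF g g_nz] unfolding eventually_cosparse .
  hence "{z. \<not>(g analytic_on {z} \<and> g z \<noteq> 0)} sparse_in (cball 0 R)" by (rule sparse_in_subset) auto
  hence "finite (cball 0 R \<inter> {z. \<not>(g analytic_on {z} \<and> g z \<noteq> 0)})" by (rule sparse_in_compact_finite) auto
  thus ?thesis by (rule finite_subset[rotated]) (auto simp: sing_set_def)
qed

lemma sing_set_subset:
  assumes "good_circle g R"
  shows "sing_set R \<subseteq> ball 0 R"
  using assms by (force simp: sing_set_def good_circle_def)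

lemma notin_sing_set: "cmod z \<le> R \<Longrightarrow> z \<notin> sing_set R \<Longrightarrow> g analytic_on {z} \<and> g z \<noteq> 0"
  by (auto simp: sing_set_def)

lemma mero_cball: "g meromorphic_on cball 0 R"
  using g by (rule meromorphic_on_subset) auto

lemma mero_inverse: "(\<lambda>z. inverse (g z)) meromorphic_on UNIV"
  by (intro meromorphic_intros g)

lemma eventually_nonzero_at: "eventually (\<lambda>w. g w \<noteq> 0) (at z)"
  using g_nz by (rule eventually_cosparse_imp_eventually_at) auto

lemma zorder_eq_mults: "real_of_int (zorder g z) = real (pole_mult (\<lambda>w. inverse (g w)) z) - real (pole_mult g z)"
  using zorder_eq_pole_mults[OF meromorphic_on_UNIV_at[OF g] eventually_nonzero_at, of z] by simp

lemma pole_in_sing_set: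
  assumes "cmod z \<le> R" "is_pole g z \<or> is_pole (\<lambda>z. inverse (g z)) z"
  shows "z \<in> sing_set R"
proof (rule ccontr)
  assume "z \<notin> sing_set R"
  hence *: "g analytic_on {z}" "g z \<noteq> 0" using assms(1) notin_sing_set by blast+
  hence "(\<lambda>z. inverse (g z)) analytic_on {z}" by (intro analytic_intros) auto
  thus False using assms(2) * analytic_at_imp_no_pole by blast
qed

lemma N_count_sing_set:
  assumes "R > 0"
  shows "N_count g R = (\<Sum>z\<in>sing_set R. real (pole_mult g z) * (ln R - ln (cmod z)))"
    "N_count (\<lambda>z. inverse (g z)) R = (\<Sum>z\<in>sing_set R. real (pole_mult (\<lambda>z. inverse (g z)) z) * (ln R - ln (cmod z)))"
proof -
  show "N_count g R = (\<Sum>z\<in>sing_set R. real (pole_mult g z) * (ln R - ln (cmod z)))"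
    unfolding N_count_eq[OF g assms]
    using finite_sing_set pole_in_sing_set pole_mult_eq_0_iff[OF meromorphic_on_UNIV_at[OF g]]
    by (intro log_count_superset) (auto simp: sing_set_def)
  show "N_count (\<lambda>z. inverse (g z)) R = (\<Sum>z\<in>sing_set R. real (pole_mult (\<lambda>z. inverse (g z)) z) * (ln R - ln (cmod z)))"
    unfolding N_count_eq[OF mero_inverse assms]
    using finite_sing_set pole_in_sing_set pole_mult_eq_0_iff[OF meromorphic_on_UNIV_at[OF mero_inverse]]
    by (intro log_count_superset) (auto simp: sing_set_def)
qed

lemma continuous_on_good_circle:
  assumes "good_circle g R"
  shows "continuous_on (sphere 0 R) g" "\<And>z. cmod z = R \<Longrightarrow> g z \<noteq> 0" "R > 0"
  using assms by (auto simp: good_circle_def intro: continuous_on_sphere_if_analytic)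

text \<open>The first fundamental theorem for the value 0, in exact form: \<open>ln x\<close> is
  \<open>log_plus x - log_plus (inverse x)\<close>, and Jensen's formula evaluates its mean. The
  additive constant is the logarithm of the leading Laurent coefficient at the origin.\<close>

lemma char_T_inverse:
  assumes R: "good_circle g R"
  shows "char_T g R = char_T (\<lambda>z. inverse (g z)) R + ln (cmod (zor_poly g 0 0))"
proof -
  note c = continuous_on_good_circle[OF R]
  have "circ_mean (\<lambda>w. ln (cmod (g w))) R = circ_mean (\<lambda>w. log_plus (cmod (g w)) - log_plus (cmod (inverse (g w)))) R"
  proof (rule circ_mean_cong)
    fix w :: complex assume "cmod w = R"
    thus "ln (cmod (g w)) = log_plus (cmod (g w)) - log_plus (cmod (inverse (g w)))"
      using c ln_eq_log_plus_diff[of "cmod (g w)"] by (simp add: norm_inverse)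
  qed (use c in auto)
  also have "\<dots> = proximity g R - proximity (\<lambda>z. inverse (g z)) R"
    unfolding proximity_eq_circ_mean by (rule circ_mean_diff) (use c in \<open>auto intro!: continuous_intros\<close>)
  finally have "proximity g R - proximity (\<lambda>z. inverse (g z)) R =
      ln (cmod (zor_poly g 0 0)) + (\<Sum>a\<in>sing_set R. zorder g a * (ln R - ln (cmod a)))"
    using jensen_formula[OF mero_cball c(3) finite_sing_set sing_set_subset[OF R] notin_sing_set] by simp
  also have "(\<Sum>a\<in>sing_set R. zorder g a * (ln R - ln (cmod a))) = N_count (\<lambda>z. inverse (g z)) R - N_count g R"
    unfolding N_count_sing_set[OF c(3)] zorder_eq_mults by (simp only: left_diff_distrib sum_subtractf)
  finally show ?thesis by (simp add: char_T_def)
qed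

text \<open>In the Poisson-Jensen formula the logarithms of the Blaschke factors are nonnegative, so
  the zeros contribute negatively and may be dropped. The resulting bound is itself nonnegative,
  hence it also bounds \<open>log_plus\<close>.\<close>

lemma poisson_jensen_upper:
  assumes R: "good_circle g R" and z: "cmod z < R" "z \<notin> sing_set R"
  shows "log_plus (cmod (g z)) \<le> circ_mean (\<lambda>w. log_plus (cmod (g w)) * poisson_kernel R z w) R +
           (\<Sum>a\<in>sing_set R. real (pole_mult g a) * ln (cmod (blaschke R a z)))"
proof -
  note c = continuous_on_good_circle[OF R]
  have B: "ln (cmod (blaschke R a z)) \<ge> 0" if "a \<in> sing_set R" for a
  proof -
    have "cmod a < R" "z \<noteq> a" using that sing_set_subset[OF R] z by auto
    thus ?thesis using norm_blaschke_ge_1[of a R z] z by simp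
  qed
  have "ln (cmod (g z)) = circ_mean (\<lambda>w. ln (cmod (g w)) * poisson_kernel R z w) R -
           (\<Sum>a\<in>sing_set R. zorder g a * ln (cmod (blaschke R a z)))"
    using poisson_jensen[OF mero_cball c(3) finite_sing_set sing_set_subset[OF R] notin_sing_set z] .
  moreover have "circ_mean (\<lambda>w. ln (cmod (g w)) * poisson_kernel R z w) R \<le>
             circ_mean (\<lambda>w. log_plus (cmod (g w)) * poisson_kernel R z w) R"
    by (rule circ_mean_mono)
       (use c z in \<open>auto intro!: continuous_intros continuous_on_poisson_kernel mult_right_mono ln_le_log_plus poisson_kernel_nonneg\<close>)
  moreover have "- (\<Sum>a\<in>sing_set R. zorder g a * ln (cmod (blaschke R a z))) \<le>
      (\<Sum>a\<in>sing_set R. real (pole_mult g a) * ln (cmod (blaschke R a z)))"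
    unfolding sum_negf[symmetric] mult_minus_left[symmetric]
    by (intro sum_mono mult_right_mono B) (auto simp: zorder_eq_mults)
  ultimately have "ln (cmod (g z)) \<le> circ_mean (\<lambda>w. log_plus (cmod (g w)) * poisson_kernel R z w) R +
           (\<Sum>a\<in>sing_set R. real (pole_mult g a) * ln (cmod (blaschke R a z)))" by linarith
  moreover have "0 \<le> circ_mean (\<lambda>w. log_plus (cmod (g w)) * poisson_kernel R z w) R +
           (\<Sum>a\<in>sing_set R. real (pole_mult g a) * ln (cmod (blaschke R a z)))"
    by (intro add_nonneg_nonneg circ_mean_nonneg sum_nonneg mult_nonneg_nonneg B)
       (use z c in \<open>auto intro!: poisson_kernel_nonneg\<close>)
  ultimately show ?thesis by (simp add: log_plus_def)
qed

text \<open>The pointwise bound \<open>poisson_jensen_upper\<close> for radius \<open>R\<close> is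
  averaged over the circle of radius \<open>r\<close>. After exchanging the means the Poisson kernel
  averages to 1, which leaves the proximity at \<open>R\<close>, and the Blaschke terms average to
  the increase of N from \<open>r\<close> to \<open>R\<close>.\<close>

lemma char_T_mono:
  assumes r: "good_circle g r" and R: "good_circle g R" and rR: "r \<le> R"
  shows "char_T g r \<le> char_T g R"
proof (cases "r = R")
  case False
  hence rR: "r < R" using rR by simp
  note cr = continuous_on_good_circle[OF r]
  note cR = continuous_on_good_circle[OF R]
  let ?S = "sing_set R"
  have S_r: "cmod a \<noteq> r" "cmod a < R" if "a \<in> ?S" for a
    using that r sing_set_subset[OF R] by (auto simp: sing_set_def good_circle_def)
  have z_S: "z \<notin> ?S" if "cmod z = r" for z using S_r that by blast
  define K where "K = (\<lambda>z w. log_plus (cmod (g w)) * poisson_kernel R z w)"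
  have contK: "continuous_on (sphere 0 r \<times> sphere 0 R) (\<lambda>(z, w). K z w)"
  proof -
    have "continuous_on (sphere 0 r \<times> sphere 0 R) (\<lambda>x. log_plus (cmod (g (snd x))))"
      by (rule continuous_on_compose2[of "sphere 0 R" "\<lambda>w. log_plus (cmod (g w))"])
         (use cR in \<open>auto intro!: continuous_intros\<close>)
    moreover have "continuous_on (sphere 0 r \<times> sphere 0 R)
        (\<lambda>x. (R\<^sup>2 - (cmod (fst x))\<^sup>2) / (cmod (snd x - fst x))\<^sup>2)"
      using rR by (intro continuous_intros) auto
    ultimately show ?thesis unfolding K_def poisson_kernel_def case_prod_unfold
      by (rule continuous_on_mult)
  qed
  have contK1: "continuous_on (sphere 0 r) (\<lambda>z. circ_mean (\<lambda>w. K z w) R)"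
  proof -
    have "continuous_on (sphere 0 r \<times> cbox 0 (2*pi)) (\<lambda>x. (\<lambda>(z, w). K z w) (fst x, of_real R * cis (snd x)))"
      by (rule continuous_on_compose2[OF contK]) (use cR in \<open>auto simp: norm_mult intro!: continuous_intros\<close>)
    hence "continuous_on (sphere 0 r \<times> cbox 0 (2*pi)) (\<lambda>(z, t). K z (of_real R * cis t))"
      by (simp add: case_prod_unfold)
    from integral_continuous_on_param[OF this] show ?thesis
      unfolding circ_mean_def by (intro continuous_intros) auto
  qed
  have contB: "continuous_on (sphere 0 r) (\<lambda>z. ln (cmod (blaschke R a z)))" if "a \<in> ?S" for a
  proof -
    have "continuous_on (sphere 0 r) (blaschke R a)"
      using S_r[OF that] cR by (intro continuous_on_sphere_if_analytic analytic_blaschke) auto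
    moreover have "blaschke R a z \<noteq> 0" if "cmod z = r" for z
      using S_r[OF \<open>a \<in> ?S\<close>] that rR by (intro blaschke_nonzero) auto
    ultimately show ?thesis by (intro continuous_intros) auto
  qed
  have "proximity g r \<le> circ_mean (\<lambda>z. circ_mean (\<lambda>w. K z w) R +
           (\<Sum>a\<in>?S. real (pole_mult g a) * ln (cmod (blaschke R a z)))) r"
    unfolding proximity_eq_circ_mean K_def
  proof (rule circ_mean_mono)
    show "continuous_on (sphere 0 r) (\<lambda>z. circ_mean (\<lambda>w. log_plus (cmod (g w)) * poisson_kernel R z w) R +
           (\<Sum>a\<in>?S. real (pole_mult g a) * ln (cmod (blaschke R a z))))"
      by (intro continuous_on_add contK1[unfolded K_def] continuous_on_sum continuous_on_mult continuous_on_const contB)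
  qed (use cr rR R z_S poisson_jensen_upper in \<open>auto intro!: continuous_intros\<close>)
  also have "\<dots> = circ_mean (\<lambda>z. circ_mean (\<lambda>w. K z w) R) r +
     (\<Sum>a\<in>?S. circ_mean (\<lambda>z. real (pole_mult g a) * ln (cmod (blaschke R a z))) r)"
  proof -
    have c2: "continuous_on (sphere 0 r) (\<lambda>z. \<Sum>a\<in>?S. real (pole_mult g a) * ln (cmod (blaschke R a z)))"
      by (intro continuous_on_sum continuous_on_mult continuous_on_const contB)
    show ?thesis
      by (subst circ_mean_add[OF contK1 c2 less_imp_le[OF cr(3)]], subst circ_mean_sum)
         (use finite_sing_set cr in \<open>auto intro!: continuous_on_mult continuous_on_const contB\<close>)
  qed
  also have "circ_mean (\<lambda>z. circ_mean (\<lambda>w. K z w) R) r = circ_mean (\<lambda>w. circ_mean (\<lambda>z. K z w) r) R"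
    using contK cr cR by (intro circ_mean_swap) auto
  also have "\<dots> = proximity g R"
    unfolding proximity_eq_circ_mean K_def circ_mean_cmult
    by (rule circ_mean_cong) (use cr cR rR in \<open>auto simp: circ_mean_poisson_kernel_swap\<close>)
  also have "(\<Sum>a\<in>?S. circ_mean (\<lambda>z. real (pole_mult g a) * ln (cmod (blaschke R a z))) r) =
      (\<Sum>a\<in>?S. real (pole_mult g a) * (ln R - ln (max r (cmod a))))"
    unfolding circ_mean_cmult using S_r cr rR by (intro sum.cong refl) (simp add: circ_mean_ln_blaschke)
  also have "\<dots> = (\<Sum>a | cmod a \<le> R \<and> real (pole_mult g a) \<noteq> 0. real (pole_mult g a) * (ln R - ln (max r (cmod a))))"
    using finite_sing_set pole_in_sing_set pole_mult_eq_0_iff[OF meromorphic_on_UNIV_at[OF g]]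
    by (intro sum.mono_neutral_right) (auto simp: sing_set_def)
  also have "\<dots> = N_count g R - N_count g r"
    using locally_finite_support_pole_mult[OF g] cr cR rR
    by (simp add: N_count_eq[OF g] log_count_diff)
  finally show ?thesis by (simp add: char_T_def)
qed auto

end

lemma sum_sqrt_le:
  assumes "finite S" "\<And>a. a \<in> S \<Longrightarrow> x a \<ge> 0"
  shows "sqrt (\<Sum>a\<in>S. x a) \<le> (\<Sum>a\<in>S. sqrt (x a))"
  using assms
proof (induction S rule: finite_induct)
  case (insert a S)
  have "sqrt (x a + (\<Sum>a\<in>S. x a)) \<le> sqrt (x a) + sqrt (\<Sum>a\<in>S. x a)"
    using insert by (intro sqrt_add_le_add_sqrt sum_nonneg) auto
  thus ?case using insert by simp
qed auto

lemma sqrt_nat_mult_le: "x \<ge> 0 \<Longrightarrow> sqrt (real n * x) \<le> real n * sqrt x"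
proof -
  assume x: "x \<ge> 0"
  have "sqrt (real n) \<le> real n"
  proof (cases n)
    case (Suc m)
    have "sqrt (real n) * 1 \<le> sqrt (real n) * sqrt (real n)" using Suc by (intro mult_left_mono) auto
    thus ?thesis by simp
  qed auto
  thus ?thesis using x by (simp add: real_sqrt_mult mult_right_mono)
qed

subsection \<open>The lemma on the logarithmic derivative\<close>

context
  fixes g :: "complex \<Rightarrow> complex"
  assumes g: "g meromorphic_on UNIV" and g_nz: "\<forall>\<^sub>\<approx>z\<in>UNIV. g z \<noteq> 0"
begin

text \<open>The square root is subadditive, so it can be applied to each term of
  \<open>logarithmic_derivative_bound\<close>; afterwards the singular terms have means bounded
  uniformly in \<open>a\<close>. The two proximities in \<open>A\<close> come from
  \<open>\<bar>ln x\<bar> = log_plus x + log_plus (inverse x)\<close>.\<close>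

lemma sqrt_logderiv_bound:
  assumes R: "good_circle g R" and z: "cmod z < R" "z \<notin> sing_set g R" 
  defines "A \<equiv> 2 * R / (R - cmod z)\<^sup>2 * (proximity g R + proximity (\<lambda>z. inverse (g z)) R)"
  shows "sqrt (cmod (deriv g z / g z)) \<le> sqrt A + (\<Sum>a\<in>sing_set g R.
     real (pole_mult g a + pole_mult (\<lambda>z. inverse (g z)) a) * (1 / sqrt (cmod (z - a)) + 1 / sqrt (R - cmod z)))"
proof -
  let ?S = "sing_set g R" and ?n = "\<lambda>a. pole_mult g a + pole_mult (\<lambda>z. inverse (g z)) a"
  note c = continuous_on_good_circle[OF g g_nz R]
  have mean: "circ_mean (\<lambda>w. \<bar>ln (cmod (g w))\<bar>) R = proximity g R + proximity (\<lambda>z. inverse (g z)) R"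
  proof -
    have "circ_mean (\<lambda>w. \<bar>ln (cmod (g w))\<bar>) R = circ_mean (\<lambda>w. log_plus (cmod (g w)) + log_plus (cmod (inverse (g w)))) R"
    proof (rule circ_mean_cong)
      fix w :: complex assume "cmod w = R"
      thus "\<bar>ln (cmod (g w))\<bar> = log_plus (cmod (g w)) + log_plus (cmod (inverse (g w)))"
        using c abs_ln_eq_log_plus[of "cmod (g w)"] by (simp add: norm_inverse)
    qed (use c in auto)
    also have "\<dots> = proximity g R + proximity (\<lambda>z. inverse (g z)) R"
      unfolding proximity_eq_circ_mean by (rule circ_mean_add) (use c in \<open>auto intro!: continuous_intros\<close>)
    finally show ?thesis .
  qed
  have x0: "1 / cmod (z - a) + 1 / (R - cmod z) \<ge> 0" for a using z by simp
  have A: "A \<ge> 0" unfolding A_def using z c by (intro mult_nonneg_nonneg add_nonneg_nonneg proximity_nonneg) auto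
  have "cmod (deriv g z / g z) \<le> A + (\<Sum>a\<in>?S. \<bar>real_of_int (zorder g a)\<bar> * (1 / cmod (z - a) + 1 / (R - cmod z)))"
    using logarithmic_derivative_bound[OF mero_cball[OF g g_nz] c(3) finite_sing_set[OF g g_nz] sing_set_subset[OF g g_nz R] notin_sing_set[OF g g_nz] z]
    unfolding mean A_def .
  also have "\<dots> \<le> A + (\<Sum>a\<in>?S. real (?n a) * (1 / cmod (z - a) + 1 / (R - cmod z)))"
    by (intro add_left_mono sum_mono mult_right_mono x0) (simp add: zorder_eq_mults[OF g g_nz])
  finally have "sqrt (cmod (deriv g z / g z)) \<le> sqrt (A + (\<Sum>a\<in>?S. real (?n a) * (1 / cmod (z - a) + 1 / (R - cmod z))))"
    by simp
  also have "\<dots> \<le> sqrt A + sqrt (\<Sum>a\<in>?S. real (?n a) * (1 / cmod (z - a) + 1 / (R - cmod z)))"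
    by (intro sqrt_add_le_add_sqrt A sum_nonneg mult_nonneg_nonneg x0) auto
  also have "sqrt (\<Sum>a\<in>?S. real (?n a) * (1 / cmod (z - a) + 1 / (R - cmod z))) \<le>
        (\<Sum>a\<in>?S. sqrt (real (?n a) * (1 / cmod (z - a) + 1 / (R - cmod z))))"
    by (intro sum_sqrt_le finite_sing_set[OF g g_nz] mult_nonneg_nonneg x0) auto
  also have "\<dots> \<le> (\<Sum>a\<in>?S. real (?n a) * (1 / sqrt (cmod (z - a)) + 1 / sqrt (R - cmod z)))"
  proof (intro sum_mono)
    fix a
    have "sqrt (real (?n a) * (1 / cmod (z - a) + 1 / (R - cmod z))) \<le> real (?n a) * sqrt (1 / cmod (z - a) + 1 / (R - cmod z))"
      by (intro sqrt_nat_mult_le x0)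
    also have "sqrt (1 / cmod (z - a) + 1 / (R - cmod z)) \<le> sqrt (1 / cmod (z - a)) + sqrt (1 / (R - cmod z))"
      using z by (intro sqrt_add_le_add_sqrt) auto
    also have "\<dots> = 1 / sqrt (cmod (z - a)) + 1 / sqrt (R - cmod z)" by (simp add: real_sqrt_divide)
    finally show "sqrt (real (?n a) * (1 / cmod (z - a) + 1 / (R - cmod z))) \<le> real (?n a) * (1 / sqrt (cmod (z - a)) + 1 / sqrt (R - cmod z))"
      by (simp add: mult_left_mono)
  qed
  finally show ?thesis by simp
qed

text \<open>With \<open>X\<close> the square root of the modulus,
  \<open>log_plus (X^2) \<le> 2 * ln (1 + X)\<close>, and concavity moves the mean inside the
  logarithm. The 2 inside the bound dominates \<open>sqrt 2 / sqrt r\<close> for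
  \<open>r \<ge> 1\<close>.\<close>

lemma proximity_logderiv_bound:
  assumes r: "good_circle g r" and R: "good_circle g R" and rR: "1 \<le> r" "r < R"
  defines "A \<equiv> 2 * R / (R - r)\<^sup>2 * (proximity g R + proximity (\<lambda>z. inverse (g z)) R)"
  defines "n \<equiv> (\<Sum>a\<in>sing_set g R. real (pole_mult g a + pole_mult (\<lambda>z. inverse (g z)) a))"
  shows "proximity (\<lambda>z. deriv g z / g z) r \<le> 2 * ln (1 + (sqrt A + n * (2 + 1 / sqrt (R - r))))"
proof -
  let ?S = "sing_set g R" and ?n = "\<lambda>a. real (pole_mult g a + pole_mult (\<lambda>z. inverse (g z)) a)"
  note cr = continuous_on_good_circle[OF g g_nz r]
  have S_r: "cmod a \<noteq> r" if "a \<in> ?S" for a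
    using that r by (auto simp: sing_set_def[OF g g_nz] good_circle_def)
  have z_S: "z \<notin> ?S" if "cmod z = r" for z using S_r that by blast
  have "continuous_on (sphere 0 r) (deriv g)"
    using r by (intro continuous_on_sphere_if_analytic analytic_deriv) (auto simp: good_circle_def)
  hence contu: "continuous_on (sphere 0 r) (\<lambda>z. deriv g z / g z)"
    using cr by (intro continuous_intros) auto
  define X where "X = (\<lambda>z. sqrt (cmod (deriv g z / g z)))"
  have contX: "continuous_on (sphere 0 r) X" unfolding X_def by (intro continuous_intros contu)
  define Y where "Y = (\<lambda>z. sqrt A + (\<Sum>a\<in>?S. ?n a * (1 / sqrt (cmod (z - a)) + 1 / sqrt (R - r))))"
  have contd: "continuous_on (sphere 0 r) (\<lambda>z. 1 / sqrt (cmod (z - a)))" if "a \<in> ?S" for a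
    using S_r[OF that] by (intro continuous_intros) auto
  have contY: "continuous_on (sphere 0 r) Y" unfolding Y_def by (intro continuous_intros contd) auto
  have "circ_mean X r \<le> circ_mean Y r"
  proof (rule circ_mean_mono[OF contX contY])
    fix z :: complex assume "cmod z = r"
    thus "X z \<le> Y z" using sqrt_logderiv_bound[OF R, of z] z_S[of z] rR by (simp add: X_def Y_def A_def)
  qed (use cr in auto)
  also have "\<dots> = sqrt A + (\<Sum>a\<in>?S. ?n a * (circ_mean (\<lambda>z. 1 / sqrt (cmod (z - a))) r + 1 / sqrt (R - r)))"
  proof -
    have "circ_mean Y r = circ_mean (\<lambda>z. sqrt A) r + circ_mean (\<lambda>z. \<Sum>a\<in>?S. ?n a * (1 / sqrt (cmod (z - a)) + 1 / sqrt (R - r))) r"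
      unfolding Y_def using cr by (intro circ_mean_add continuous_intros contd) auto
    also have "circ_mean (\<lambda>z. \<Sum>a\<in>?S. ?n a * (1 / sqrt (cmod (z - a)) + 1 / sqrt (R - r))) r =
      (\<Sum>a\<in>?S. circ_mean (\<lambda>z. ?n a * (1 / sqrt (cmod (z - a)) + 1 / sqrt (R - r))) r)"
      using cr finite_sing_set[OF g g_nz] by (intro circ_mean_sum continuous_intros contd) auto
    also have "\<dots> = (\<Sum>a\<in>?S. ?n a * (circ_mean (\<lambda>z. 1 / sqrt (cmod (z - a))) r + 1 / sqrt (R - r)))"
    proof (intro sum.cong refl)
      fix a assume a: "a \<in> ?S"
      have "circ_mean (\<lambda>z. 1 / sqrt (cmod (z - a)) + 1 / sqrt (R - r)) r =
            circ_mean (\<lambda>z. 1 / sqrt (cmod (z - a))) r + circ_mean (\<lambda>z. 1 / sqrt (R - r)) r"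
        using cr a by (intro circ_mean_add continuous_intros contd) auto
      thus "circ_mean (\<lambda>z. ?n a * (1 / sqrt (cmod (z - a)) + 1 / sqrt (R - r))) r =
        ?n a * (circ_mean (\<lambda>z. 1 / sqrt (cmod (z - a))) r + 1 / sqrt (R - r))"
        by (simp only: circ_mean_cmult circ_mean_const)
    qed
    finally show ?thesis by simp
  qed
  also have "\<dots> \<le> sqrt A + (\<Sum>a\<in>?S. ?n a * (2 + 1 / sqrt (R - r)))"
  proof (intro add_left_mono sum_mono mult_left_mono add_right_mono)
    fix a assume a: "a \<in> ?S"
    have "circ_mean (\<lambda>z. 1 / sqrt (cmod (z - a))) r \<le> sqrt 2 / sqrt r"
      using S_r[OF a] cr by (intro circ_mean_inverse_sqrt_dist)
    also have "\<dots> \<le> 2 / 1" using rR by (intro frac_le) (auto intro!: real_le_lsqrt)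
    finally show "circ_mean (\<lambda>z. 1 / sqrt (cmod (z - a))) r \<le> 2" by simp
  qed auto
  also have "\<dots> = sqrt A + n * (2 + 1 / sqrt (R - r))"
    by (simp only: n_def sum_distrib_right)
  finally have mX: "circ_mean X r \<le> sqrt A + n * (2 + 1 / sqrt (R - r))" .
  have "circ_mean X r \<ge> 0" using cr by (intro circ_mean_nonneg) (auto simp: X_def)
  have "proximity (\<lambda>z. deriv g z / g z) r \<le> circ_mean (\<lambda>z. 2 * ln (1 + X z)) r"
    unfolding proximity_eq_circ_mean
  proof (rule circ_mean_mono)
    show "continuous_on (sphere 0 r) (\<lambda>z. log_plus (cmod (deriv g z / g z)))"
      by (intro continuous_intros contu) auto
    show "continuous_on (sphere 0 r) (\<lambda>z. 2 * ln (1 + X z))"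
    proof -
      have "1 + X z > 0" for z by (simp add: X_def add_pos_nonneg)
      thus ?thesis by (intro continuous_intros contX) (metis less_irrefl)
    qed
    fix z :: complex
    have X0: "X z \<ge> 0" by (simp add: X_def)
    have "cmod (deriv g z / g z) = (X z)\<^sup>2" by (simp add: X_def)
    hence "log_plus (cmod (deriv g z / g z)) = 2 * log_plus (X z)" using X0 by (simp add: log_plus_power)
    also have "\<dots> \<le> 2 * ln (1 + X z)" using X0 by (simp add: log_plus_eq)
    finally show "log_plus (cmod (deriv g z / g z)) \<le> 2 * ln (1 + X z)" .
  qed (use cr in auto)
  also have "\<dots> \<le> 2 * ln (1 + circ_mean X r)"
    unfolding circ_mean_cmult using cr contX by (intro mult_left_mono circ_mean_ln_concave) (auto simp: X_def)
  also have "\<dots> \<le> 2 * ln (1 + (sqrt A + n * (2 + 1 / sqrt (R - r))))"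
    using mX \<open>circ_mean X r \<ge> 0\<close> by simp
  finally show ?thesis .
qed

lemma count_sing_set_bound:
  assumes r: "1 \<le> r" "r < R" and s: "good_circle g r"
  shows "(\<Sum>a\<in>sing_set g r. real (pole_mult g a + pole_mult (\<lambda>z. inverse (g z)) a)) * (ln R - ln r) \<le>
    N_count g R + N_count (\<lambda>z. inverse (g z)) R"
proof -
  have *: "(\<Sum>a\<in>sing_set g r. real (pole_mult f a)) * (ln R - ln r) \<le> N_count f R"
    if f: "f meromorphic_on UNIV" and sub: "\<And>a. cmod a \<le> r \<Longrightarrow> is_pole f a \<Longrightarrow> a \<in> sing_set g r" for f
  proof -
    have "(\<Sum>a\<in>sing_set g r. real (pole_mult f a)) = (\<Sum>a | cmod a \<le> r \<and> real (pole_mult f a) \<noteq> 0. real (pole_mult f a))"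
      using finite_sing_set[OF g g_nz] sub pole_mult_eq_0_iff[OF meromorphic_on_UNIV_at[OF f]]
      by (intro sum.mono_neutral_right) (auto simp: sing_set_def[OF g g_nz])
    also have "\<dots> * (ln R - ln r) \<le> log_count (\<lambda>a. real (pole_mult f a)) R"
      using r by (intro count_le_log_count locally_finite_support_pole_mult f) auto
    finally show ?thesis using r by (simp add: N_count_eq[OF f])
  qed
  have "(\<Sum>a\<in>sing_set g r. real (pole_mult g a + pole_mult (\<lambda>z. inverse (g z)) a)) * (ln R - ln r) =
        (\<Sum>a\<in>sing_set g r. real (pole_mult g a)) * (ln R - ln r) +
        (\<Sum>a\<in>sing_set g r. real (pole_mult (\<lambda>z. inverse (g z)) a)) * (ln R - ln r)"
    by (simp add: sum.distrib distrib_right)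
  also have "\<dots> \<le> N_count g R + N_count (\<lambda>z. inverse (g z)) R"
    using pole_in_sing_set[OF g g_nz] mero_inverse[OF g g_nz] by (intro add_mono * g) blast+
  finally show ?thesis .
qed

text \<open>Two larger radii are used: \<open>R1\<close> for the factorization, and
  \<open>R2 > R1\<close> to bound the number of zeros and poles up to \<open>R1\<close> by counting
  functions. Both lie within \<open>1 / T r\<close> of \<open>r\<close>, so Borel's lemma keeps
  \<open>T\<close> below \<open>2 * T r\<close> there. All terms are then at most a multiple of
  \<open>r * T r ^ 3\<close>, hence the coefficients 1 and 3; the constant 256 exceeds
  \<open>1 + 128 + 64\<close>.\<close>

lemma logarithmic_derivative_lemma:
  "eventually (\<lambda>r. proximity (\<lambda>z. deriv g z / g z) r \<le>
     2 * (ln 256 + ln r + 3 * ln (char_T g r + char_T (\<lambda>z. inverse (g z)) r + 1))) nev_filter"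
proof -
  define h where "h = (\<lambda>z. inverse (g z))"
  have h: "h meromorphic_on UNIV" unfolding h_def by (rule mero_inverse[OF g g_nz])
  have h_nz: "\<forall>\<^sub>\<approx>z\<in>UNIV. h z \<noteq> 0" using g_nz by (simp add: h_def)
  define T where "T = (\<lambda>r. char_T g r + char_T h r + 1)"
  define G where "G = {r. r \<ge> 1 \<and> good_circle g r}"
  have hG: "good_circle h r" if "good_circle g r" for r
    unfolding h_def by (rule good_circle_inverse[OF that])
  have "mono_on G T"
    unfolding mono_on_def T_def using char_T_mono[OF g g_nz] char_T_mono[OF h h_nz] hG
    by (auto simp: G_def intro!: add_mono)
  moreover have "T r \<ge> 1" if "r \<in> G" for r
    using char_T_nonneg[OF g, of r] char_T_nonneg[OF h, of r] that by (auto simp: T_def G_def)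
  ultimately obtain E where E: "E \<in> sets lborel" "emeasure lborel E < \<infinity>"
    "\<And>r R. r \<in> G \<Longrightarrow> r \<notin> E \<Longrightarrow> R \<in> G \<Longrightarrow> r < R \<Longrightarrow> R \<le> r + 1 / T r \<Longrightarrow> T R \<le> 2 * T r"
    using borel_growth by blast
  have "eventually (\<lambda>r. r \<notin> E) nev_filter"
    unfolding eventually_nev_filter using E(1,2) by blast
  moreover have "eventually (\<lambda>r. r \<in> G) nev_filter"
    using eventually_good_circle[OF g g_nz] eventually_nev_filter_at_top[OF eventually_ge_at_top[of 1]]
    by eventually_elim (simp add: G_def)
  ultimately show ?thesis
  proof eventually_elim
    case (elim r)
    have r: "r \<ge> 1" "good_circle g r" using elim by (auto simp: G_def)
    have T1: "T r \<ge> 1"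
      using char_T_nonneg[OF g, of r] char_T_nonneg[OF h, of r] r by (auto simp: T_def)
    \<comment> \<open>A quarter of the admissible length \<open>1 / T r\<close>. Choosing
      \<open>R1\<close> in the second and \<open>R2\<close> in the fourth quarter leaves gaps of at
      least \<open>d\<close> between \<open>r\<close>, \<open>R1\<close> and
      \<open>R2\<close>.\<close>
    define d where "d = 1 / (4 * T r)"
    have d: "d > 0" "4 * d = 1 / T r" "d \<le> 1 / 4" using T1 by (auto simp: d_def field_simps)
    obtain R1 where R1: "r + d < R1" "R1 < r + 2 * d" "good_circle g R1"
      using good_circle_exists[OF g g_nz, of "r + d" "r + 2 * d"] d r by auto
    obtain R2 where R2: "r + 3 * d < R2" "R2 < r + 4 * d" "good_circle g R2"
      using good_circle_exists[OF g g_nz, of "r + 3 * d" "r + 4 * d"] d r by auto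
    have G12: "R1 \<in> G" "R2 \<in> G" using R1 R2 r d by (auto simp: G_def)
    have T12: "T R1 \<le> 2 * T r" "T R2 \<le> 2 * T r"
      using elim G12 R1 R2 d by (auto intro!: E(3))
    have R2r: "R1 \<le> 2 * r" "R2 \<le> 2 * r" using R1 R2 d r by auto
    define A where "A = 2 * R1 / (R1 - r)\<^sup>2 * (proximity g R1 + proximity h R1)"
    define n where "n = (\<Sum>a\<in>sing_set g R1. real (pole_mult g a + pole_mult h a))"
    have n0: "n \<ge> 0" unfolding n_def by (intro sum_nonneg) auto
    have prox: "proximity g R1 + proximity h R1 \<le> 2 * T r"
      using T12(1) N_count_nonneg[OF g, of R1] N_count_nonneg[OF h, of R1] R1 d r
      by (simp add: T_def char_T_def)
    have prox0: "proximity g R1 + proximity h R1 \<ge> 0" using R1 d r by (intro add_nonneg_nonneg proximity_nonneg) auto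
    have "A \<le> 2 * (2 * r) / d\<^sup>2 * (2 * T r)"
      unfolding A_def using R1 R2r d r prox prox0 
      by (intro mult_mono frac_le power_mono) auto
    also have "\<dots> = 128 * r * T r ^ 3" using T1 by (simp add: d_def field_simps power2_eq_square power3_eq_cube)
    finally have A: "A \<le> 128 * r * T r ^ 3" .
    have T3: "1 \<le> T r ^ 3" using T1 by simp
    have rT3: "1 * 1 \<le> r * T r ^ 3" using T3 r by (intro mult_mono) auto
    have "sqrt A \<le> sqrt (128 * r * T r ^ 3)" using A by simp
    also have "\<dots> \<le> 128 * r * T r ^ 3"
    proof (rule real_le_lsqrt)
      have "1 \<le> 128 * r * T r ^ 3" using rT3 by simp
      hence "1 * (128 * r * T r ^ 3) \<le> (128 * r * T r ^ 3) * (128 * r * T r ^ 3)" by (intro mult_right_mono) auto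
      thus "128 * r * T r ^ 3 \<le> (128 * r * T r ^ 3)\<^sup>2" by (simp add: power2_eq_square)
    qed (use rT3 in auto)
    finally have sA: "sqrt A \<le> 128 * r * T r ^ 3" .
    have "n * (ln R2 - ln R1) \<le> N_count g R2 + N_count h R2"
      unfolding n_def h_def using R1 R2 d r by (intro count_sing_set_bound) auto
    also have "\<dots> \<le> T R2" using proximity_nonneg[of R2 g] proximity_nonneg[of R2 h] R2 d r
      by (simp add: T_def char_T_def)
    finally have n1: "n * (ln R2 - ln R1) \<le> 2 * T r" using T12 by simp
    have "d / (2 * r) \<le> ln R2 - ln R1"
    proof -
      have "ln (R1 / R2) \<le> R1 / R2 - 1" using R1 R2 r d by (intro ln_le_minus_one) auto
      hence "1 - R1 / R2 \<le> ln R2 - ln R1" using R1 R2 r d by (subst (asm) ln_divide_pos) auto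
      moreover have "d / (2 * r) \<le> (R2 - R1) / R2" using R1 R2 R2r r d by (intro frac_le) auto
      moreover have "(R2 - R1) / R2 = 1 - R1 / R2" using R2 r d by (simp add: field_simps)
      ultimately show ?thesis by simp
    qed
    hence "n * (d / (2 * r)) \<le> 2 * T r" using n1 n0 mult_left_mono[of "d / (2 * r)" "ln R2 - ln R1" n] by linarith
    hence n: "n \<le> 16 * r * (T r)\<^sup>2" using T1 r by (simp add: d_def field_simps power2_eq_square)
    have "1 / sqrt (R1 - r) \<le> 2 * T r"
    proof -
      have "1 / (4 * (T r)\<^sup>2) \<le> d" using T1 by (simp add: d_def field_simps power2_eq_square)
      also have "d \<le> R1 - r" using R1 by simp
      finally have "sqrt (1 / (4 * (T r)\<^sup>2)) \<le> sqrt (R1 - r)" by simp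
      moreover have "sqrt (1 / (4 * (T r)\<^sup>2)) = 1 / (2 * T r)" using T1 by (simp add: real_sqrt_divide real_sqrt_mult)
      ultimately have "1 / (2 * T r) \<le> sqrt (R1 - r)" by simp
      moreover have "sqrt (R1 - r) > 0" using R1 d by simp
      ultimately show ?thesis using T1 by (simp add: field_simps)
    qed
    hence "2 + 1 / sqrt (R1 - r) \<le> 4 * T r" using T1 by simp
    hence "n * (2 + 1 / sqrt (R1 - r)) \<le> (16 * r * (T r)\<^sup>2) * (4 * T r)"
      using n n0 R1 d r T1 by (intro mult_mono) auto
    also have "\<dots> = 64 * r * T r ^ 3" by (simp add: power2_eq_square power3_eq_cube)
    finally have "1 + (sqrt A + n * (2 + 1 / sqrt (R1 - r))) \<le> 256 * r * T r ^ 3"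
      using sA rT3 by linarith
    moreover have "sqrt A \<ge> 0" unfolding A_def using R1 d r prox0 by (intro real_sqrt_ge_zero mult_nonneg_nonneg) auto
    moreover have "n * (2 + 1 / sqrt (R1 - r)) \<ge> 0" using n0 R1 d by (intro mult_nonneg_nonneg) auto
    ultimately have "ln (1 + (sqrt A + n * (2 + 1 / sqrt (R1 - r)))) \<le> ln (256 * r * T r ^ 3)"
      by (subst ln_le_cancel_iff) linarith+
    also have "\<dots> = ln 256 + ln r + 3 * ln (T r)"
      using T1 r by (simp add: ln_mult_pos ln_realpow)
    finally have "2 * ln (1 + (sqrt A + n * (2 + 1 / sqrt (R1 - r)))) \<le> 2 * (ln 256 + ln r + 3 * ln (T r))"
      by simp
    moreover have "proximity (\<lambda>z. deriv g z / g z) r \<le> 2 * ln (1 + (sqrt A + n * (2 + 1 / sqrt (R1 - r))))"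
      unfolding A_def n_def h_def using R1 d r by (intro proximity_logderiv_bound) auto
    ultimately show ?case by (simp add: T_def h_def)
  qed
qed

end

subsection \<open>Growth comparison off exceptional sets\<close>

lemma smallo_mono_nonneg:
  fixes g h k :: "'a \<Rightarrow> real"
  assumes "eventually (\<lambda>x. 0 \<le> g x \<and> g x \<le> h x) F" "h \<in> o[F](k)"
  shows "g \<in> o[F](k)"
proof -
  have "eventually (\<lambda>x. norm (g x) \<le> 1 * norm (h x)) F" using assms(1) by eventually_elim auto
  hence "g \<in> O[F](h)" by (rule bigoI)
  thus ?thesis using assms(2) landau_o.big_small_trans by blast
qed

lemma bigo_mono_nonneg:
  fixes g h k :: "'a \<Rightarrow> real"
  assumes "eventually (\<lambda>x. 0 \<le> g x \<and> g x \<le> h x) F" "h \<in> O[F](k)"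
  shows "g \<in> O[F](k)"
proof -
  have "eventually (\<lambda>x. norm (g x) \<le> 1 * norm (h x)) F" using assms(1) by eventually_elim auto
  hence "g \<in> O[F](h)" by (rule bigoI)
  thus ?thesis using assms(2) landau_o.big_trans by blast
qed

lemma tail_measure_small:
  assumes E: "E \<in> sets lborel" "emeasure lborel E < \<infinity>" and e: "e > 0"
  obtains R :: real where "emeasure lborel (E \<inter> {R..}) < e"
proof -
  have "(\<lambda>i. emeasure lborel (E \<inter> {real i..})) \<longlonglongrightarrow> emeasure lborel (\<Inter>i. E \<inter> {real i..})"
  proof (rule Lim_emeasure_decseq)
    show "range (\<lambda>i. E \<inter> {real i..}) \<subseteq> sets lborel" using E by auto
    show "decseq (\<lambda>i. E \<inter> {real i..})" unfolding decseq_def by auto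
    fix i
    have "emeasure lborel (E \<inter> {real i..}) \<le> emeasure lborel E" using E by (intro emeasure_mono) auto
    thus "emeasure lborel (E \<inter> {real i..}) \<noteq> \<infinity>" using E(2) by (auto simp: top_unique)
  qed
  moreover have "(\<Inter>i. E \<inter> {real i..}) = {}"
  proof -
    have False if "x \<in> (\<Inter>i. E \<inter> {real i..})" for x
    proof -
      obtain i where "x < real i" using reals_Archimedean2 by blast
      moreover have "real i \<le> x" using that by auto
      ultimately show False by simp
    qed
    thus ?thesis by blast
  qed
  ultimately have "(\<lambda>i. emeasure lborel (E \<inter> {real i..})) \<longlonglongrightarrow> 0" by simp
  hence "eventually (\<lambda>i. emeasure lborel (E \<inter> {real i..}) < e) sequentially"
    using e by (intro order_tendstoD) auto
  thus ?thesis using that by (auto simp: eventually_sequentially)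
qed

text \<open>Each exceptional set is cut down to a tail of measure below \<open>(1/2)^k\<close>, so
  that the union still has finite measure; only the starting radius \<open>R\<close> depends on
  \<open>k\<close>. This bridges the gap between smallness along the filter, with one set per
  epsilon, and \<open>is_S\<close>, with one set for all.\<close>

lemma nev_filter_diagonal:
  fixes P :: "nat \<Rightarrow> real \<Rightarrow> bool"
  assumes "\<And>k. eventually (P k) nev_filter"
  obtains E where "E \<in> sets lborel" "emeasure lborel E < \<infinity>" "\<And>k. \<exists>R. \<forall>r\<ge>R. r \<notin> E \<longrightarrow> P k r"
proof -
  have "\<exists>E R. E \<in> sets lborel \<and> emeasure lborel E < ennreal ((1/2)^k) \<and> (\<forall>r\<ge>R. r \<notin> E \<longrightarrow> P k r)" for k
  proof -
    obtain E R where E: "E \<in> sets lborel" "emeasure lborel E < \<infinity>" "\<And>r. r \<ge> R \<Longrightarrow> r \<notin> E \<Longrightarrow> P k r"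
      using assms[of k] unfolding eventually_nev_filter by blast
    obtain R' where R': "emeasure lborel (E \<inter> {R'..}) < ennreal ((1/2)^k)"
      using tail_measure_small[OF E(1,2), of "ennreal ((1/2)^k)"] by auto
    show ?thesis
      by (intro exI[of _ "E \<inter> {R'..}"] exI[of _ "max R R'"]) (use E R' in auto)
  qed
  then obtain E R where E: "\<And>k. E k \<in> sets lborel" "\<And>k. emeasure lborel (E k) < ennreal ((1/2)^k)"
      "\<And>k r. r \<ge> R k \<Longrightarrow> r \<notin> E k \<Longrightarrow> P k r" by metis
  show ?thesis
  proof (rule that[of "\<Union>k. E k"])
    have "emeasure lborel (\<Union>k. E k) \<le> (\<Sum>k. emeasure lborel (E k))"
      using E(1) by (intro emeasure_subadditive_countably) auto
    also have "\<dots> \<le> (\<Sum>k. ennreal ((1/2) ^ k))"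
      using E(2) by (intro suminf_le) (auto intro: less_imp_le)
    also have "\<dots> = ennreal (\<Sum>k. (1/2) ^ k)"
      by (intro suminf_ennreal2 summable_geometric) auto
    also have "\<dots> < \<infinity>" by simp
    finally show "emeasure lborel (\<Union>k. E k) < \<infinity>" .
  qed (use E in blast)+
qed

lemma is_S_imp_smallo:
  assumes "is_S f s"
  shows "s \<in> o[nev_filter](char_T f)"
proof (rule landau_o.smallI)
  fix c :: real assume c: "c > 0"
  obtain E where E: "E \<in> sets lborel" "emeasure lborel E < \<infinity>" "\<And>e. e > 0 \<Longrightarrow> \<exists>R. \<forall>r\<ge>R. r \<notin> E \<longrightarrow> \<bar>s r\<bar> \<le> e * char_T f r"
    using assms unfolding is_S_def by blast
  have "eventually (\<lambda>r. \<bar>s r\<bar> \<le> c * char_T f r) nev_filter"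
    unfolding eventually_nev_filter using E(1,2) E(3)[OF c] by blast
  thus "eventually (\<lambda>r. norm (s r) \<le> c * norm (char_T f r)) nev_filter"
  proof eventually_elim
    case (elim r)
    have "c * char_T f r \<le> c * \<bar>char_T f r\<bar>" using c by (intro mult_left_mono) auto
    thus ?case using elim by simp
  qed
qed

lemma smallo_imp_is_S:
  assumes f: "f meromorphic_on UNIV" and s: "s \<in> o[nev_filter](char_T f)"
  shows "is_S f s"
proof -
  have ev: "eventually (\<lambda>r. \<bar>s r\<bar> \<le> 1 / real (Suc k) * \<bar>char_T f r\<bar>) nev_filter" for k
    using landau_o.smallD[OF s, of "1 / real (Suc k)"] by simp
  obtain E where
    E: "E \<in> sets lborel" "emeasure lborel E < \<infinity>" "\<And>k. \<exists>R. \<forall>r\<ge>R. r \<notin> E \<longrightarrow> \<bar>s r\<bar> \<le> 1 / real (Suc k) * \<bar>char_T f r\<bar>"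
    by (rule nev_filter_diagonal[OF ev]) (rule that)
  show ?thesis unfolding is_S_def
  proof (intro exI[of _ E] conjI E allI impI)
    fix e :: real assume e: "e > 0"
    obtain k where k: "1 / real (Suc k) < e" using nat_approx_posE[OF e] by blast
    obtain R where R: "\<And>r. r \<ge> R \<Longrightarrow> r \<notin> E \<Longrightarrow> \<bar>s r\<bar> \<le> 1 / real (Suc k) * \<bar>char_T f r\<bar>" using E(3)[of k] by blast
    show "\<exists>R. \<forall>r\<ge>R. r \<notin> E \<longrightarrow> \<bar>s r\<bar> \<le> e * char_T f r"
    proof (intro exI[of _ "max 1 R"] allI impI)
      fix r assume r: "r \<ge> max 1 R" "r \<notin> E"
      have T: "char_T f r \<ge> 0" using char_T_nonneg[OF f, of r] r by simp
      have "\<bar>s r\<bar> \<le> 1 / real (Suc k) * char_T f r" using R[of r] r T by simp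
      also have "\<dots> \<le> e * char_T f r" using k T by (intro mult_right_mono) auto
      finally show "\<bar>s r\<bar> \<le> e * char_T f r" .
    qed
  qed
qed

lemma eventually_nev_ge: "eventually (\<lambda>r. r \<ge> c) nev_filter"
  by (rule eventually_nev_filter_at_top[OF eventually_ge_at_top])

subsection \<open>Estimates for proximity and counting functions\<close>

lemma N_count_finite_poles_nev:
  assumes "f meromorphic_on UNIV" "finite {z. is_pole f z}"
  shows "N_count f \<in> O[nev_filter](\<lambda>r. ln r)"
  using N_count_finite_poles[OF assms] nev_filter_le_at_top
  by (rule landau_o.big.filter_mono'[THEN subsetD, rotated])

lemma analytic_DERIV: "g analytic_on {z} \<Longrightarrow> (g has_field_derivative deriv g z) (at z)"
  using analytic_on_imp_differentiable_at DERIV_deriv_iff_field_differentiable by fastforce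

text \<open>Weaker than \<open>good_circle\<close>: zeros on the circle are allowed, since
  \<open>log_plus (cmod (f z))\<close> is continuous at them.\<close>

definition analytic_circle :: "(complex \<Rightarrow> complex) \<Rightarrow> real \<Rightarrow> bool" where
  "analytic_circle f r \<longleftrightarrow> r > 0 \<and> (\<forall>z. cmod z = r \<longrightarrow> f analytic_on {z})"

lemma eventually_analytic_circle:
  assumes "f meromorphic_on UNIV"
  shows "eventually (analytic_circle f) nev_filter"
  using eventually_nev_circle[OF meromorphic_on_imp_analytic_cosparse[OF assms]] eventually_nev_ge[of 1]
  by eventually_elim (auto simp: analytic_circle_def)

lemma analytic_circle_continuous:
  assumes "analytic_circle f r"
  shows "continuous_on (sphere 0 r) f"
  using assms by (intro continuous_on_sphere_if_analytic) (auto simp: analytic_circle_def)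

lemma continuous_log_plus_circle:
  assumes "analytic_circle f r"
  shows "continuous_on (sphere 0 r) (\<lambda>z. log_plus (cmod (f z)))"
  using analytic_circle_continuous[OF assms] by (intro continuous_intros) auto

lemma proximity_mult:
  assumes "analytic_circle f r" "analytic_circle g r"
  shows "proximity (\<lambda>z. f z * g z) r \<le> proximity f r + proximity g r"
proof -
  note c = analytic_circle_continuous[OF assms(1)] analytic_circle_continuous[OF assms(2)]
  have r: "r \<ge> 0" using assms(1) by (simp add: analytic_circle_def)
  have "proximity (\<lambda>z. f z * g z) r \<le> circ_mean (\<lambda>z. log_plus (cmod (f z)) + log_plus (cmod (g z))) r"
    unfolding proximity_eq_circ_mean
    by (rule circ_mean_mono) (use c r in \<open>auto intro!: continuous_intros log_plus_mult simp: norm_mult\<close>)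
  also have "\<dots> = proximity f r + proximity g r"
    unfolding proximity_eq_circ_mean using assms r by (intro circ_mean_add continuous_log_plus_circle)
  finally show ?thesis .
qed

lemma proximity_add:
  assumes "analytic_circle f r" "analytic_circle g r"
  shows "proximity (\<lambda>z. f z + g z) r \<le> proximity f r + proximity g r + ln 2"
proof -
  note c = analytic_circle_continuous[OF assms(1)] analytic_circle_continuous[OF assms(2)]
  have r: "r \<ge> 0" using assms(1) by (simp add: analytic_circle_def)
  have "proximity (\<lambda>z. f z + g z) r \<le> circ_mean (\<lambda>z. (log_plus (cmod (f z)) + log_plus (cmod (g z))) + ln 2) r"
    unfolding proximity_eq_circ_mean
  proof (rule circ_mean_mono)
    fix z
    have "log_plus (cmod (f z + g z)) \<le> log_plus (cmod (f z) + cmod (g z))"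
      by (intro log_plus_mono norm_triangle_ineq) auto
    also have "\<dots> \<le> log_plus (cmod (f z)) + log_plus (cmod (g z)) + ln 2" by (intro log_plus_add) auto
    finally show "log_plus (cmod (f z + g z)) \<le> log_plus (cmod (f z)) + log_plus (cmod (g z)) + ln 2" .
  qed (use c r in \<open>auto intro!: continuous_intros\<close>)
  also have "\<dots> = circ_mean (\<lambda>z. log_plus (cmod (f z)) + log_plus (cmod (g z))) r + ln 2"
    by (subst circ_mean_add) (use assms r in \<open>auto intro!: continuous_on_add continuous_log_plus_circle\<close>)
  also have "circ_mean (\<lambda>z. log_plus (cmod (f z)) + log_plus (cmod (g z))) r = proximity f r + proximity g r"
    unfolding proximity_eq_circ_mean using assms r by (intro circ_mean_add continuous_log_plus_circle)
  finally show ?thesis .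
qed

lemma proximity_const: "proximity (\<lambda>_. c) r = log_plus (cmod c)"
  by (simp add: proximity_eq_circ_mean)

section \<open>Identities off a discrete set and inequalities for counting functions\<close>

lemma proximity_cong_circle:
  assumes "\<And>z. cmod z = r \<Longrightarrow> f z = g z" "r \<ge> 0"
  shows "proximity f r = proximity g r"
  unfolding proximity_eq_circ_mean by (rule circ_mean_cong) (use assms in auto)

lemma proximity_cong_cosparse:
  assumes "\<forall>\<^sub>\<approx>z\<in>UNIV. f z = g z"
  shows "eventually (\<lambda>r. proximity f r = proximity g r) nev_filter"
  using eventually_nev_circle[OF assms] eventually_nev_ge[of 0]
  by eventually_elim (rule proximity_cong_circle, auto)

lemma cosparse_UNIV_at: "\<forall>\<^sub>\<approx>z\<in>UNIV. P z \<Longrightarrow> eventually P (at z)"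
  by (rule eventually_cosparse_imp_eventually_at) auto

text \<open>A set sparse in the plane is closed, so the identity holds in a neighbourhood of each
  point outside it and can be differentiated there.\<close>

lemma cosparse_deriv_cong:
  assumes "\<forall>\<^sub>\<approx>z\<in>UNIV. f z = g z"
  shows "\<forall>\<^sub>\<approx>z\<in>UNIV. deriv f z = deriv g z"
proof -
  have cl: "closed {z. f z \<noteq> g z}"
    using assms unfolding eventually_cosparse by (rule sparse_in_UNIV_imp_closed)
  from assms show ?thesis
  proof eventually_elim
    case (elim z)
    have "eventually (\<lambda>w. w \<in> - {z. f z \<noteq> g z}) (nhds z)"
      using cl elim by (intro eventually_nhds_in_open) auto
    hence "eventually (\<lambda>w. f w = g w) (nhds z)" by eventually_elim auto
    thus "deriv f z = deriv g z" by (intro deriv_cong_ev) auto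
  qed
qed

lemma N_count_cong_cosparse:
  assumes "\<forall>\<^sub>\<approx>z\<in>UNIV. f z = g z"
  shows "N_count f = N_count g"
proof -
  have "pole_mult f z = pole_mult g z" "is_pole f z = is_pole g z" for z
    using pole_mult_cong[OF cosparse_UNIV_at[OF assms]] is_pole_cong[OF cosparse_UNIV_at[OF assms] refl] by auto
  hence "pole_count f = pole_count g" by (simp add: pole_count_def fun_eq_iff)
  thus ?thesis by (simp add: N_count_def[abs_def])
qed

lemma N_count_le:
  assumes "f meromorphic_on UNIV" "locally_finite_support w" "\<And>z. real (pole_mult f z) \<le> w z" "r \<ge> 1"
  shows "N_count f r \<le> log_count w r"
  using assms by (simp add: N_count_eq log_count_mono)

lemma N_count_le_add:
  assumes "f meromorphic_on UNIV" "g meromorphic_on UNIV" "h meromorphic_on UNIV"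
    "\<And>z. pole_mult f z \<le> pole_mult g z + pole_mult h z" "r \<ge> 1"
  shows "N_count f r \<le> N_count g r + N_count h r"
proof -
  have lf: "locally_finite_support (\<lambda>z. real (pole_mult g z) + real (pole_mult h z))"
    using assms by (intro locally_finite_support_add locally_finite_support_pole_mult)
  have "real (pole_mult f z) \<le> real (pole_mult g z) + real (pole_mult h z)" for z
    using assms(4)[of z] by linarith
  hence "N_count f r \<le> log_count (\<lambda>z. real (pole_mult g z) + real (pole_mult h z)) r"
    by (intro N_count_le assms lf)
  also have "\<dots> = N_count g r + N_count h r"
    using assms by (simp add: log_count_add locally_finite_support_pole_mult N_count_eq)
  finally show ?thesis .
qed

lemma N_count_add:
  assumes "f meromorphic_on UNIV" "g meromorphic_on UNIV" "r \<ge> 1"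
  shows "N_count (\<lambda>z. f z + g z) r \<le> N_count f r + N_count g r"
  by (rule N_count_le_add)
     (use assms in \<open>auto intro!: meromorphic_intros pole_mult_add intro: meromorphic_on_UNIV_at\<close>)

lemma N_count_mult:
  assumes "f meromorphic_on UNIV" "g meromorphic_on UNIV" "r \<ge> 1"
  shows "N_count (\<lambda>z. f z * g z) r \<le> N_count f r + N_count g r"
  by (rule N_count_le_add)
     (use assms in \<open>auto intro!: meromorphic_intros pole_mult_mult intro: meromorphic_on_UNIV_at\<close>)

lemma N_count_deriv:
  assumes "f meromorphic_on UNIV" "r \<ge> 1"
  shows "N_count (deriv f) r \<le> N_count f r + N_count f r"
proof (rule N_count_le_add)
  fix z show "pole_mult (deriv f) z \<le> pole_mult f z + pole_mult f z"
    using pole_mult_deriv_le_double[OF meromorphic_on_UNIV_at[OF assms(1)], of z] by simp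
qed (use assms in \<open>auto intro!: meromorphic_intros\<close>)

lemma N_count_analytic:
  assumes "f analytic_on UNIV"
  shows "N_count f r = 0"
proof -
  have "\<not>is_pole f z" for z
    using assms analytic_at_imp_no_pole analytic_on_subset by blast
  hence "pole_count f = (\<lambda>_. 0)" by (simp add: pole_count_def fun_eq_iff)
  thus ?thesis by (simp add: N_count_def integrated_count_def)
qed

lemma N_count_logderiv:
  assumes f: "f meromorphic_on UNIV" "\<forall>\<^sub>\<approx>z\<in>UNIV. f z \<noteq> 0" and r: "r \<ge> 1"
  shows "N_count (\<lambda>z. deriv f z / f z) r \<le> N_count f r + N_count (\<lambda>z. inverse (f z)) r"
proof (rule N_count_le_add)
  fix z
  have le: "(of_bool (is_pole g z) :: nat) \<le> pole_mult g z" if "g meromorphic_on UNIV" for g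
    using pole_mult_eq_0_iff[OF meromorphic_on_UNIV_at[OF that], of z] by (auto simp: Suc_le_eq)
  have inv: "(\<lambda>z. inverse (f z)) meromorphic_on UNIV" by (intro meromorphic_intros f)
  have "pole_mult (\<lambda>w. deriv f w / f w) z \<le> of_bool (is_pole f z) + of_bool (is_pole (\<lambda>w. inverse (f w)) z)"
    by (intro pole_mult_logderiv meromorphic_on_UNIV_at f cosparse_UNIV_at)
  also have "\<dots> \<le> pole_mult f z + pole_mult (\<lambda>w. inverse (f w)) z" by (intro add_mono le f inv)
  finally show "pole_mult (\<lambda>z. deriv f z / f z) z \<le> pole_mult f z + pole_mult (\<lambda>z. inverse (f z)) z" .
qed (use assms in \<open>auto intro!: meromorphic_intros\<close>)

subsection \<open>Functions that are small with respect to a transcendental function\<close>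

text \<open>Isolates what the small-function calculus needs of a transcendental function: error
  terms of size \<open>ln r\<close> are negligible. The calculus is used for the given
  \<open>f\<close> and, in an argument by contradiction, for its logarithmic derivative
  \<open>u\<close>.\<close>

locale nev_large =
  fixes f :: "complex \<Rightarrow> complex"
  assumes f: "f meromorphic_on UNIV" and f_nz: "\<forall>\<^sub>\<approx>z\<in>UNIV. f z \<noteq> 0"
    and ln_small: "(\<lambda>r. ln r) \<in> o[nev_filter](char_T f)"
begin

abbreviation (input) "T \<equiv> char_T f"

lemma const_small: "(\<lambda>_. c) \<in> o[nev_filter](T)"
proof -
  have "(\<lambda>_. c) \<in> O[nev_filter](\<lambda>r. ln r)"
  proof (rule bigoI[where c = "\<bar>c\<bar>"])
    show "eventually (\<lambda>r. norm c \<le> \<bar>c\<bar> * norm (ln r)) nev_filter"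
      using eventually_nev_ge[of "exp 1"]
    proof eventually_elim
      case (elim r)
      hence "r > 0" using exp_gt_zero[of 1] by linarith
      hence "ln r \<ge> 1" using elim ln_ge_iff by auto
      hence "\<bar>c\<bar> * 1 \<le> \<bar>c\<bar> * \<bar>ln r\<bar>" by (intro mult_left_mono) auto
      thus ?case by simp
    qed
  qed
  thus ?thesis using ln_small landau_o.big_small_trans by blast
qed

lemma T_at_top: "filterlim T at_top nev_filter"
proof (rule filterlim_at_top_mono)
  show "filterlim (\<lambda>r. ln r :: real) at_top nev_filter"
    by (rule filterlim_mono[OF ln_at_top order.refl nev_filter_le_at_top])
  show "eventually (\<lambda>r. ln r \<le> T r) nev_filter"
    using landau_o.smallD[OF ln_small zero_less_one] eventually_nev_ge[of 1]
    by eventually_elim (use char_T_nonneg[OF f] in force)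
qed

lemma ln_smallo_T:
  assumes "W \<in> O[nev_filter](T)" "eventually (\<lambda>r. W r \<ge> 1) nev_filter"
  shows "(\<lambda>r. ln (W r)) \<in> o[nev_filter](T)"
proof -
  obtain K where K: "K > 0" "eventually (\<lambda>r. norm (W r) \<le> K * norm (T r)) nev_filter"
    using assms(1) by (elim landau_o.bigE)
  have "(\<lambda>x::real. ln x) \<in> o(\<lambda>x. x)"
    by (intro smalloI_tendsto ln_x_over_x_tendsto_0 eventually_mono[OF eventually_gt_at_top[of 0]]) auto
  from landau_o.small.compose[OF this T_at_top]
  have "(\<lambda>r. ln (T r)) \<in> o[nev_filter](T)" .
  hence "(\<lambda>r. ln K + ln (T r)) \<in> o[nev_filter](T)" using const_small by (intro sum_in_smallo)
  moreover have "eventually (\<lambda>r. T r \<ge> 1) nev_filter" using T_at_top by (simp add: filterlim_at_top)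
  hence "eventually (\<lambda>r. 0 \<le> ln (W r) \<and> ln (W r) \<le> ln K + ln (T r)) nev_filter"
    using K(2) assms(2)
  proof eventually_elim
    case (elim r)
    have "ln (W r) \<le> ln (K * T r)" using elim K(1) by (subst ln_le_cancel_iff) auto
    also have "\<dots> = ln K + ln (T r)" using elim K(1) by (intro ln_mult_pos) auto
    finally show ?case using elim by simp
  qed
  ultimately show ?thesis by (rule smallo_mono_nonneg[rotated])
qed

text \<open>The error is logarithmic in \<open>r\<close> and in the characteristic of
  \<open>g\<close>. Measuring it against \<open>T\<close> instead of \<open>char_T g\<close> lets
  \<open>g\<close> be any coefficient, including a rational one, for which no smallness relative to
  itself could be expected.\<close>

lemma logderiv_smallo:
  assumes g: "g meromorphic_on UNIV" "\<forall>\<^sub>\<approx>z\<in>UNIV. g z \<noteq> 0" and T: "char_T g \<in> O[nev_filter](T)"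
  shows "proximity (\<lambda>z. deriv g z / g z) \<in> o[nev_filter](T)"
proof -
  define c where "c = ln (cmod (zor_poly g 0 0))"
  define W where "W = (\<lambda>r. char_T g r + char_T (\<lambda>z. inverse (g z)) r + 1)"
  have inv: "(\<lambda>z. inverse (g z)) meromorphic_on UNIV" by (intro meromorphic_intros g)
  have "(\<lambda>r. char_T g r + (char_T g r - c) + 1) \<in> O[nev_filter](T)"
    using T landau_o.small_imp_big[OF const_small] by (intro sum_in_bigo)
  moreover have ev: "eventually (\<lambda>r. 0 \<le> W r \<and> W r \<le> char_T g r + (char_T g r - c) + 1) nev_filter"
    using eventually_good_circle[OF g] eventually_nev_ge[of 1]
  proof eventually_elim
    case (elim r)
    thus ?case using char_T_inverse[OF g, of r] char_T_nonneg[OF g(1), of r] char_T_nonneg[OF inv, of r]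
      by (simp add: W_def c_def)
  qed
  ultimately have "W \<in> O[nev_filter](T)" by (rule bigo_mono_nonneg[rotated])
  moreover have "eventually (\<lambda>r. W r \<ge> 1) nev_filter"
    using eventually_nev_ge[of 1]
    by eventually_elim (use char_T_nonneg[OF g(1)] char_T_nonneg[OF inv] in \<open>force simp: W_def\<close>)
  ultimately have "(\<lambda>r. ln (W r)) \<in> o[nev_filter](T)" by (rule ln_smallo_T)
  hence "(\<lambda>r. 2 * (ln 256 + ln r + 3 * ln (W r))) \<in> o[nev_filter](T)"
    using const_small ln_small by (intro landau_o.small.cmult_in_iff[THEN iffD2] sum_in_smallo) auto
  moreover have "eventually (\<lambda>r. 0 \<le> proximity (\<lambda>z. deriv g z / g z) r \<and>
      proximity (\<lambda>z. deriv g z / g z) r \<le> 2 * (ln 256 + ln r + 3 * ln (W r))) nev_filter"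
    using logarithmic_derivative_lemma[OF g] eventually_nev_ge[of 1]
    by eventually_elim (auto simp: W_def intro: proximity_nonneg)
  ultimately show ?thesis by (rule smallo_mono_nonneg[rotated])
qed

text \<open>Wider than \<open>small_function\<close>: only the proximity must be small. The bound on
  the poles merely keeps the characteristic at O(T), which is what the lemma on the logarithmic
  derivative needs. In this way \<open>deriv f z / f z\<close>, whose poles sit at all zeros and
  poles of \<open>f\<close>, is an admissible coefficient.\<close>

definition nev_small :: "(complex \<Rightarrow> complex) \<Rightarrow> bool" where
  "nev_small b \<longleftrightarrow> b meromorphic_on UNIV \<and> proximity b \<in> o[nev_filter](T) \<and> N_count b \<in> O[nev_filter](T)"

lemma nev_small_mero: "nev_small b \<Longrightarrow> b meromorphic_on UNIV"
  by (simp add: nev_small_def)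

lemma nev_smallI:
  assumes "b meromorphic_on UNIV" "m \<in> o[nev_filter](T)" "N \<in> O[nev_filter](T)"
    "eventually (\<lambda>r. proximity b r \<le> m r) nev_filter" "eventually (\<lambda>r. N_count b r \<le> N r) nev_filter"
  shows "nev_small b"
  unfolding nev_small_def
proof (intro conjI assms(1))
  have "eventually (\<lambda>r. 0 \<le> proximity b r \<and> proximity b r \<le> m r) nev_filter"
    using assms(4) eventually_nev_ge[of 0] by eventually_elim (auto intro: proximity_nonneg)
  thus "proximity b \<in> o[nev_filter](T)" using assms(2) by (rule smallo_mono_nonneg)
  have "eventually (\<lambda>r. 0 \<le> N_count b r \<and> N_count b r \<le> N r) nev_filter"
    using assms(5) eventually_nev_ge[of 1] by eventually_elim (auto intro: N_count_nonneg assms(1))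
  thus "N_count b \<in> O[nev_filter](T)" using assms(3) by (rule bigo_mono_nonneg)
qed

lemma nev_small_cong:
  assumes "nev_small a" "\<forall>\<^sub>\<approx>z\<in>UNIV. b z = a z"
  shows "nev_small b"
proof (rule nev_smallI)
  show "b meromorphic_on UNIV" using assms meromorphic_on_cong'[of b a UNIV UNIV] by (simp add: nev_small_def)
  show "proximity a \<in> o[nev_filter](T)" "N_count a \<in> O[nev_filter](T)" using assms by (auto simp: nev_small_def)
  show "eventually (\<lambda>r. proximity b r \<le> proximity a r) nev_filter"
    using proximity_cong_cosparse[OF assms(2)] by eventually_elim simp
qed (use N_count_cong_cosparse[OF assms(2)] in auto)

lemma nev_small_add:
  assumes "nev_small a" "nev_small b"
  shows "nev_small (\<lambda>z. a z + b z)"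
proof (rule nev_smallI)
  note ab = assms[unfolded nev_small_def]
  show "(\<lambda>z. a z + b z) meromorphic_on UNIV" using ab by (intro meromorphic_intros) auto
  show "(\<lambda>r. proximity a r + proximity b r + ln 2) \<in> o[nev_filter](T)"
    using ab const_small by (intro sum_in_smallo) auto
  show "(\<lambda>r. N_count a r + N_count b r) \<in> O[nev_filter](T)"
    using ab by (intro sum_in_bigo) auto
  show "eventually (\<lambda>r. proximity (\<lambda>z. a z + b z) r \<le> proximity a r + proximity b r + ln 2) nev_filter"
    using eventually_analytic_circle[OF nev_small_mero[OF assms(1)]] eventually_analytic_circle[OF nev_small_mero[OF assms(2)]]
    by eventually_elim (rule proximity_add)
  show "eventually (\<lambda>r. N_count (\<lambda>z. a z + b z) r \<le> N_count a r + N_count b r) nev_filter"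
    using eventually_nev_ge[of 1] by eventually_elim (use ab N_count_add in auto)
qed

lemma nev_small_mult:
  assumes "nev_small a" "nev_small b"
  shows "nev_small (\<lambda>z. a z * b z)"
proof (rule nev_smallI)
  note ab = assms[unfolded nev_small_def]
  show "(\<lambda>z. a z * b z) meromorphic_on UNIV" using ab by (intro meromorphic_intros) auto
  show "(\<lambda>r. proximity a r + proximity b r) \<in> o[nev_filter](T)"
    using ab by (intro sum_in_smallo) auto
  show "(\<lambda>r. N_count a r + N_count b r) \<in> O[nev_filter](T)"
    using ab by (intro sum_in_bigo) auto
  show "eventually (\<lambda>r. proximity (\<lambda>z. a z * b z) r \<le> proximity a r + proximity b r) nev_filter"
    using eventually_analytic_circle[OF nev_small_mero[OF assms(1)]] eventually_analytic_circle[OF nev_small_mero[OF assms(2)]]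
    by eventually_elim (rule proximity_mult)
  show "eventually (\<lambda>r. N_count (\<lambda>z. a z * b z) r \<le> N_count a r + N_count b r) nev_filter"
    using eventually_nev_ge[of 1] by eventually_elim (use ab N_count_mult in auto)
qed

lemma nev_small_const: "nev_small (\<lambda>_. c)"
proof (rule nev_smallI)
  show "(\<lambda>_. log_plus (cmod c)) \<in> o[nev_filter](T)" "(\<lambda>_. 0) \<in> O[nev_filter](T)"
    using const_small by auto
qed (auto simp: proximity_const N_count_analytic)

lemma nev_small_prod: "(\<And>i. i \<in> I \<Longrightarrow> nev_small (b i)) \<Longrightarrow> nev_small (\<lambda>z. \<Prod>i\<in>I. b i z)"
  by (induction I rule: infinite_finite_induct) (auto intro: nev_small_const nev_small_mult)

lemma nev_small_power: "nev_small b \<Longrightarrow> nev_small (\<lambda>z. b z ^ k)"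
  by (induction k) (auto intro: nev_small_const nev_small_mult)

lemma nev_small_char_T:
  assumes "nev_small b"
  shows "char_T b \<in> O[nev_filter](T)"
proof -
  have "char_T b = (\<lambda>r. proximity b r + N_count b r)" by (simp add: fun_eq_iff char_T_def)
  moreover have "proximity b \<in> O[nev_filter](T)" "N_count b \<in> O[nev_filter](T)"
    using assms landau_o.small_imp_big by (auto simp: nev_small_def)
  ultimately show ?thesis by (simp add: sum_in_bigo(1))
qed

text \<open>Unless \<open>b\<close> vanishes identically, its derivative is \<open>b\<close> times
  its logarithmic derivative, and the proximity of the latter is small.\<close>

lemma nev_small_deriv:
  assumes b: "nev_small b"
  shows "nev_small (deriv b)"
proof -
  note b' = nev_small_mero[OF b]
  consider "\<forall>\<^sub>\<approx>z\<in>UNIV. b z = 0" | "\<forall>\<^sub>\<approx>z\<in>UNIV. b z \<noteq> 0"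
    using meromorphic_imp_constant_or_avoid[OF b', of 0] by auto
  thus ?thesis
  proof cases
    case 1
    have "\<forall>\<^sub>\<approx>z\<in>UNIV. deriv b z = 0" using cosparse_deriv_cong[OF 1] by simp
    thus ?thesis by (intro nev_small_cong[OF nev_small_const[of 0]])
  next
    case 2
    define u where "u = (\<lambda>z. deriv b z / b z)"
    have mu: "u meromorphic_on UNIV" unfolding u_def by (intro meromorphic_intros b')
    have m: "proximity u \<in> o[nev_filter](T)"
      unfolding u_def by (intro logderiv_smallo b' 2 nev_small_char_T b)
    show ?thesis
    proof (rule nev_smallI)
      show "deriv b meromorphic_on UNIV" by (intro meromorphic_intros b')
      show "(\<lambda>r. proximity u r + proximity b r) \<in> o[nev_filter](T)"
        using b m by (intro sum_in_smallo) (auto simp: nev_small_def)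
      show "(\<lambda>r. N_count b r + N_count b r) \<in> O[nev_filter](T)"
        using b by (intro sum_in_bigo) (auto simp: nev_small_def)
      have "\<forall>\<^sub>\<approx>z\<in>UNIV. deriv b z = u z * b z" using 2 by eventually_elim (simp add: u_def)
      from proximity_cong_cosparse[OF this] eventually_analytic_circle[OF mu] eventually_analytic_circle[OF b']
      show "eventually (\<lambda>r. proximity (deriv b) r \<le> proximity u r + proximity b r) nev_filter"
        by eventually_elim (simp add: proximity_mult)
      show "eventually (\<lambda>r. N_count (deriv b) r \<le> N_count b r + N_count b r) nev_filter"
        using eventually_nev_ge[of 1] by eventually_elim (intro N_count_deriv b')
    qed
  qed
qed

lemma T_inverse_bigo: "char_T (\<lambda>z. inverse (f z)) \<in> O[nev_filter](T)"
proof -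
  have "(\<lambda>r. T r - ln (cmod (zor_poly f 0 0))) \<in> O[nev_filter](T)"
    using landau_o.small_imp_big[OF const_small] by (intro sum_in_bigo) auto
  moreover have "eventually (\<lambda>r. 0 \<le> char_T (\<lambda>z. inverse (f z)) r \<and> char_T (\<lambda>z. inverse (f z)) r \<le> T r - ln (cmod (zor_poly f 0 0))) nev_filter"
    using eventually_good_circle[OF f f_nz] eventually_nev_ge[of 1]
  proof eventually_elim
    case (elim r)
    have "(\<lambda>z. inverse (f z)) meromorphic_on UNIV" by (intro meromorphic_intros f)
    from char_T_nonneg[OF this, of r] show ?case using char_T_inverse[OF f f_nz, of r] elim by simp
  qed
  ultimately show ?thesis by (rule bigo_mono_nonneg[rotated])
qed

lemma nev_small_logderiv: "nev_small (\<lambda>z. deriv f z / f z)"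
proof (rule nev_smallI)
  show "(\<lambda>z. deriv f z / f z) meromorphic_on UNIV" by (intro meromorphic_intros f)
  show "proximity (\<lambda>z. deriv f z / f z) \<in> o[nev_filter](T)" by (intro logderiv_smallo f f_nz) auto
  show "(\<lambda>r. T r + char_T (\<lambda>z. inverse (f z)) r) \<in> O[nev_filter](T)"
    using T_inverse_bigo by (intro sum_in_bigo) auto
  show "eventually (\<lambda>r. N_count (\<lambda>z. deriv f z / f z) r \<le> T r + char_T (\<lambda>z. inverse (f z)) r) nev_filter"
    using eventually_nev_ge[of 1]
  proof eventually_elim
    case (elim r)
    show ?case using N_count_logderiv[OF f f_nz, of r] elim proximity_nonneg[of r f] proximity_nonneg[of r "\<lambda>z. inverse (f z)"]
      by (simp add: char_T_def)
  qed
qed auto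

lemma nev_small_if_char_T_smallo:
  assumes "a meromorphic_on UNIV" "char_T a \<in> o[nev_filter](T)"
  shows "nev_small a"
proof (rule nev_smallI[OF assms(1,2) landau_o.small_imp_big[OF assms(2)]])
  show "eventually (\<lambda>r. proximity a r \<le> char_T a r) nev_filter"
    using eventually_nev_ge[of 1] by eventually_elim (simp add: char_T_def N_count_nonneg assms)
  show "eventually (\<lambda>r. N_count a r \<le> char_T a r) nev_filter"
    using eventually_nev_ge[of 1] by eventually_elim (simp add: char_T_def proximity_nonneg)
qed

end

subsection \<open>Growth of rational and of transcendental functions\<close>

lemma norm_poly_le:
  fixes p :: "complex poly"
  obtains C where "C \<ge> 0" "\<And>z. cmod z \<ge> 1 \<Longrightarrow> cmod (poly p z) \<le> C * cmod z ^ degree p"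
proof (rule that[of "\<Sum>i\<le>degree p. cmod (coeff p i)"])
  fix z :: complex assume z: "cmod z \<ge> 1"
  have "cmod (poly p z) \<le> (\<Sum>i\<le>degree p. cmod (coeff p i * z ^ i))"
    unfolding poly_altdef by (rule norm_sum)
  also have "\<dots> \<le> (\<Sum>i\<le>degree p. cmod (coeff p i) * cmod z ^ degree p)"
    using z by (intro sum_mono) (auto simp: norm_mult norm_power intro!: mult_left_mono power_increasing)
  finally show "cmod (poly p z) \<le> (\<Sum>i\<le>degree p. cmod (coeff p i)) * cmod z ^ degree p"
    by (simp add: sum_distrib_right)
qed (auto intro: sum_nonneg)

lemma norm_poly_ge_aux:
  fixes q :: "complex poly"
  shows "q \<noteq> 0 \<Longrightarrow> \<exists>c>0. \<exists>R\<ge>1. \<forall>z. cmod z \<ge> R \<longrightarrow> c * cmod z ^ degree q \<le> cmod (poly q z)"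
proof (induction q rule: pCons_induct)
  case (pCons a p)
  show ?case
  proof (cases "p = 0")
    case True
    thus ?thesis using pCons.prems by (intro exI[of _ "cmod a"]) auto
  next
    case False
    then obtain c R where c: "c > 0" "R \<ge> 1" "\<And>z. cmod z \<ge> R \<Longrightarrow> c * cmod z ^ degree p \<le> cmod (poly p z)"
      using pCons.IH by blast
    show ?thesis
    \<comment> \<open>Beyond the radius \<open>2 * cmod a / c\<close> the constant coefficient costs
      at most half of the bound for \<open>z * poly p z\<close>.\<close>
    proof (rule exI[of _ "c / 2"], intro conjI exI[of _ "max R (2 * cmod a / c)"] allI impI)
      fix z :: complex assume z: "cmod z \<ge> max R (2 * cmod a / c)"
      have z1: "1 \<le> cmod z ^ degree p" using z c by (intro one_le_power) auto
      have "cmod a \<le> c / 2 * cmod z * 1" using z c by (simp add: field_simps)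
      also have "\<dots> \<le> c / 2 * cmod z * cmod z ^ degree p" using z1 c by (intro mult_left_mono) auto
      finally have "cmod a \<le> c / 2 * cmod z * cmod z ^ degree p" .
      moreover have "c * cmod z * cmod z ^ degree p \<le> cmod (z * poly p z)"
        using mult_left_mono[OF c(3)[of z], of "cmod z"] z by (simp add: norm_mult mult_ac)
      moreover have "cmod (z * poly p z) \<le> cmod (a + z * poly p z) + cmod a"
        using norm_triangle_ineq4[of "a + z * poly p z" a] by simp
      ultimately show "c / 2 * cmod z ^ degree (pCons a p) \<le> cmod (poly (pCons a p) z)"
        using False by simp
    qed (use c in auto)
  qed
qed auto

lemma norm_poly_ge:
  fixes q :: "complex poly"
  assumes "q \<noteq> 0"
  obtains c R where "c > 0" "R \<ge> 1" "\<And>z. cmod z \<ge> R \<Longrightarrow> c * cmod z ^ degree q \<le> cmod (poly q z)"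
  using norm_poly_ge_aux[OF assms] by blast

lemma analytic_on_poly_fun: "(\<lambda>z. poly p z :: complex) analytic_on A"
proof -
  have "(\<lambda>z. poly p z) holomorphic_on UNIV"
    by (auto simp: holomorphic_on_def field_differentiable_def intro!: exI DERIV_subset[OF poly_DERIV])
  hence "(\<lambda>z. poly p z) analytic_on UNIV" by (simp add: analytic_on_open)
  thus ?thesis by (rule analytic_on_subset) auto
qed

lemma poly_nonzero_cosparse:
  fixes p :: "complex poly"
  assumes "p \<noteq> 0"
  shows "\<forall>\<^sub>\<approx>z\<in>UNIV. poly p z \<noteq> 0"
  unfolding eventually_cosparse using poly_roots_finite[OF assms] by (auto intro: finite_imp_sparse)

lemma proximity_quotient_poly:
  fixes p q :: "complex poly"
  assumes "q \<noteq> 0"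
  obtains M R where "M \<ge> 0" "\<And>r. r \<ge> R \<Longrightarrow> proximity (\<lambda>z. poly p z / poly q z) r \<le> M * ln r"
proof -
  obtain C where C: "C \<ge> 0" "\<And>z. cmod z \<ge> 1 \<Longrightarrow> cmod (poly p z) \<le> C * cmod z ^ degree p"
    using norm_poly_le by blast
  obtain c R where c': "c > 0" "R \<ge> 1" "\<And>z. cmod z \<ge> R \<Longrightarrow> c * cmod z ^ degree q \<le> cmod (poly q z)"
    using norm_poly_ge[OF assms] by blast
  have c: "c > 0" "\<And>z. cmod z \<ge> R \<Longrightarrow> cmod (poly q z) \<ge> c"
  proof -
    fix z :: complex assume z: "cmod z \<ge> R"
    have "c * 1 \<le> c * cmod z ^ degree q" using z c' by (intro mult_left_mono one_le_power) auto
    thus "cmod (poly q z) \<ge> c" using c'(3)[OF z] by simp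
  qed (rule c')
  show ?thesis
  proof (rule that[of "log_plus (C / c) + degree p" "max (exp 1) R"])
    fix r assume r: "r \<ge> max (exp 1) R"
    hence "r > 0" using exp_gt_zero[of 1] by linarith
    hence lnr: "ln r \<ge> 1" using r ln_ge_iff by auto
    have r1: "r \<ge> 1" using r exp_ge_add_one_self[of 1] by linarith
    have nz: "poly q z \<noteq> 0" if "cmod z = r" for z using c(2)[of z] c(1) r that by auto
    have "continuous_on (sphere 0 r) (\<lambda>z. poly p z / poly q z)"
      using nz by (intro continuous_on_sphere_if_analytic analytic_intros analytic_on_poly_fun) auto
    hence "proximity (\<lambda>z. poly p z / poly q z) r \<le> circ_mean (\<lambda>_. log_plus (C / c) + degree p * ln r) r"
      unfolding proximity_eq_circ_mean
    proof (intro circ_mean_mono continuous_intros)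
      fix z :: complex assume z: "cmod z = r"
      have "cmod (poly p z / poly q z) \<le> (C * r ^ degree p) / c"
        unfolding norm_divide using C(1) C(2)[of z] c(1) c(2)[of z] z r r1 by (intro frac_le) auto
      hence "log_plus (cmod (poly p z / poly q z)) \<le> log_plus ((C / c) * r ^ degree p)"
        by (intro log_plus_mono) auto
      also have "\<dots> \<le> log_plus (C / c) + log_plus (r ^ degree p)"
        using C c r1 by (intro log_plus_mult) auto
      also have "log_plus (r ^ degree p) = degree p * ln r"
        using r1 by (simp add: log_plus_power) (simp add: log_plus_def)
      finally show "log_plus (cmod (poly p z / poly q z)) \<le> log_plus (C / c) + degree p * ln r" .
    qed (use r1 nz in auto)
    also have "\<dots> = log_plus (C / c) * 1 + degree p * ln r" by simp
    also have "\<dots> \<le> log_plus (C / c) * ln r + degree p * ln r"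
      using lnr by (intro add_mono mult_left_mono) auto
    finally show "proximity (\<lambda>z. poly p z / poly q z) r \<le> (log_plus (C / c) + degree p) * ln r"
      by (simp add: ring_distribs)
  qed auto
qed

lemma rational_function_meromorphic:
  assumes "rational_function a"
  shows "a meromorphic_on UNIV" "finite {z. is_pole a z}"
proof -
  obtain p q where q: "q \<noteq> 0" and a: "\<forall>\<^sub>\<approx>z\<in>UNIV. a z = poly p z / poly q z"
    using assms unfolding rational_function_def by blast
  have "(\<lambda>z. poly p z / poly q z) meromorphic_on UNIV"
    by (intro meromorphic_intros analytic_on_imp_meromorphic_on analytic_on_poly_fun)
  thus "a meromorphic_on UNIV" using meromorphic_on_cong'[OF a refl] by simp
  have "poly q z = 0" if "is_pole a z" for z
  proof (rule ccontr)
    assume "poly q z \<noteq> 0"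
    hence "(\<lambda>z. poly p z / poly q z) analytic_on {z}" by (intro analytic_intros analytic_on_poly_fun) auto
    moreover have "is_pole (\<lambda>z. poly p z / poly q z) z"
      using that is_pole_cong[OF cosparse_UNIV_at[OF a] refl] by simp
    ultimately show False using analytic_at_imp_no_pole by blast
  qed
  thus "finite {z. is_pole a z}" by (intro finite_subset[OF _ poly_roots_finite[OF q]]) auto
qed

lemma rational_function_char_T:
  assumes "rational_function a"
  shows "char_T a \<in> O[nev_filter](\<lambda>r. ln r)"
proof -
  obtain p q where q: "q \<noteq> 0" and a: "\<forall>\<^sub>\<approx>z\<in>UNIV. a z = poly p z / poly q z"
    using assms unfolding rational_function_def by blast
  note mero = rational_function_meromorphic[OF assms]
  obtain M R where M: "M \<ge> 0" "\<And>r. r \<ge> R \<Longrightarrow> proximity (\<lambda>z. poly p z / poly q z) r \<le> M * ln r"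
    using proximity_quotient_poly[OF q] by blast
  have "eventually (\<lambda>r. 0 \<le> proximity a r \<and> proximity a r \<le> M * ln r) nev_filter"
    using proximity_cong_cosparse[OF a] eventually_nev_ge[of R] eventually_nev_ge[of 0]
    by eventually_elim (use M proximity_nonneg in auto)
  hence "proximity a \<in> O[nev_filter](\<lambda>r. ln r)" by (rule bigo_mono_nonneg) auto
  moreover have "N_count a \<in> O[nev_filter](\<lambda>r. ln r)"
    using N_count_finite_poles_nev[OF mero] .
  moreover have "char_T a = (\<lambda>r. proximity a r + N_count a r)" by (simp add: fun_eq_iff char_T_def)
  ultimately show ?thesis by (simp add: sum_in_bigo(1))
qed

text \<open>Cauchy's inequality at the origin kills all Taylor coefficients of index above
  \<open>N\<close>. The bound is asked only on some arbitrarily large circles, because the negation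
  of a growth statement supplies no more than that.\<close>

lemma entire_polynomial_growth:
  assumes H: "H holomorphic_on UNIV"
    and bd: "\<And>r0. \<exists>r\<ge>r0. \<forall>z. cmod z = r \<longrightarrow> cmod (H z) \<le> C * r ^ N"
  obtains P where "\<And>z. H z = poly P z"
proof -
  have zero: "(deriv ^^ k) H 0 = 0" if k: "k > N" for k
  proof (rule ccontr)
    define D where "D = cmod ((deriv ^^ k) H 0)"
    assume "(deriv ^^ k) H 0 \<noteq> 0"
    hence D: "D > 0" by (simp add: D_def)
    \<comment> \<open>So large that \<open>D * r\<close> exceeds
      \<open>fact k * \<bar>C\<bar>\<close>, which contradicts Cauchy's inequality as
      \<open>k > N\<close>.\<close>
    obtain r where r: "r \<ge> max 1 (fact k * \<bar>C\<bar> / D + 1)" "\<And>z. cmod z = r \<Longrightarrow> cmod (H z) \<le> C * r ^ N"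
      using bd by blast
    have "D \<le> fact k * (C * r ^ N) / r ^ k" unfolding D_def
    proof (rule Cauchy_inequality)
      show "H holomorphic_on ball 0 r" using H by (rule holomorphic_on_subset) auto
      show "continuous_on (cball 0 r) H"
        by (rule holomorphic_on_imp_continuous_on, rule holomorphic_on_subset[OF H]) auto
    qed (use r in auto)
    also have "\<dots> \<le> fact k * (\<bar>C\<bar> * r ^ N) / r ^ k"
      using r by (intro divide_right_mono mult_left_mono mult_right_mono) auto
    also have "r ^ k = r ^ N * r ^ (k - N)" using k by (simp flip: power_add)
    also have "fact k * (\<bar>C\<bar> * r ^ N) / (r ^ N * r ^ (k - N)) = fact k * \<bar>C\<bar> / r ^ (k - N)"
      using r by simp
    also have "\<dots> \<le> fact k * \<bar>C\<bar> / r ^ 1"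
      using r k by (intro divide_left_mono power_increasing mult_pos_pos) auto
    finally have "D * r \<le> fact k * \<bar>C\<bar>" using r by (simp add: field_simps)
    moreover have "D * r \<ge> D * (fact k * \<bar>C\<bar> / D + 1)" using r D by (intro mult_left_mono) auto
    moreover have "D * (fact k * \<bar>C\<bar> / D + 1) = fact k * \<bar>C\<bar> + D" using D by (simp add: field_simps)
    ultimately show False using D by linarith
  qed
  show ?thesis
  proof (rule that)
    fix z
    have "((\<lambda>n. (deriv ^^ n) H 0 / (fact n) * (z - 0)^n) sums H z)"
      by (rule holomorphic_power_series[of H 0 "cmod z + 1"]) (auto intro: holomorphic_on_subset[OF H])
    moreover have "((\<lambda>n. (deriv ^^ n) H 0 / (fact n) * (z - 0)^n) sums (\<Sum>n\<in>{..N}. (deriv ^^ n) H 0 / (fact n) * (z - 0)^n))"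
      by (rule sums_finite) (auto simp: zero)
    ultimately have "H z = (\<Sum>n\<in>{..N}. (deriv ^^ n) H 0 / (fact n) * (z - 0)^n)" by (rule sums_unique2)
    also have "\<dots> = poly (\<Sum>n\<in>{..N}. monom ((deriv ^^ n) H 0 / (fact n)) n) z"
      by (simp add: poly_sum poly_monom)
    finally show "H z = poly (\<Sum>n\<in>{..N}. monom ((deriv ^^ n) H 0 / (fact n)) n) z" .
  qed
qed

lemma analytic_pole_mult_0: "f analytic_on UNIV \<Longrightarrow> pole_mult f z = 0"
  by (rule pole_mult_analytic) (rule analytic_on_subset, auto)

text \<open>Without poles only the Poisson integral remains in \<open>poisson_jensen_upper\<close>,
  and for \<open>cmod z \<le> R / 2\<close> the kernel is at most
  \<open>(R + cmod z) / (R - cmod z) \<le> 3\<close>.\<close>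

lemma log_plus_le_proximity:
  assumes H: "H analytic_on UNIV" and H_nz: "\<forall>\<^sub>\<approx>z\<in>UNIV. H z \<noteq> 0"
    and R: "good_circle H R" and z: "cmod z \<le> R / 2"
  shows "log_plus (cmod (H z)) \<le> 3 * proximity H R"
proof (cases "H z = 0")
  case True
  have "R > 0" using R by (simp add: good_circle_def)
  thus ?thesis using True by (simp add: log_plus_def proximity_nonneg)
next
  case False
  have mero: "H meromorphic_on UNIV" using H by (rule analytic_on_imp_meromorphic_on)
  have R0: "R > 0" using R by (simp add: good_circle_def)
  have Ha: "H analytic_on {w}" for w using H by (rule analytic_on_subset) auto
  have zR: "cmod z < R" using z R0 by linarith
  have cont: "continuous_on (sphere 0 R) H" by (intro continuous_on_sphere_if_analytic Ha)
  have "z \<notin> sing_set H R" using False Ha by (simp add: sing_set_def[OF mero H_nz])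
  hence "log_plus (cmod (H z)) \<le> circ_mean (\<lambda>w. log_plus (cmod (H w)) * poisson_kernel R z w) R +
           (\<Sum>a\<in>sing_set H R. real (pole_mult H a) * ln (cmod (blaschke R a z)))"
    by (intro poisson_jensen_upper[OF mero H_nz R zR])
  also have "(\<Sum>a\<in>sing_set H R. real (pole_mult H a) * ln (cmod (blaschke R a z))) = 0"
    by (simp add: analytic_pole_mult_0[OF H])
  also have "circ_mean (\<lambda>w. log_plus (cmod (H w)) * poisson_kernel R z w) R \<le> circ_mean (\<lambda>w. 3 * log_plus (cmod (H w))) R"
  proof (rule circ_mean_mono)
    show "continuous_on (sphere 0 R) (\<lambda>w. log_plus (cmod (H w)) * poisson_kernel R z w)"
      using zR by (intro continuous_intros cont continuous_on_poisson_kernel) auto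
    show "continuous_on (sphere 0 R) (\<lambda>w. 3 * log_plus (cmod (H w)))"
      by (intro continuous_intros cont) auto
    fix w :: complex assume w: "cmod w = R"
    have "poisson_kernel R z w \<le> (R + cmod z) / (R - cmod z)" by (rule poisson_kernel_le[OF zR w])
    also have "\<dots> \<le> 3" using z zR by (simp add: divide_simps)
    finally have "log_plus (cmod (H w)) * poisson_kernel R z w \<le> log_plus (cmod (H w)) * 3"
      by (intro mult_left_mono) auto
    thus "log_plus (cmod (H w)) * poisson_kernel R z w \<le> 3 * log_plus (cmod (H w))" by simp
  qed (use R0 in auto)
  also have "\<dots> = 3 * proximity H R" by (simp add: circ_mean_cmult proximity_eq_circ_mean)
  finally show ?thesis by simp
qed

text \<open>\<open>p\<close> is the product of the \<open>z - b\<close> to the pole multiplicities.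
  The equation for \<open>H\<close> holds at every point where \<open>f\<close> is analytic, not
  only off some discrete set, so that it can be used on whole circles.\<close>

lemma clear_poles:
  assumes f: "f meromorphic_on UNIV" and fin: "finite {z. is_pole f z}"
  obtains p H where "p \<noteq> 0" "\<And>z. poly p z = 0 \<Longrightarrow> is_pole f z" "H analytic_on UNIV"
    "\<And>z. f analytic_on {z} \<Longrightarrow> H z = f z * poly p z"
proof -
  define Z where "Z = {z. is_pole f z}"
  define p where "p = (\<Prod>b\<in>Z. [:-b, 1:] ^ pole_mult f b)"
  have pz: "poly p z = (\<Prod>b\<in>Z. (z - b) ^ pole_mult f b)" for z
    by (simp add: p_def poly_prod)
  define g where "g = (\<lambda>z. f z * poly p z)"
  have g: "g meromorphic_on UNIV" unfolding g_def
    by (intro meromorphic_intros f analytic_on_imp_meromorphic_on analytic_on_poly_fun)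
  have np: "\<not>is_pole g z" for z
  proof (cases "z \<in> Z")
    case False
    have "pole_mult g z \<le> pole_mult f z + pole_mult (poly p) z" unfolding g_def
      by (intro pole_mult_mult meromorphic_on_UNIV_at f analytic_on_imp_meromorphic_on analytic_on_poly_fun)
    also have "\<dots> = 0"
      using False pole_mult_eq_0_iff[OF meromorphic_on_UNIV_at[OF f], of z] pole_mult_analytic[OF analytic_on_poly_fun]
      by (simp add: Z_def)
    finally show ?thesis using pole_mult_eq_0_iff[OF meromorphic_on_UNIV_at[OF g], of z] by simp
  next
    case True
    obtain F where F: "F analytic_on {z}" "eventually (\<lambda>w. f w * (w - z) ^ pole_mult f z = F w) (at z)"
      using pole_mult_le_iff[OF meromorphic_on_UNIV_at[OF f], of z "pole_mult f z"] by auto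
    have an: "(\<lambda>w. F w * (\<Prod>b\<in>Z-{z}. (w - b) ^ pole_mult f b)) analytic_on {z}"
      using F by (intro analytic_intros)
    have "eventually (\<lambda>w. g w = F w * (\<Prod>b\<in>Z-{z}. (w - b) ^ pole_mult f b)) (at z)"
      using F(2)
    proof eventually_elim
      case (elim w)
      show ?case unfolding elim[symmetric] g_def pz
        using True fin by (simp add: Z_def prod.remove mult_ac)
    qed
    from is_pole_cong[OF this refl] show ?thesis using analytic_at_imp_no_pole[OF an] by simp
  qed
  define H where "H = remove_sings g"
  have "\<not>is_pole H z" for z
  proof -
    have "eventually (\<lambda>w. H w = g w) (at z)"
      unfolding H_def by (rule cosparse_UNIV_at[OF eventually_remove_sings_eq[OF g]])
    from is_pole_cong[OF this refl] show ?thesis using np by simp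
  qed
  hence "H analytic_on UNIV" unfolding H_def
    using remove_sings_nicely_meromorphic[OF g] by (intro nicely_meromorphic_without_singularities) auto
  moreover have "p \<noteq> 0" unfolding p_def using fin by (auto simp: Z_def)
  moreover have "is_pole f z" if "poly p z = 0" for z
    using that fin unfolding pz by (auto simp: Z_def split: if_splits)
  moreover have "H z = f z * poly p z" if "f analytic_on {z}" for z
  proof -
    have "g analytic_on {z}" unfolding g_def using that by (intro analytic_intros analytic_on_poly_fun)
    thus ?thesis by (simp add: H_def g_def)
  qed
  ultimately show ?thesis using that by blast
qed

text \<open>If the characteristic stays below \<open>K * ln r\<close> on arbitrarily large good
  circles, then \<open>f\<close> has at most \<open>2 * K\<close> poles. Clearing them leaves an
  entire function with logarithmic proximity on these circles, hence of polynomial growth on the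
  circles of half the radius. It is a polynomial, and \<open>f\<close> would be rational.\<close>

lemma transcendental_growth:
  assumes f: "f meromorphic_on UNIV" and f_nz: "\<forall>\<^sub>\<approx>z\<in>UNIV. f z \<noteq> 0" and tr: "\<not>rational_function f"
  shows "(\<lambda>r. ln r) \<in> o[nev_filter](char_T f)"
proof (rule landau_o.smallI)
  fix c :: real assume c: "c > 0"
  define K where "K = 1 / c"
  have K: "K > 0" using c by (simp add: K_def)
  have "\<exists>r0\<ge>1. \<forall>r\<ge>r0. good_circle f r \<longrightarrow> K * ln r \<le> char_T f r"
  proof (rule ccontr)
    assume "\<not> ?thesis"
    hence low: "\<exists>r\<ge>r0. good_circle f r \<and> char_T f r < K * ln r" if "r0 \<ge> 1" for r0
      using that by (meson not_le)
    have count: "real (card B) \<le> 2 * K" if B: "finite B" "B \<subseteq> {z. is_pole f z}" for B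
    proof -
      \<comment> \<open>A disc of radius \<open>t\<close> contains \<open>B\<close>, and
        \<open>r \<ge> t^2\<close> places \<open>B\<close> within radius \<open>sqrt r\<close>.
        Between \<open>sqrt r\<close> and \<open>r\<close> the logarithm grows by half of
        \<open>ln r\<close>, which yields the factor 2 in \<open>2 * K\<close>.\<close>
      define t where "t = Max (insert 1 (cmod ` B))"
      have t: "t \<ge> 1" "\<And>z. z \<in> B \<Longrightarrow> cmod z \<le> t" using B(1) by (auto simp: t_def intro: Max_ge)
      obtain r where r: "r \<ge> max 2 (t\<^sup>2)" "good_circle f r" "char_T f r < K * ln r"
        using low[of "max 2 (t\<^sup>2)", OF max.coboundedI1] by auto
      have st: "t \<le> sqrt r" using r t by (intro real_le_rsqrt) auto
      have lnr: "ln r > 0" using r by auto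
      have lt: "sqrt r < r"
      proof -
        have "sqrt r * 1 < sqrt r * sqrt r" using r by (intro mult_strict_left_mono) auto
        thus ?thesis using r by simp
      qed
      let ?A = "{z. cmod z \<le> sqrt r \<and> real (pole_mult f z) \<noteq> 0}"
      note pm = pole_mult_eq_0_iff[OF meromorphic_on_UNIV_at[OF f]]
      have fA: "finite ?A" using locally_finite_supportD[OF locally_finite_support_pole_mult[OF f]] .
      have "real (card B) = (\<Sum>z\<in>B. 1)" by simp
      also have "\<dots> \<le> (\<Sum>z\<in>B. real (pole_mult f z))"
        using B pm by (intro sum_mono) (auto simp: Suc_le_eq subset_iff intro!: Nat.gr0I)
      also have "\<dots> \<le> (\<Sum>z\<in>?A. real (pole_mult f z))"
        using B pm t(2) st fA by (intro sum_mono2) force+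
      finally have "real (card B) * (ln r - ln (sqrt r)) \<le> (\<Sum>z\<in>?A. real (pole_mult f z)) * (ln r - ln (sqrt r))"
        using lt r by (intro mult_right_mono) auto
      also have "\<dots> \<le> log_count (\<lambda>z. real (pole_mult f z)) r"
        using st t lt by (intro count_le_log_count locally_finite_support_pole_mult f) auto
      also have "\<dots> = N_count f r" using r by (simp add: N_count_eq[OF f])
      also have "\<dots> \<le> char_T f r" using r by (simp add: char_T_def proximity_nonneg)
      also have "\<dots> < K * ln r" by fact
      finally have "real (card B) * (ln r / 2) < (2 * K) * (ln r / 2)" using r by (simp add: ln_sqrt)
      thus ?thesis using lnr by (simp add: mult_less_cancel_right)
    qed
    have fin: "finite {z. is_pole f z}"
    proof (rule ccontr)
      assume "infinite {z. is_pole f z}"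
      then obtain B where B: "finite B" "card B = nat \<lceil>2 * K\<rceil> + 1" "B \<subseteq> {z. is_pole f z}"
        using infinite_arbitrarily_large by metis
      have "real (card B) \<le> 2 * K" using count[OF B(1,3)] .
      moreover have "real (nat \<lceil>2 * K\<rceil>) \<ge> 2 * K" by linarith
      ultimately show False using B(2) by simp
    qed
    obtain p H where pH: "p \<noteq> 0" "\<And>z. poly p z = 0 \<Longrightarrow> is_pole f z" "H analytic_on UNIV"
      "\<And>z. f analytic_on {z} \<Longrightarrow> H z = f z * poly p z" using clear_poles[OF f fin] by blast
    have Hfp: "\<forall>\<^sub>\<approx>z\<in>UNIV. H z = f z * poly p z"
      using meromorphic_on_imp_analytic_cosparse[OF f] by eventually_elim (rule pH(4))
    have H_nz: "\<forall>\<^sub>\<approx>z\<in>UNIV. H z \<noteq> 0"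
      using Hfp f_nz poly_nonzero_cosparse[OF pH(1)] by eventually_elim simp
    obtain M R where M: "M \<ge> 0" "\<And>r. r \<ge> R \<Longrightarrow> proximity (\<lambda>z. poly p z / poly 1 z) r \<le> M * ln r"
      using proximity_quotient_poly[of 1 p] by auto
    \<comment> \<open>The factor 3 is that of \<open>log_plus_le_proximity\<close>, and
      \<open>M\<close> accounts for the polynomial \<open>p\<close>. The factor \<open>2 ^ N\<close>
      below compensates for evaluating at \<open>r / 2\<close>.\<close>
    define N where "N = nat \<lceil>3 * (K + M)\<rceil>"
    have N: "3 * (K + M) \<le> real N" unfolding N_def by linarith
    have "\<exists>s\<ge>s0. \<forall>z. cmod z = s \<longrightarrow> cmod (H z) \<le> 2 ^ N * s ^ N" for s0
    proof -
      obtain r where r: "r \<ge> max (max 1 R) (2 * s0)" "good_circle f r" "char_T f r < K * ln r"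
        using low[of "max (max 1 R) (2 * s0)", OF max.coboundedI1[OF max.coboundedI1]] by auto
      have fr: "f analytic_on {z}" "f z \<noteq> 0" if "cmod z = r" for z using r(2) that by (auto simp: good_circle_def)
      have pr: "poly p z \<noteq> 0" if "cmod z = r" for z
        using pH(2)[of z] analytic_at_imp_no_pole[OF fr(1)[OF that]] by blast
      have Hr: "good_circle H r" unfolding good_circle_def
        using r pH(3,4) fr pr by (auto intro: analytic_on_subset)
      have "proximity H r = proximity (\<lambda>z. f z * poly p z) r"
        using fr pH(4) r by (intro proximity_cong_circle) auto
      also have "\<dots> \<le> proximity f r + proximity (poly p) r"
        using fr r by (intro proximity_mult) (auto simp: analytic_circle_def analytic_on_poly_fun)
      also have "proximity f r \<le> char_T f r" using r by (simp add: char_T_def N_count_nonneg f)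
      also have "proximity (poly p) r \<le> M * ln r" using M(2)[of r] r by simp
      finally have "3 * proximity H r \<le> 3 * (K + M) * ln r" using r(3) by (simp add: ring_distribs)
      also have "\<dots> \<le> real N * ln r" using N r by (intro mult_right_mono) auto
      finally have prox: "3 * proximity H r \<le> real N * ln r" .
      show ?thesis
      proof (intro exI[of _ "r / 2"] conjI allI impI)
        fix z :: complex assume z: "cmod z = r / 2"
        show "cmod (H z) \<le> 2 ^ N * (r / 2) ^ N"
        proof (cases "H z = 0")
          case False
          have "ln (cmod (H z)) \<le> log_plus (cmod (H z))" by (rule ln_le_log_plus)
          also have "\<dots> \<le> 3 * proximity H r" using z by (intro log_plus_le_proximity pH H_nz Hr) auto
          also have "\<dots> \<le> ln (r ^ N)" using prox r by (simp add: ln_realpow)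
          finally have "cmod (H z) \<le> r ^ N" using False r by (subst (asm) ln_le_cancel_iff) auto
          also have "r ^ N = 2 ^ N * (r / 2) ^ N" by (simp add: power_divide)
          finally show ?thesis .
        qed (use r in auto)
      qed (use r in auto)
    qed
    moreover have "H holomorphic_on UNIV" using pH(3) analytic_imp_holomorphic by blast
    ultimately obtain P where P: "\<And>z. H z = poly P z" using entire_polynomial_growth by blast
    have "\<forall>\<^sub>\<approx>z\<in>UNIV. f z = poly P z / poly p z"
      using Hfp poly_nonzero_cosparse[OF pH(1)] by eventually_elim (simp add: P[symmetric])
    hence "rational_function f" unfolding rational_function_def using pH(1) by blast
    thus False using tr by blast
  qed
  then obtain r0 where r0: "r0 \<ge> 1" "\<And>r. r \<ge> r0 \<Longrightarrow> good_circle f r \<Longrightarrow> K * ln r \<le> char_T f r" by blast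
  show "eventually (\<lambda>r. norm (ln r) \<le> c * norm (char_T f r)) nev_filter"
    using eventually_good_circle[OF f f_nz] eventually_nev_ge[of r0]
  proof eventually_elim
    case (elim r)
    have "ln r \<ge> 0" using elim r0(1) by simp
    moreover have "ln r \<le> c * char_T f r" using r0(2)[of r] elim c by (simp add: K_def field_simps)
    moreover have "char_T f r \<ge> 0" using char_T_nonneg[OF f] elim r0(1) by simp
    ultimately show ?case by simp
  qed
qed

subsection \<open>Polynomials in \<open>f\<close> with small coefficients\<close>

lemma rational_nev_small:
  assumes "nev_large f" "rational_function a"
  shows "nev_large.nev_small f a"
proof -
  interpret nev_large f by fact
  show ?thesis
    using rational_function_meromorphic[OF assms(2)] rational_function_char_T[OF assms(2)] ln_small
    by (intro nev_small_if_char_T_smallo) (auto intro: landau_o.big_small_trans)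
qed

context nev_large
begin

text \<open>Ordinary polynomials in \<open>f\<close> replace differential polynomials: the
  derivatives of \<open>f\<close> are moved into the coefficients as quotients by \<open>f\<close>.
  The degree in \<open>f\<close> is the only quantity that the estimates use.\<close>

definition small_poly :: "nat \<Rightarrow> (complex \<Rightarrow> complex) \<Rightarrow> bool" where
  "small_poly d g \<longleftrightarrow> (\<exists>b. (\<forall>i. nev_small (b i)) \<and> (\<forall>\<^sub>\<approx>z\<in>UNIV. g z = (\<Sum>i\<le>d. b i z * f z ^ i)))"

lemma small_poly_cong:
  assumes "small_poly d g" "\<forall>\<^sub>\<approx>z\<in>UNIV. h z = g z"
  shows "small_poly d h"
proof -
  obtain b where b: "\<And>i. nev_small (b i)" "\<forall>\<^sub>\<approx>z\<in>UNIV. g z = (\<Sum>i\<le>d. b i z * f z ^ i)"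
    using assms(1) unfolding small_poly_def by blast
  have "\<forall>\<^sub>\<approx>z\<in>UNIV. h z = (\<Sum>i\<le>d. b i z * f z ^ i)" using b(2) assms(2) by eventually_elim simp
  thus ?thesis using b(1) unfolding small_poly_def by blast
qed

lemma small_poly_add:
  assumes "small_poly d g" "small_poly d h"
  shows "small_poly d (\<lambda>z. g z + h z)"
proof -
  obtain b where b: "\<And>i. nev_small (b i)" "\<forall>\<^sub>\<approx>z\<in>UNIV. g z = (\<Sum>i\<le>d. b i z * f z ^ i)"
    using assms(1) unfolding small_poly_def by blast
  obtain c where c: "\<And>i. nev_small (c i)" "\<forall>\<^sub>\<approx>z\<in>UNIV. h z = (\<Sum>i\<le>d. c i z * f z ^ i)"
    using assms(2) unfolding small_poly_def by blast
  have "\<forall>\<^sub>\<approx>z\<in>UNIV. g z + h z = (\<Sum>i\<le>d. (b i z + c i z) * f z ^ i)"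
    using b(2) c(2) by eventually_elim (simp add: sum.distrib distrib_right)
  moreover have "nev_small (\<lambda>z. b i z + c i z)" for i by (intro nev_small_add b c)
  ultimately show ?thesis unfolding small_poly_def by (intro exI[of _ "\<lambda>i z. b i z + c i z"]) auto
qed

lemma small_poly_mult_small:
  assumes "nev_small a" "small_poly d g"
  shows "small_poly d (\<lambda>z. a z * g z)"
proof -
  obtain b where b: "\<And>i. nev_small (b i)" "\<forall>\<^sub>\<approx>z\<in>UNIV. g z = (\<Sum>i\<le>d. b i z * f z ^ i)"
    using assms(2) unfolding small_poly_def by blast
  have "\<forall>\<^sub>\<approx>z\<in>UNIV. a z * g z = (\<Sum>i\<le>d. (a z * b i z) * f z ^ i)"
    using b(2) by eventually_elim (simp add: sum_distrib_left mult_ac)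
  moreover have "nev_small (\<lambda>z. a z * b i z)" for i by (intro nev_small_mult b assms)
  ultimately show ?thesis unfolding small_poly_def by (intro exI[of _ "\<lambda>i z. a z * b i z"]) auto
qed

lemma small_poly_monomial:
  assumes "nev_small a" "i \<le> d"
  shows "small_poly d (\<lambda>z. a z * f z ^ i)"
proof -
  have "nev_small (\<lambda>z. if k = i then a z else 0)" for k
    by (cases "k = i") (use assms nev_small_const in auto)
  moreover have "a z * f z ^ i = (\<Sum>k\<le>d. (if k = i then a z else 0) * f z ^ k)" for z
    using assms(2) by (simp add: if_distrib[of "\<lambda>x. x * _"] cong: if_cong)
  ultimately show ?thesis unfolding small_poly_def
    by (intro exI[of _ "\<lambda>k z. if k = i then a z else 0"]) auto
qed

lemma small_poly_small: "nev_small a \<Longrightarrow> small_poly d a"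
  using small_poly_monomial[of a 0 d] by simp

lemma small_poly_sum:
  "(\<And>i. i \<in> I \<Longrightarrow> small_poly d (g i)) \<Longrightarrow> small_poly d (\<lambda>z. \<Sum>i\<in>I. g i z)"
  by (induction I rule: infinite_finite_induct) (auto intro: small_poly_add small_poly_small nev_small_const)

lemma small_poly_meromorphic:
  assumes "small_poly d g"
  shows "g meromorphic_on UNIV"
proof -
  obtain b where b: "\<And>i. nev_small (b i)" "\<forall>\<^sub>\<approx>z\<in>UNIV. g z = (\<Sum>i\<le>d. b i z * f z ^ i)"
    using assms unfolding small_poly_def by blast
  have "(\<lambda>z. \<Sum>i\<le>d. b i z * f z ^ i) meromorphic_on UNIV"
    by (intro meromorphic_intros nev_small_mero b f)
  thus ?thesis using meromorphic_on_cong'[OF b(2) refl] by simp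
qed

lemma analytic_cosparse: "\<forall>\<^sub>\<approx>z\<in>UNIV. f analytic_on {z} \<and> f z \<noteq> 0"
  by (rule cosparse_analytic_nonzero[OF f f_nz])

text \<open>The derivative of \<open>b * f^i\<close> is \<open>(b' + i * (f'/f) * b) * f^i\<close>,
  with a coefficient of the same class, so differentiation does not raise the degree.\<close>

lemma small_poly_deriv:
  assumes "small_poly d g"
  shows "small_poly d (deriv g)"
proof -
  obtain b where b: "\<And>i. nev_small (b i)" "\<forall>\<^sub>\<approx>z\<in>UNIV. g z = (\<Sum>i\<le>d. b i z * f z ^ i)"
    using assms unfolding small_poly_def by blast
  have "\<forall>\<^sub>\<approx>z\<in>UNIV. \<forall>i\<in>{..d}. b i analytic_on {z}"
    by (intro eventually_ball_finite ballI meromorphic_on_imp_analytic_cosparse nev_small_mero b) auto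
  with cosparse_deriv_cong[OF b(2)] analytic_cosparse
  have "\<forall>\<^sub>\<approx>z\<in>UNIV. deriv g z = (\<Sum>i\<le>d. (deriv (b i) z + of_nat i * (deriv f z / f z) * b i z) * f z ^ i)"
  proof eventually_elim
    case (elim z)
    have "((\<lambda>z. \<Sum>i\<le>d. b i z * f z ^ i) has_field_derivative
       (\<Sum>i\<le>d. (deriv (b i) z + of_nat i * (deriv f z / f z) * b i z) * f z ^ i)) (at z)"
    proof (rule DERIV_sum)
      fix i assume "i \<in> {..d}"
      hence bi: "(b i has_field_derivative deriv (b i) z) (at z)" using elim by (intro analytic_DERIV) auto
      have fi: "(f has_field_derivative deriv f z) (at z)" using elim by (intro analytic_DERIV) auto
      have "((\<lambda>z. b i z * f z ^ i) has_field_derivative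
         deriv (b i) z * f z ^ i + of_nat i * f z ^ (i - 1) * deriv f z * b i z) (at z)"
        using bi fi by (auto intro!: derivative_eq_intros)
      moreover have "deriv (b i) z * f z ^ i + of_nat i * f z ^ (i - 1) * deriv f z * b i z =
          (deriv (b i) z + of_nat i * (deriv f z / f z) * b i z) * f z ^ i"
        using elim by (cases i) (auto simp: field_simps)
      ultimately show "((\<lambda>z. b i z * f z ^ i) has_field_derivative
         (deriv (b i) z + of_nat i * (deriv f z / f z) * b i z) * f z ^ i) (at z)" by simp
    qed
    thus ?case using elim DERIV_imp_deriv by simp
  qed
  moreover have "nev_small (\<lambda>z. deriv (b i) z + of_nat i * (deriv f z / f z) * b i z)" for i
    by (intro nev_small_add nev_small_mult nev_small_const nev_small_logderiv nev_small_deriv b)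
  ultimately show ?thesis unfolding small_poly_def
    by (intro exI[of _ "\<lambda>i z. deriv (b i) z + of_nat i * (deriv f z / f z) * b i z"]) auto
qed

text \<open>The quotients \<open>v\<close> of the \<open>s\<close>-th derivative by \<open>f\<close>
  satisfy a recursion: the next one is \<open>deriv v + v * (f'/f)\<close>, and the class is closed
  under these operations.\<close>

lemma nev_small_higher_logderiv: "nev_small (\<lambda>z. (deriv ^^ s) f z / f z)"
proof (induction s)
  case 0
  have "\<forall>\<^sub>\<approx>z\<in>UNIV. (deriv ^^ 0) f z / f z = 1" using f_nz by eventually_elim simp
  thus ?case by (rule nev_small_cong[OF nev_small_const])
next
  case (Suc s)
  define v where "v = (\<lambda>z. (deriv ^^ s) f z / f z)"
  have "(deriv ^^ s) f meromorphic_on UNIV" by (intro meromorphic_intros f)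
  from meromorphic_on_imp_analytic_cosparse[OF this] analytic_cosparse
  have "\<forall>\<^sub>\<approx>z\<in>UNIV. (deriv ^^ Suc s) f z / f z = deriv v z + v z * (deriv f z / f z)"
  proof eventually_elim
    case (elim z)
    have "(v has_field_derivative
       (deriv ((deriv ^^ s) f) z * f z - (deriv ^^ s) f z * deriv f z) / (f z * f z)) (at z)"
      unfolding v_def using elim by (intro DERIV_divide analytic_DERIV) auto
    hence "deriv v z = (deriv ((deriv ^^ s) f) z * f z - (deriv ^^ s) f z * deriv f z) / (f z * f z)"
      by (rule DERIV_imp_deriv)
    moreover have "x / y = (x * y - p * q) / (y * y) + p / y * (q / y)" if "y \<noteq> 0" for x y p q :: complex
      using that by (simp add: diff_divide_distrib)
    ultimately show ?case using elim by (simp add: v_def)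
  qed
  moreover have v: "nev_small v" using Suc by (simp add: v_def)
  note nev_small_add[OF nev_small_deriv[OF v] nev_small_mult[OF v nev_small_logderiv]]
  ultimately show ?case by (rule nev_small_cong[rotated])
qed

text \<open>Dividing each derivative in a monomial by \<open>f\<close> extracts the power of
  \<open>f\<close> given by the degree of the monomial and leaves a small coefficient.\<close>

lemma small_poly_diff_poly:
  assumes a: "\<And>j. j < l \<Longrightarrow> nev_small (a j)" and d: "diff_poly_degree l k e \<le> d"
  shows "small_poly d (diff_poly l k a e f)"
proof -
  have "small_poly d (\<lambda>z. a j z * (\<Prod>s\<le>k. ((deriv ^^ s) f z) ^ e j s))" if j: "j \<in> {..<l}" for j
  proof -
    have "(\<Sum>s\<le>k. e j s) \<le> diff_poly_degree l k e"
      unfolding diff_poly_degree_def using j by (intro Max_ge) auto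
    hence "small_poly d (\<lambda>z. (a j z * (\<Prod>s\<le>k. ((deriv ^^ s) f z / f z) ^ e j s)) * f z ^ (\<Sum>s\<le>k. e j s))"
      using a j d
      by (intro small_poly_monomial nev_small_mult nev_small_prod nev_small_power nev_small_higher_logderiv) auto
    moreover have "\<forall>\<^sub>\<approx>z\<in>UNIV. a j z * (\<Prod>s\<le>k. ((deriv ^^ s) f z) ^ e j s) =
       (a j z * (\<Prod>s\<le>k. ((deriv ^^ s) f z / f z) ^ e j s)) * f z ^ (\<Sum>s\<le>k. e j s)"
      using f_nz by eventually_elim (simp add: power_sum power_divide prod_dividef)
    ultimately show ?thesis by (rule small_poly_cong)
  qed
  thus ?thesis unfolding diff_poly_def by (rule small_poly_sum)
qed

text \<open>A variant of Clunie's lemma: where \<open>cmod (f z) \<ge> 1\<close>, dividing the equation by \<open>f z ^ d\<close> bounds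
  \<open>cmod (f z) ^ j * cmod (\<psi> z)\<close> by the coefficients of \<open>Q\<close>.\<close>

lemma clunie_type_bound:
  assumes Q: "small_poly d Q" and psi: "\<psi> meromorphic_on UNIV" "\<forall>\<^sub>\<approx>z\<in>UNIV. \<psi> z \<noteq> 0"
    and eq: "\<forall>\<^sub>\<approx>z\<in>UNIV. f z ^ (d + j) * \<psi> z = Q z"
  obtains S where "S \<in> o[nev_filter](T)"
    "eventually (\<lambda>r. real j * proximity f r \<le> proximity (\<lambda>z. inverse (\<psi> z)) r + S r) nev_filter"
proof -
  obtain b where b: "\<And>i. nev_small (b i)" "\<forall>\<^sub>\<approx>z\<in>UNIV. Q z = (\<Sum>i\<le>d. b i z * f z ^ i)"
    using Q unfolding small_poly_def by blast
  define C where "C = ln (max 1 (card {..d}))"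
  define S where "S = (\<lambda>r. (\<Sum>i\<le>d. proximity (b i) r) + C)"
  have "S \<in> o[nev_filter](T)" unfolding S_def
    using b const_small by (intro sum_in_smallo big_sum_in_smallo) (auto simp: nev_small_def)
  moreover have "\<forall>\<^sub>\<approx>z\<in>UNIV. \<forall>i\<in>{..d}. b i analytic_on {z}"
    by (intro eventually_ball_finite ballI meromorphic_on_imp_analytic_cosparse nev_small_mero b) auto
  hence "\<forall>\<^sub>\<approx>z\<in>UNIV. f z ^ (d + j) * \<psi> z = (\<Sum>i\<le>d. b i z * f z ^ i) \<and> (\<forall>i\<le>d. b i analytic_on {z})"
    using b(2) eq by eventually_elim auto
  from eventually_nev_circle[OF this] eventually_good_circle[OF f f_nz] eventually_good_circle[OF psi]
  have "eventually (\<lambda>r. real j * proximity f r \<le> proximity (\<lambda>z. inverse (\<psi> z)) r + S r) nev_filter"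
  proof eventually_elim
    case (elim r)
    have r: "r > 0" using elim by (simp add: good_circle_def)
    have b_an: "analytic_circle (b i) r" if "i \<le> d" for i
      using elim that r by (auto simp: analytic_circle_def)
    have f_an: "analytic_circle f r" using elim by (auto simp: analytic_circle_def good_circle_def)
    have psi_an: "analytic_circle (\<lambda>z. inverse (\<psi> z)) r"
      using good_circle_inverse[OF elim(3)] by (auto simp: analytic_circle_def good_circle_def)
    note cont = continuous_log_plus_circle[OF b_an] continuous_log_plus_circle[OF f_an] continuous_log_plus_circle[OF psi_an]
    have "real j * proximity f r = circ_mean (\<lambda>z. real j * log_plus (cmod (f z))) r"
      by (simp add: proximity_eq_circ_mean circ_mean_cmult)
    also have "\<dots> \<le> circ_mean (\<lambda>z. log_plus (cmod (inverse (\<psi> z))) + ((\<Sum>i\<le>d. log_plus (cmod (b i z))) + C)) r"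
    proof (intro circ_mean_mono continuous_on_add continuous_on_mult continuous_on_sum continuous_on_const cont)
      fix z :: complex assume z: "cmod z = r"
      have nz: "f z \<noteq> 0" "\<psi> z \<noteq> 0" using elim z by (auto simp: good_circle_def)
      have e: "f z ^ (d + j) * \<psi> z = (\<Sum>i\<le>d. b i z * f z ^ i)" using elim z by auto
      have C0: "C \<ge> 0" by (simp add: C_def)
      show "real j * log_plus (cmod (f z)) \<le> log_plus (cmod (inverse (\<psi> z))) + ((\<Sum>i\<le>d. log_plus (cmod (b i z))) + C)"
      proof (cases "cmod (f z) \<le> 1")
        case True
        hence "log_plus (cmod (f z)) = 0" by (simp add: log_plus_eq max_absorb1)
        thus ?thesis using C0 by (auto intro!: add_nonneg_nonneg sum_nonneg)
      next
        case False
        hence f1: "cmod (f z) \<ge> 1" by simp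
        have "cmod (f z) ^ d * (cmod (f z) ^ j * cmod (\<psi> z)) = cmod (\<Sum>i\<le>d. b i z * f z ^ i)"
          unfolding e[symmetric] by (simp add: norm_mult norm_power power_add)
        also have "\<dots> \<le> (\<Sum>i\<le>d. cmod (b i z * f z ^ i))" by (rule norm_sum)
        also have "\<dots> \<le> (\<Sum>i\<le>d. cmod (b i z) * cmod (f z) ^ d)"
          using f1 by (intro sum_mono) (auto simp: norm_mult norm_power intro!: mult_left_mono power_increasing)
        also have "\<dots> = cmod (f z) ^ d * (\<Sum>i\<le>d. cmod (b i z))" by (simp add: sum_distrib_left mult.commute)
        finally have "cmod (f z) ^ j * cmod (\<psi> z) \<le> (\<Sum>i\<le>d. cmod (b i z))"
          using nz by simp
        hence "(cmod (f z) ^ j * cmod (\<psi> z)) * cmod (inverse (\<psi> z)) \<le> (\<Sum>i\<le>d. cmod (b i z)) * cmod (inverse (\<psi> z))"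
          by (intro mult_right_mono) auto
        moreover have "cmod (\<psi> z) * cmod (inverse (\<psi> z)) = 1" using nz by (simp add: norm_inverse)
        ultimately have "cmod (f z) ^ j \<le> (\<Sum>i\<le>d. cmod (b i z)) * cmod (inverse (\<psi> z))"
          by (simp only: mult.assoc mult_1_right)
        hence "log_plus (cmod (f z) ^ j) \<le> log_plus ((\<Sum>i\<le>d. cmod (b i z)) * cmod (inverse (\<psi> z)))"
          by (intro log_plus_mono) auto
        also have "\<dots> \<le> log_plus (\<Sum>i\<le>d. cmod (b i z)) + log_plus (cmod (inverse (\<psi> z)))"
          by (intro log_plus_mult sum_nonneg) auto
        also have "log_plus (\<Sum>i\<le>d. cmod (b i z)) \<le> (\<Sum>i\<le>d. log_plus (cmod (b i z))) + C"
          unfolding C_def by (intro log_plus_sum) auto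
        finally show ?thesis by (simp add: log_plus_power)
      qed
    qed (use r in auto)
    also have "\<dots> = proximity (\<lambda>z. inverse (\<psi> z)) r + circ_mean (\<lambda>z. (\<Sum>i\<le>d. log_plus (cmod (b i z))) + C) r"
      unfolding proximity_eq_circ_mean
      using r by (intro circ_mean_add continuous_on_add continuous_on_sum continuous_on_const cont) auto
    also have "circ_mean (\<lambda>z. (\<Sum>i\<le>d. log_plus (cmod (b i z))) + C) r =
               circ_mean (\<lambda>z. (\<Sum>i\<le>d. log_plus (cmod (b i z)))) r + circ_mean (\<lambda>z. C) r"
      using r by (intro circ_mean_add continuous_on_sum continuous_on_const cont) auto
    also have "circ_mean (\<lambda>z. (\<Sum>i\<le>d. log_plus (cmod (b i z)))) r = (\<Sum>i\<le>d. proximity (b i) r)"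
      unfolding proximity_eq_circ_mean using r by (intro circ_mean_sum cont) auto
    finally show ?case by (simp add: S_def)
  qed
  ultimately show ?thesis using that by blast
qed

text \<open>With \<open>B\<close> the sum of the moduli of the coefficients, \<open>cmod h\<close>
  is at most \<open>(1 + 2 * B) * max 1 (cmod f) ^ n\<close>. Conversely, where
  \<open>cmod f > 1 + 2 * B\<close> the lower terms amount to at most half of
  \<open>cmod f ^ n\<close>, as their degree is below \<open>n\<close>; elsewhere
  \<open>cmod f\<close> is itself bounded by the coefficients.\<close>

lemma proximity_leading_term:
  assumes P: "small_poly d P" and n: "d < n" and eq: "\<forall>\<^sub>\<approx>z\<in>UNIV. f z ^ n + P z = h z"
  shows "(\<lambda>r. proximity h r - real n * proximity f r) \<in> o[nev_filter](T)"
proof -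
  obtain b where b: "\<And>i. nev_small (b i)" "\<forall>\<^sub>\<approx>z\<in>UNIV. P z = (\<Sum>i\<le>d. b i z * f z ^ i)"
    using P unfolding small_poly_def by blast
  have h: "h meromorphic_on UNIV"
  proof -
    have "(\<lambda>z. f z ^ n + P z) meromorphic_on UNIV" by (intro meromorphic_intros f small_poly_meromorphic[OF P])
    thus ?thesis using meromorphic_on_cong'[OF eq refl] by simp
  qed
  define C where "C = log_plus 2 + ln (max 1 (card {..d})) + ln 2"
  have C0: "C \<ge> 0" by (simp add: C_def)
  define S where "S = (\<lambda>r. real n * ((\<Sum>i\<le>d. proximity (b i) r) + C) + ln 2)"
  have "(\<lambda>r. (\<Sum>i\<le>d. proximity (b i) r) + C) \<in> o[nev_filter](T)"
    using b const_small by (intro sum_in_smallo big_sum_in_smallo) (auto simp: nev_small_def)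
  hence "(\<lambda>r. real n * ((\<Sum>i\<le>d. proximity (b i) r) + C)) \<in> o[nev_filter](T)" using n by simp
  hence S: "S \<in> o[nev_filter](T)" unfolding S_def by (intro sum_in_smallo const_small)
  have "\<forall>\<^sub>\<approx>z\<in>UNIV. \<forall>i\<in>{..d}. b i analytic_on {z}"
    by (intro eventually_ball_finite ballI meromorphic_on_imp_analytic_cosparse nev_small_mero b) auto
  hence "\<forall>\<^sub>\<approx>z\<in>UNIV. h z = f z ^ n + (\<Sum>i\<le>d. b i z * f z ^ i) \<and> (\<forall>i\<le>d. b i analytic_on {z})"
    using b(2) eq by eventually_elim auto
  from eventually_nev_circle[OF this] eventually_analytic_circle[OF f] eventually_analytic_circle[OF h]
  have "eventually (\<lambda>r. \<bar>proximity h r - real n * proximity f r\<bar> \<le> S r) nev_filter"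
  proof eventually_elim
    case (elim r)
    have r: "r > 0" using elim by (simp add: analytic_circle_def)
    have b_an: "analytic_circle (b i) r" if "i \<le> d" for i
      using elim that r by (auto simp: analytic_circle_def)
    note cont = continuous_log_plus_circle[OF b_an] continuous_log_plus_circle[OF elim(2)] continuous_log_plus_circle[OF elim(3)]
    \<comment> \<open>Dominates \<open>log_plus (1 + 2 * B)\<close> pointwise, while its mean is a
      sum of small proximities and a constant.\<close>
    define \<beta> where "\<beta> = (\<lambda>z. (\<Sum>i\<le>d. log_plus (cmod (b i z))) + C)"
    have \<beta>_cont: "continuous_on (sphere 0 r) \<beta>"
      unfolding \<beta>_def by (intro continuous_on_add continuous_on_sum continuous_on_const cont) auto
    have \<beta>_mean: "circ_mean \<beta> r = (\<Sum>i\<le>d. proximity (b i) r) + C"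
    proof -
      have "circ_mean \<beta> r = circ_mean (\<lambda>z. (\<Sum>i\<le>d. log_plus (cmod (b i z)))) r + circ_mean (\<lambda>z. C) r"
        unfolding \<beta>_def using r by (intro circ_mean_add continuous_on_sum continuous_on_const cont) auto
      also have "circ_mean (\<lambda>z. (\<Sum>i\<le>d. log_plus (cmod (b i z)))) r = (\<Sum>i\<le>d. proximity (b i) r)"
        unfolding proximity_eq_circ_mean using r by (intro circ_mean_sum cont) auto
      finally show ?thesis by simp
    qed
    have pw: "log_plus (cmod (h z)) \<le> real n * log_plus (cmod (f z)) + (real n * \<beta> z + ln 2)"
             "real n * log_plus (cmod (f z)) \<le> log_plus (cmod (h z)) + (real n * \<beta> z + ln 2)" if z: "cmod z = r" for z
    proof -
      define B where "B = (\<Sum>i\<le>d. cmod (b i z))"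
      have B0: "B \<ge> 0" unfolding B_def by (intro sum_nonneg) auto
      have hz: "h z = f z ^ n + (\<Sum>i\<le>d. b i z * f z ^ i)" using elim z by auto
      have \<beta>0: "\<beta> z \<ge> 0" unfolding \<beta>_def using C0 by (intro add_nonneg_nonneg sum_nonneg) auto
      have n1: "1 * \<beta> z \<le> real n * \<beta> z" using n \<beta>0 by (intro mult_right_mono) auto
      have B\<beta>: "log_plus (1 + 2 * B) \<le> \<beta> z"
      proof -
        have "log_plus (1 + 2 * B) \<le> log_plus 1 + log_plus (2 * B) + ln 2" using B0 by (intro log_plus_add) auto
        also have "log_plus (2 * B) \<le> log_plus 2 + log_plus B" using B0 by (intro log_plus_mult) auto
        also have "log_plus B \<le> (\<Sum>i\<le>d. log_plus (cmod (b i z))) + ln (max 1 (card {..d}))"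
          unfolding B_def by (intro log_plus_sum) auto
        finally show ?thesis by (simp add: \<beta>_def C_def log_plus_def)
      qed
      have sum_le: "cmod (\<Sum>i\<le>d. b i z * f z ^ i) \<le> B * M ^ (n - 1)" if M: "M \<ge> 1" "cmod (f z) \<le> M" for M
      proof -
        have "cmod (\<Sum>i\<le>d. b i z * f z ^ i) \<le> (\<Sum>i\<le>d. cmod (b i z * f z ^ i))" by (rule norm_sum)
        also have "\<dots> \<le> (\<Sum>i\<le>d. cmod (b i z) * M ^ (n - 1))"
        proof (intro sum_mono)
          fix i assume "i \<in> {..d}"
          hence "cmod (f z) ^ i \<le> M ^ i" "M ^ i \<le> M ^ (n - 1)"
            using M n by (auto intro!: power_mono power_increasing)
          thus "cmod (b i z * f z ^ i) \<le> cmod (b i z) * M ^ (n - 1)"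
            by (auto simp: norm_mult norm_power intro!: mult_left_mono)
        qed
        finally show ?thesis by (simp add: B_def sum_distrib_right)
      qed
      show "log_plus (cmod (h z)) \<le> real n * log_plus (cmod (f z)) + (real n * \<beta> z + ln 2)"
      proof -
        define M where "M = max 1 (cmod (f z))"
        have M: "M \<ge> 1" "cmod (f z) \<le> M" by (auto simp: M_def)
        have "cmod (h z) \<le> cmod (f z) ^ n + B * M ^ (n - 1)"
          unfolding hz using sum_le[OF M] by (intro norm_triangle_le add_mono) (auto simp: norm_power)
        also have "\<dots> \<le> M ^ n + B * M ^ n"
          using M B0 by (intro add_mono power_mono mult_left_mono power_increasing) auto
        also have "\<dots> \<le> (1 + 2 * B) * M ^ n"
          using M B0 by (simp add: distrib_right)
        finally have "log_plus (cmod (h z)) \<le> log_plus ((1 + 2 * B) * M ^ n)" by (intro log_plus_mono) auto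
        also have "\<dots> \<le> log_plus (1 + 2 * B) + log_plus (M ^ n)" using M B0 by (intro log_plus_mult) auto
        also have "log_plus (M ^ n) = real n * log_plus (cmod (f z))"
          using M by (simp add: log_plus_power) (simp add: log_plus_eq M_def)
        finally show ?thesis using B\<beta> n1 ln_gt_zero[of "2::real"] by linarith
      qed
      show "real n * log_plus (cmod (f z)) \<le> log_plus (cmod (h z)) + (real n * \<beta> z + ln 2)"
      proof (cases "cmod (f z) \<le> 1 + 2 * B")
        case True
        hence "log_plus (cmod (f z)) \<le> log_plus (1 + 2 * B)" by (intro log_plus_mono) auto
        hence "real n * log_plus (cmod (f z)) \<le> real n * \<beta> z" using B\<beta> by (intro mult_left_mono) auto
        moreover have "log_plus (cmod (h z)) \<ge> 0" by simp
        ultimately show ?thesis using ln_gt_zero[of "2::real"] by linarith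
      next
        case False
        define M where "M = cmod (f z)"
        have M: "M \<ge> 1" "cmod (f z) \<le> M" "2 * B \<le> M" using False B0 by (auto simp: M_def)
        have "M ^ n = cmod (h z - (\<Sum>i\<le>d. b i z * f z ^ i))" unfolding hz by (simp add: norm_power M_def)
        also have "\<dots> \<le> cmod (h z) + B * M ^ (n - 1)"
          using sum_le[OF M(1,2)] by (intro norm_triangle_le_diff add_mono) auto
        also have "B * M ^ (n - 1) \<le> (M / 2) * M ^ (n - 1)" using M by (intro mult_right_mono) auto
        also have "(M / 2) * M ^ (n - 1) = M ^ n / 2" using n by (cases n) auto
        finally have "M ^ n \<le> 2 * cmod (h z)" by simp
        hence "log_plus (M ^ n) \<le> log_plus (2 * cmod (h z))" using M by (intro log_plus_mono) auto
        also have "\<dots> \<le> log_plus 2 + log_plus (cmod (h z))" by (intro log_plus_mult) auto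
        finally have "real n * log_plus (cmod (f z)) \<le> ln 2 + log_plus (cmod (h z))"
          using M by (simp add: log_plus_power M_def) (simp add: log_plus_def)
        thus ?thesis using \<beta>0 n1 by linarith
      qed
    qed
    have mean: "circ_mean (\<lambda>z. u z + (real n * \<beta> z + ln 2)) r = circ_mean u r + S r"
      if "continuous_on (sphere 0 r) u" for u
    proof -
      have "circ_mean (\<lambda>z. u z + (real n * \<beta> z + ln 2)) r = circ_mean u r + circ_mean (\<lambda>z. real n * \<beta> z + ln 2) r"
        using r that \<beta>_cont by (intro circ_mean_add continuous_intros) auto
      also have "circ_mean (\<lambda>z. real n * \<beta> z + ln 2) r = circ_mean (\<lambda>z. real n * \<beta> z) r + circ_mean (\<lambda>z. ln 2) r"
        using r \<beta>_cont by (intro circ_mean_add continuous_intros) auto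
      finally show ?thesis by (simp add: circ_mean_cmult \<beta>_mean S_def)
    qed
    have "proximity h r \<le> circ_mean (\<lambda>z. real n * log_plus (cmod (f z)) + (real n * \<beta> z + ln 2)) r"
      unfolding proximity_eq_circ_mean using pw(1) r
      by (intro circ_mean_mono continuous_on_add continuous_on_mult continuous_on_const cont \<beta>_cont) auto
    also have "\<dots> = real n * proximity f r + S r"
      by (subst mean) (auto simp: circ_mean_cmult proximity_eq_circ_mean intro!: continuous_on_mult continuous_on_const cont)
    finally have 1: "proximity h r \<le> real n * proximity f r + S r" .
    have "real n * proximity f r = circ_mean (\<lambda>z. real n * log_plus (cmod (f z))) r"
      by (simp add: circ_mean_cmult proximity_eq_circ_mean)
    also have "\<dots> \<le> circ_mean (\<lambda>z. log_plus (cmod (h z)) + (real n * \<beta> z + ln 2)) r"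
      using pw(2) r by (intro circ_mean_mono continuous_on_add continuous_on_mult continuous_on_const cont \<beta>_cont) auto
    also have "\<dots> = proximity h r + S r"
      by (subst mean) (auto simp: proximity_eq_circ_mean intro!: cont)
    finally show ?case using 1 by linarith
  qed
  hence "eventually (\<lambda>r. norm (proximity h r - real n * proximity f r) \<le> 1 * norm (S r)) nev_filter"
    by eventually_elim auto
  hence "(\<lambda>r. proximity h r - real n * proximity f r) \<in> O[nev_filter](S)" by (rule bigoI)
  thus ?thesis using S landau_o.big_small_trans by blast
qed

end

subsection \<open>Local analysis of the differential equations\<close>

lemma pole_mult_deriv_at_pole:
  assumes f: "f meromorphic_on {z}" and p: "is_pole f z"
  shows "pole_mult (deriv f) z = pole_mult f z + 1"
proof -
  have neg: "zorder f z < 0" using f p isolated_pole_imp_neg_zorder by (simp add: meromorphic_at_iff)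
  have fr: "frequently (\<lambda>w. f w \<noteq> 0) (at z)"
    using f p non_zero_neighbour_pole[of f z] by (simp add: meromorphic_at_iff eventually_frequently)
  have "zorder (deriv f) z = zorder f z - 1"
    using f neg fr by (intro zorder_deriv_minus_1) (auto simp: meromorphic_at_iff)
  moreover have "is_pole (deriv f) z" using is_pole_deriv_iff[OF f] p by simp
  ultimately show ?thesis using p neg by (simp add: pole_mult_def nat_add_distrib)
qed

text \<open>At a pole of \<open>h\<close> that is not a pole of \<open>r0\<close>, \<open>r1\<close>
  or \<open>r2\<close>, the second derivative has a pole of multiplicity two higher than
  \<open>h\<close>, and the other terms of the equation reach at most one higher, so nothing can
  cancel it.\<close>

lemma ode_finite_poles:
  assumes h: "h meromorphic_on UNIV" and rat: "rational_function r0" "rational_function r1" "rational_function r2"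
    and ode: "\<forall>\<^sub>\<approx>z\<in>UNIV. deriv (deriv h) z + r1 z * deriv h z + r0 z * h z = r2 z"
  shows "finite {z. is_pole h z}"
proof -
  note rm = rational_function_meromorphic[OF rat(1)] rational_function_meromorphic[OF rat(2)] rational_function_meromorphic[OF rat(3)]
  have "is_pole r0 z \<or> is_pole r1 z \<or> is_pole r2 z" if p: "is_pole h z" for z
  proof (rule ccontr)
    assume "\<not> ?thesis"
    hence r: "pole_mult r0 z = 0" "pole_mult r1 z = 0" "pole_mult r2 z = 0"
      by (auto simp: pole_mult_def)
    note mero = meromorphic_on_UNIV_at[OF h, of z] meromorphic_on_UNIV_at[OF rm(1), of z]
       meromorphic_on_UNIV_at[OF rm(3), of z] meromorphic_on_UNIV_at[OF rm(5), of z]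
    define k where "k = pole_mult h z + 1"
    have dm: "deriv h meromorphic_on {z}" using mero(1) by (rule meromorphic_on_deriv)
    have 1: "pole_mult (\<lambda>w. r1 w * deriv h w) z \<le> k"
      using pole_mult_mult[OF mero(3) dm] pole_mult_deriv[OF mero(1)] r by (simp add: k_def)
    have 2: "pole_mult (\<lambda>w. r0 w * h w) z \<le> k"
      using pole_mult_mult[OF mero(2,1)] r by (simp add: k_def)
    have m3: "(\<lambda>w. r1 w * deriv h w + r0 w * h w) meromorphic_on {z}" by (intro meromorphic_intros mero)
    have 3: "pole_mult (\<lambda>w. r1 w * deriv h w + r0 w * h w) z \<le> k"
      by (intro pole_mult_add 1 2 meromorphic_intros mero)
    have "pole_mult (\<lambda>_. - 1) z = 0" by (intro pole_mult_analytic) auto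
    hence 4: "pole_mult (\<lambda>w. (- 1) * (r1 w * deriv h w + r0 w * h w)) z \<le> k"
      using pole_mult_mult[of "\<lambda>_. - 1" z, OF _ m3] 3 by (auto intro: order_trans)
    have 5: "pole_mult (\<lambda>w. r2 w + (- 1) * (r1 w * deriv h w + r0 w * h w)) z \<le> k"
      by (intro pole_mult_add 4 meromorphic_intros mero) (simp add: r)
    have "eventually (\<lambda>w. deriv (deriv h) w = r2 w + (- 1) * (r1 w * deriv h w + r0 w * h w)) (at z)"
      using cosparse_UNIV_at[OF ode] by eventually_elim (simp add: algebra_simps)
    from pole_mult_cong[OF this] 5 have "pole_mult (deriv (deriv h)) z \<le> k" by simp
    moreover have "pole_mult (deriv (deriv h)) z = pole_mult (deriv h) z + 1"
      using p is_pole_deriv_iff[OF mero(1)] by (intro pole_mult_deriv_at_pole dm) simp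
    moreover have "pole_mult (deriv h) z = k" unfolding k_def by (intro pole_mult_deriv_at_pole mero p)
    ultimately show False by simp
  qed
  hence "{z. is_pole h z} \<subseteq> {z. is_pole r0 z} \<union> {z. is_pole r1 z} \<union> {z. is_pole r2 z}" by auto
  thus ?thesis using rm by (auto intro: finite_subset)
qed

lemma eventually_at_deriv_cong:
  assumes "eventually (\<lambda>w. f w = g w) (at z)"
  shows "eventually (\<lambda>w. deriv f w = deriv g w) (at z)"
proof -
  obtain U where U: "open U" "z \<in> U" "\<And>w. w \<in> U - {z} \<Longrightarrow> f w = g w"
    using assms unfolding eventually_at_topological by blast
  have "eventually (\<lambda>w. w \<in> U - {z}) (at z)" using U by (intro eventually_at_in_open) auto
  thus ?thesis
  proof eventually_elim
    case (elim w)
    have "eventually (\<lambda>v. v \<in> U - {z}) (nhds w)" using elim U by (intro eventually_nhds_in_open) auto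
    hence "eventually (\<lambda>v. f v = g v) (nhds w)" by eventually_elim (use U in auto)
    thus ?case by (intro deriv_cong_ev) auto
  qed
qed

text \<open>Comparing the coefficients of \<open>1 / (w - z)\<^sup>2\<close> in the Riccati equation gives \<open>n * m = (n * m)\<^sup>2\<close> for
  the order \<open>m\<close> of \<open>f\<close> at \<open>z\<close>, hence \<open>m = 0\<close> as \<open>n \<ge> 2\<close>.\<close>

lemma riccati_zorder_0:
  assumes f: "f meromorphic_on UNIV" "\<forall>\<^sub>\<approx>z\<in>UNIV. f z \<noteq> 0"
    and r: "r0 meromorphic_on UNIV" "r1 meromorphic_on UNIV" "\<not>is_pole r0 z" "\<not>is_pole r1 z" and n: "n \<ge> (2::nat)"
  defines "u \<equiv> (\<lambda>z. deriv f z / f z)"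
  assumes eq: "\<forall>\<^sub>\<approx>z\<in>UNIV. of_nat n * deriv u z + (of_nat n * u z)\<^sup>2 + r1 z * (of_nat n * u z) + r0 z = 0"
  shows "zorder f z = 0"
proof -
  define m where "m = zorder f z"
  have fz: "f meromorphic_on {z}" "eventually (\<lambda>w. f w \<noteq> 0) (at z)"
    using f by (auto intro: meromorphic_on_UNIV_at cosparse_UNIV_at)
  obtain H where H: "H analytic_on {z}" "eventually (\<lambda>w. u w = of_int m / (w - z) + H w) (at z)"
    using logderiv_local_form[OF fz] unfolding u_def m_def by blast
  obtain R0 where R0: "R0 analytic_on {z}" "eventually (\<lambda>w. r0 w = R0 w) (at z)"
    using pole_mult_le_iff[OF meromorphic_on_UNIV_at[OF r(1)], of z 0] r(3) by (auto simp: pole_mult_def)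
  obtain R1 where R1: "R1 analytic_on {z}" "eventually (\<lambda>w. r1 w = R1 w) (at z)"
    using pole_mult_le_iff[OF meromorphic_on_UNIV_at[OF r(2)], of z 0] r(4) by (auto simp: pole_mult_def)
  obtain V where V: "open V" "z \<in> V" "H holomorphic_on V" using H(1) unfolding analytic_at by blast
  \<comment> \<open>The left side of the Riccati equation times \<open>(w - z)^2\<close>, written so
    that it is analytic at \<open>z\<close>. It vanishes near \<open>z\<close>, hence also at
    \<open>z\<close>, where its value is \<open>- n * m + (n * m)^2\<close>.\<close>
  define L where "L = (\<lambda>w. of_nat n * (- of_int m + (w - z)\<^sup>2 * deriv H w) + (of_nat n * (of_int m + (w - z) * H w))\<^sup>2
     + R1 w * (w - z) * (of_nat n * (of_int m + (w - z) * H w)) + R0 w * (w - z)\<^sup>2)"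
  have "eventually (\<lambda>w. w \<in> V - {z}) (at z)" using V by (intro eventually_at_in_open) auto
  with H(2) eventually_at_deriv_cong[OF H(2)] R0(2) R1(2) cosparse_UNIV_at[OF eq]
  have "eventually (\<lambda>w. L w = 0) (at z)"
  proof eventually_elim
    case (elim w)
    define x where "x = w - z"
    have x: "x \<noteq> 0" using elim by (simp add: x_def)
    have "((\<lambda>w. of_int m / (w - z) + H w) has_field_derivative - of_int m / (w - z)\<^sup>2 + deriv H w) (at w)"
      using elim V by (auto intro!: derivative_eq_intros holomorphic_derivI[of H V] simp: power2_eq_square)
    hence du: "deriv u w = - of_int m / x\<^sup>2 + deriv H w" using elim(2) DERIV_imp_deriv by (simp add: x_def)
    have uw: "u w = of_int m / x + H w" using elim by (simp add: x_def)
    have A: "x\<^sup>2 * (of_nat n * (- of_int m / x\<^sup>2 + deriv H w) + (of_nat n * (of_int m / x + H w))\<^sup>2 +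
        R1 w * (of_nat n * (of_int m / x + H w)) + R0 w) = 0"
      using elim(5) unfolding du uw elim(3) elim(4) by simp
    have B: "x\<^sup>2 * (of_nat n * (- of_int m / x\<^sup>2 + deriv H w) + (of_nat n * (of_int m / x + H w))\<^sup>2 +
        R1 w * (of_nat n * (of_int m / x + H w)) + R0 w) = L w"
      unfolding L_def x_def[symmetric] using x by (simp add: power2_eq_square field_simps)
    from B[symmetric] A show ?case by (rule trans)
  qed
  hence "L \<midarrow>z\<rightarrow> 0" by (rule tendsto_eventually)
  moreover have "L analytic_on {z}" unfolding L_def using H R0 R1 by (intro analytic_intros) auto
  hence "L \<midarrow>z\<rightarrow> L z" by (rule isContD[OF analytic_at_imp_isCont])
  ultimately have "L z = 0" using tendsto_unique[of "at z" L] by simp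
  hence "(of_nat n * of_int m)\<^sup>2 = (of_nat n * of_int m :: complex)" by (simp add: L_def)
  hence "of_int ((int n * m) * (int n * m)) = (of_int (int n * m) :: complex)" by (simp add: power2_eq_square)
  hence "(int n * m) * (int n * m) = int n * m" by (simp only: of_int_eq_iff)
  hence "m = 0 \<or> int n * m = 1" using n by simp
  moreover have "int n * m \<noteq> 1" using n by (simp add: zmult_eq_1_iff)
  ultimately show ?thesis by (simp add: m_def)
qed

subsection \<open>Rational functions\<close>

lemma rational_function_cong:
  assumes "rational_function a" "\<forall>\<^sub>\<approx>z\<in>UNIV. b z = a z"
  shows "rational_function b"
proof -
  obtain p q where q: "q \<noteq> 0" and a: "\<forall>\<^sub>\<approx>z\<in>UNIV. a z = poly p z / poly q z"
    using assms unfolding rational_function_def by blast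
  have "\<forall>\<^sub>\<approx>z\<in>UNIV. b z = poly p z / poly q z" using a assms(2) by eventually_elim simp
  thus ?thesis using q unfolding rational_function_def by blast
qed

lemma rational_function_poly: "rational_function (poly p)"
  unfolding rational_function_def by (intro exI[of _ p] exI[of _ 1]) auto

lemma rational_function_const: "rational_function (\<lambda>_. c)"
proof -
  have "(\<lambda>_. c) = poly [:c:]" by (simp add: fun_eq_iff)
  thus ?thesis using rational_function_poly[of "[:c:]"] by simp
qed

lemma rational_function_linear: "rational_function (\<lambda>z. z - a)"
proof -
  have "(\<lambda>z. z - a) = poly [:-a, 1:]" by (simp add: fun_eq_iff)
  thus ?thesis using rational_function_poly[of "[:-a, 1:]"] by simp
qed

lemma rational_function_mult:
  assumes "rational_function a" "rational_function b"
  shows "rational_function (\<lambda>z. a z * b z)"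
proof -
  obtain p q where q: "q \<noteq> 0" and a: "\<forall>\<^sub>\<approx>z\<in>UNIV. a z = poly p z / poly q z"
    using assms(1) unfolding rational_function_def by blast
  obtain p' q' where q': "q' \<noteq> 0" and b: "\<forall>\<^sub>\<approx>z\<in>UNIV. b z = poly p' z / poly q' z"
    using assms(2) unfolding rational_function_def by blast
  have "\<forall>\<^sub>\<approx>z\<in>UNIV. a z * b z = poly (p * p') z / poly (q * q') z"
    using a b by eventually_elim simp
  thus ?thesis using q q' unfolding rational_function_def by (intro exI[of _ "p * p'"] exI[of _ "q * q'"]) auto
qed

lemma rational_function_add:
  assumes "rational_function a" "rational_function b"
  shows "rational_function (\<lambda>z. a z + b z)"
proof -
  obtain p q where q: "q \<noteq> 0" and a: "\<forall>\<^sub>\<approx>z\<in>UNIV. a z = poly p z / poly q z"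
    using assms(1) unfolding rational_function_def by blast
  obtain p' q' where q': "q' \<noteq> 0" and b: "\<forall>\<^sub>\<approx>z\<in>UNIV. b z = poly p' z / poly q' z"
    using assms(2) unfolding rational_function_def by blast
  have "\<forall>\<^sub>\<approx>z\<in>UNIV. a z + b z = poly (p * q' + p' * q) z / poly (q * q') z"
    using a b poly_nonzero_cosparse[OF q] poly_nonzero_cosparse[OF q']
    by eventually_elim (simp add: add_frac_eq mult_ac)
  thus ?thesis using q q' unfolding rational_function_def by (intro exI[of _ "p * q' + p' * q"] exI[of _ "q * q'"]) auto
qed

lemma rational_function_inverse:
  assumes "rational_function a"
  shows "rational_function (\<lambda>z. inverse (a z))"
proof -
  obtain p q where q: "q \<noteq> 0" and a: "\<forall>\<^sub>\<approx>z\<in>UNIV. a z = poly p z / poly q z"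
    using assms(1) unfolding rational_function_def by blast
  show ?thesis
  proof (cases "p = 0")
    case True
    have "\<forall>\<^sub>\<approx>z\<in>UNIV. inverse (a z) = 0" using a by eventually_elim (simp add: True)
    thus ?thesis by (rule rational_function_cong[OF rational_function_const])
  next
    case False
    have "\<forall>\<^sub>\<approx>z\<in>UNIV. inverse (a z) = poly q z / poly p z" using a by eventually_elim simp
    thus ?thesis using False unfolding rational_function_def by blast
  qed
qed

lemma rational_function_power_int:
  assumes "rational_function a"
  shows "rational_function (\<lambda>z. a z powi n)"
proof -
  have pow: "rational_function (\<lambda>z. b z ^ k)" if "rational_function b" for b k
    by (induction k) (auto intro: rational_function_const rational_function_mult that)
  show ?thesis
    by (cases "n \<ge> 0") (auto simp: power_int_def intro!: pow rational_function_inverse assms)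
qed

lemma rational_function_sum:
  "(\<And>i. i \<in> I \<Longrightarrow> rational_function (b i)) \<Longrightarrow> rational_function (\<lambda>z. \<Sum>i\<in>I. b i z)"
  by (induction I rule: infinite_finite_induct) (auto intro: rational_function_const rational_function_add)

lemma rational_function_prod:
  "(\<And>i. i \<in> I \<Longrightarrow> rational_function (b i)) \<Longrightarrow> rational_function (\<lambda>z. \<Prod>i\<in>I. b i z)"
  by (induction I rule: infinite_finite_induct) (auto intro: rational_function_const rational_function_mult)

text \<open>Filling the removable singularities gives an entire \<open>W\<close> with
  \<open>W z * poly q z = poly p z\<close>. As \<open>poly q\<close> is bounded away from 0 near
  infinity, \<open>W\<close> grows at most like a power.\<close>

lemma rational_function_without_poles:
  assumes rat: "rational_function v" and np: "\<And>z. \<not>is_pole v z"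
  obtains P where "\<forall>\<^sub>\<approx>z\<in>UNIV. v z = poly P z"
proof -
  obtain p q where q: "q \<noteq> 0" and v: "\<forall>\<^sub>\<approx>z\<in>UNIV. v z = poly p z / poly q z"
    using rat unfolding rational_function_def by blast
  note vm = rational_function_meromorphic(1)[OF rat]
  define W where "W = remove_sings v"
  have Wv: "\<forall>\<^sub>\<approx>z\<in>UNIV. W z = v z" unfolding W_def by (rule eventually_remove_sings_eq[OF vm])
  have "\<not>is_pole W z" for z using is_pole_cong[OF cosparse_UNIV_at[OF Wv] refl] np by simp
  hence W: "W analytic_on UNIV" unfolding W_def
    using remove_sings_nicely_meromorphic[OF vm] by (intro nicely_meromorphic_without_singularities) auto
  have Wpq: "W z * poly q z = poly p z" for z
  proof -
    have "\<forall>\<^sub>\<approx>z\<in>UNIV. W z * poly q z = poly p z"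
      using Wv v poly_nonzero_cosparse[OF q] by eventually_elim simp
    hence ev: "eventually (\<lambda>z. W z * poly q z = poly p z) (at z)" by (rule cosparse_UNIV_at)
    have "W analytic_on {z}" using W by (rule analytic_on_subset) auto
    hence "(\<lambda>z. W z * poly q z) analytic_on {z}" by (intro analytic_intros analytic_on_poly_fun)
    hence 1: "(\<lambda>z. W z * poly q z) \<midarrow>z\<rightarrow> W z * poly q z" by (rule isContD[OF analytic_at_imp_isCont])
    have 2: "poly p \<midarrow>z\<rightarrow> poly p z" by (rule isContD[OF analytic_at_imp_isCont[OF analytic_on_poly_fun]])
    have "(\<lambda>z. W z * poly q z) \<midarrow>z\<rightarrow> poly p z" using 2 tendsto_cong[OF ev] by simp
    thus ?thesis using 1 tendsto_unique[of "at z"] by fastforce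
  qed
  obtain C where C: "C \<ge> 0" "\<And>z. cmod z \<ge> 1 \<Longrightarrow> cmod (poly p z) \<le> C * cmod z ^ degree p"
    using norm_poly_le by blast
  obtain c R where c: "c > 0" "R \<ge> 1" "\<And>z. cmod z \<ge> R \<Longrightarrow> c * cmod z ^ degree q \<le> cmod (poly q z)"
    using norm_poly_ge[OF q] by blast
  have "\<exists>r\<ge>r0. \<forall>z. cmod z = r \<longrightarrow> cmod (W z) \<le> (C / c) * r ^ degree p" for r0
  proof (intro exI[of _ "max R r0"] conjI allI impI)
    fix z :: complex assume z: "cmod z = max R r0"
    have "c * 1 \<le> c * cmod z ^ degree q" using z c by (intro mult_left_mono one_le_power) auto
    hence qz: "c \<le> cmod (poly q z)" using c(3)[of z] z by auto
    have "cmod (W z) * c \<le> cmod (W z) * cmod (poly q z)" using qz by (intro mult_left_mono) auto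
    also have "\<dots> = cmod (poly p z)" using Wpq[of z] by (simp flip: norm_mult)
    also have "\<dots> \<le> C * cmod z ^ degree p" using C(2)[of z] z c by auto
    finally show "cmod (W z) \<le> (C / c) * max R r0 ^ degree p" using c z by (simp add: field_simps)
  qed auto
  moreover have "W holomorphic_on UNIV" using W analytic_imp_holomorphic by blast
  ultimately obtain P where P: "\<And>z. W z = poly P z" using entire_polynomial_growth by blast
  have "\<forall>\<^sub>\<approx>z\<in>UNIV. v z = poly P z" using Wv by eventually_elim (simp add: P)
  thus ?thesis by (rule that)
qed

lemma pderiv_surj:
  fixes P :: "complex poly"
  obtains \<alpha> where "pderiv \<alpha> = P"
proof (rule that)
  show "pderiv (\<Sum>k\<le>degree P. monom (coeff P k / of_nat (Suc k)) (Suc k)) = P"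
  proof (rule poly_eqI)
    fix i
    have "coeff (pderiv (\<Sum>k\<le>degree P. monom (coeff P k / of_nat (Suc k)) (Suc k))) i =
        of_nat (Suc i) * (\<Sum>k\<le>degree P. if k = i then coeff P k / of_nat (Suc k) else 0)"
      by (simp add: coeff_pderiv coeff_sum del: of_nat_Suc)
    also have "\<dots> = coeff P i" by (simp add: coeff_eq_0 del: of_nat_Suc)
    finally show "coeff (pderiv (\<Sum>k\<le>degree P. monom (coeff P k / of_nat (Suc k)) (Suc k))) i = coeff P i" .
  qed
qed

text \<open>The plane without a sparse closed set is open and connected, so a vanishing derivative
  there forces a single constant.\<close>

lemma constant_if_deriv_0_cosparse:
  assumes g: "g meromorphic_on UNIV" and d: "\<forall>\<^sub>\<approx>z\<in>UNIV. deriv g z = 0"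
  obtains c where "\<forall>\<^sub>\<approx>z\<in>UNIV. g z = c"
proof -
  define pts where "pts = {z. \<not>(g analytic_on {z} \<and> deriv g z = 0)}"
  have ev: "\<forall>\<^sub>\<approx>z\<in>UNIV. g analytic_on {z} \<and> deriv g z = 0"
    using meromorphic_on_imp_analytic_cosparse[OF g] d by eventually_elim simp
  hence sp: "pts sparse_in UNIV" by (simp add: eventually_cosparse pts_def)
  have "connected (UNIV - pts)" using sp by (intro sparse_imp_connected) auto
  moreover have "open (UNIV - pts)" using sp by (intro open_diff_sparse_pts) auto
  moreover have "(g has_field_derivative 0) (at z)" if "z \<in> UNIV - pts" for z
  proof -
    have "g analytic_on {z}" "deriv g z = 0" using that by (auto simp: pts_def)
    thus ?thesis using analytic_DERIV[of g z] by simp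
  qed
  ultimately have "g constant_on (UNIV - pts)" by (intro has_field_derivative_0_imp_constant_on) auto
  then obtain c where c: "\<And>z. z \<in> UNIV - pts \<Longrightarrow> g z = c" by (auto simp: constant_on_def)
  have "\<forall>\<^sub>\<approx>z\<in>UNIV. g z = c" using ev by eventually_elim (use c in \<open>auto simp: pts_def\<close>)
  thus ?thesis by (rule that)
qed

text \<open>Removing the principal parts \<open>zorder f a / (z - a)\<close> from the logarithmic
  derivative leaves a rational function without poles, so a polynomial with antiderivative
  \<open>\<alpha>\<close>. Dividing \<open>f\<close> by the corresponding product and by
  \<open>exp (poly \<alpha> z)\<close> then gives a function with derivative 0.\<close>

lemma rational_logderiv_form:
  assumes f: "f meromorphic_on UNIV" "\<forall>\<^sub>\<approx>z\<in>UNIV. f z \<noteq> 0"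
    and Z: "finite Z" "\<And>z. z \<notin> Z \<Longrightarrow> zorder f z = 0"
    and u: "rational_function (\<lambda>z. deriv f z / f z)"
  obtains c \<alpha> where "\<forall>\<^sub>\<approx>z\<in>UNIV. f z = c * (\<Prod>a\<in>Z. (z - a) powi zorder f a) * exp (poly \<alpha> z)"
proof -
  define m where "m = zorder f"
  define s where "s = (\<lambda>z. \<Sum>a\<in>Z. - of_int (m a) / (z - a))"
  define v where "v = (\<lambda>z. deriv f z / f z + s z)"
  have "rational_function (\<lambda>z. - of_int (m a) / (z - a))" for a
    using rational_function_mult[OF rational_function_const rational_function_inverse[OF rational_function_linear], of "- of_int (m a)" a]
    by (simp add: field_simps)
  hence v_rat: "rational_function v" unfolding v_def s_def by (intro rational_function_add u rational_function_sum)
  have "\<not>is_pole v z" for z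
  proof -
    have fz: "f meromorphic_on {z}" "eventually (\<lambda>w. f w \<noteq> 0) (at z)"
      using f by (auto intro: meromorphic_on_UNIV_at cosparse_UNIV_at)
    obtain H where H: "H analytic_on {z}" "eventually (\<lambda>w. deriv f w / f w = of_int (m z) / (w - z) + H w) (at z)"
      using logderiv_local_form[OF fz] unfolding m_def by blast
    have s_eq: "s w = (\<Sum>a\<in>Z-{z}. - of_int (m a) / (w - a)) - of_int (m z) / (w - z)" for w
    proof (cases "z \<in> Z")
      case True
      thus ?thesis using Z(1) by (simp add: s_def sum.remove)
    next
      case False
      thus ?thesis using Z(2) by (simp add: s_def m_def)
    qed
    from H(2) have "eventually (\<lambda>w. v w = H w + (\<Sum>a\<in>Z-{z}. - of_int (m a) / (w - a))) (at z)"
      by eventually_elim (simp add: v_def s_eq)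
    from is_pole_cong[OF this refl]
    have "is_pole v z \<longleftrightarrow> is_pole (\<lambda>w. H w + (\<Sum>a\<in>Z-{z}. - of_int (m a) / (w - a))) z" .
    moreover have "(\<lambda>w. H w + (\<Sum>a\<in>Z-{z}. - of_int (m a) / (w - a))) analytic_on {z}"
      using H(1) by (intro analytic_intros) auto
    ultimately show ?thesis by (simp add: analytic_at_imp_no_pole)
  qed
  then obtain P where P: "\<forall>\<^sub>\<approx>z\<in>UNIV. v z = poly P z" using rational_function_without_poles[OF v_rat] by blast
  obtain \<alpha> where \<alpha>: "pderiv \<alpha> = P" using pderiv_surj by blast
  define Q where "Q = (\<lambda>z. \<Prod>a\<in>Z. (z - a) powi (- m a))"
  define g where "g = (\<lambda>z. f z * Q z * exp (- poly \<alpha> z))"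
  have E: "(\<lambda>z. exp (- poly \<alpha> z)) analytic_on UNIV" by (intro analytic_intros analytic_on_poly_fun)
  have gm: "g meromorphic_on UNIV" unfolding g_def Q_def
    by (intro meromorphic_intros f analytic_on_imp_meromorphic_on[OF E])
  have nZ: "\<forall>\<^sub>\<approx>z\<in>UNIV. z \<notin> Z" using Z(1) by (intro eventually_not_in_cosparse finite_imp_sparse)
  have "\<forall>\<^sub>\<approx>z\<in>UNIV. deriv g z = 0"
    using cosparse_analytic_nonzero[OF f] P nZ
  proof eventually_elim
    case (elim z)
    have df: "(f has_field_derivative deriv f z) (at z)"
      using elim by (intro analytic_DERIV) auto
    have "(Q has_field_derivative Q z * (\<Sum>a\<in>Z. (of_int (- m a) * (z - a) powi (- m a - 1) * 1) / (z - a) powi (- m a))) (at z)"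
      unfolding Q_def using elim by (intro has_field_derivative_prod' DERIV_power_int) (auto intro!: derivative_eq_intros)
    also have "(\<Sum>a\<in>Z. (of_int (- m a) * (z - a) powi (- m a - 1) * 1) / (z - a) powi (- m a)) = s z"
      unfolding s_def
    proof (intro sum.cong refl)
      fix a assume "a \<in> Z"
      hence "z - a \<noteq> 0" using elim by auto
      thus "(of_int (- m a) * (z - a) powi (- m a - 1) * 1) / (z - a) powi (- m a) = - of_int (m a) / (z - a)"
        by (subst power_int_diff) auto
    qed
    finally have dQ: "(Q has_field_derivative Q z * s z) (at z)" .
    have dE: "((\<lambda>z. exp (- poly \<alpha> z)) has_field_derivative exp (- poly \<alpha> z) * (- poly P z)) (at z)"
      by (auto intro!: derivative_eq_intros simp: \<alpha>)
    have "(g has_field_derivative (deriv f z * Q z + Q z * s z * f z) * exp (- poly \<alpha> z) + exp (- poly \<alpha> z) * (- poly P z) * (f z * Q z)) (at z)"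
      unfolding g_def by (intro DERIV_mult df dQ dE)
    moreover have "(deriv f z * Q z + Q z * s z * f z) * exp (- poly \<alpha> z) + exp (- poly \<alpha> z) * (- poly P z) * (f z * Q z) =
        f z * Q z * exp (- poly \<alpha> z) * (deriv f z / f z + s z - poly P z)"
      using elim by (simp add: algebra_simps)
    moreover have "deriv f z / f z + s z - poly P z = 0" using elim by (simp add: v_def)
    ultimately show ?case using DERIV_imp_deriv by fastforce
  qed
  then obtain c where c: "\<forall>\<^sub>\<approx>z\<in>UNIV. g z = c" using constant_if_deriv_0_cosparse[OF gm] by blast
  have "\<forall>\<^sub>\<approx>z\<in>UNIV. f z = c * (\<Prod>a\<in>Z. (z - a) powi zorder f a) * exp (poly \<alpha> z)"
    using c nZ
  proof eventually_elim
    case (elim z)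
    have "Q z * (\<Prod>a\<in>Z. (z - a) powi m a) = 1"
      unfolding Q_def prod.distrib[symmetric] using elim
      by (intro prod.neutral ballI) (auto simp: power_int_minus intro!: left_inverse)
    hence "g z * (\<Prod>a\<in>Z. (z - a) powi m a) * exp (poly \<alpha> z) = f z * (exp (- poly \<alpha> z) * exp (poly \<alpha> z))"
      unfolding g_def by (simp add: mult_ac)
    also have "exp (- poly \<alpha> z) * exp (poly \<alpha> z) = 1" by (simp flip: exp_add)
    finally show ?case using elim by (simp add: m_def)
  qed
  thus ?thesis by (rule that)
qed

subsection \<open>Growth of \<open>q * exp \<alpha>\<close> and the order\<close>

lemma log_plus_norm_exp: "log_plus (cmod (exp w)) = max 0 (Re w)"
  by (simp add: log_plus_def norm_exp_eq_Re)

lemma continuous_on_poly_fun: "continuous_on A (\<lambda>z::complex. poly p z)"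
  by (rule holomorphic_on_imp_continuous_on, rule analytic_imp_holomorphic, rule analytic_on_poly_fun)

lemma proximity_exp_poly_le:
  fixes \<alpha> :: "complex poly"
  obtains C where "C \<ge> 0" "\<And>r. r \<ge> 1 \<Longrightarrow> proximity (\<lambda>z. exp (poly \<alpha> z)) r \<le> C * r ^ degree \<alpha>"
proof -
  obtain C where C: "C \<ge> 0" "\<And>z. cmod z \<ge> 1 \<Longrightarrow> cmod (poly \<alpha> z) \<le> C * cmod z ^ degree \<alpha>"
    using norm_poly_le by blast
  show ?thesis
  proof (rule that[OF C(1)])
    fix r :: real assume r: "r \<ge> 1"
    have "proximity (\<lambda>z. exp (poly \<alpha> z)) r \<le> circ_mean (\<lambda>_. C * r ^ degree \<alpha>) r"
      unfolding proximity_eq_circ_mean log_plus_norm_exp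
    proof (intro circ_mean_mono)
      show "continuous_on (sphere 0 r) (\<lambda>z. max 0 (Re (poly \<alpha> z)))"
        by (intro continuous_intros continuous_on_poly_fun)
      fix z :: complex assume z: "cmod z = r"
      have "Re (poly \<alpha> z) \<le> cmod (poly \<alpha> z)" by (rule complex_Re_le_cmod)
      also have "\<dots> \<le> C * r ^ degree \<alpha>" using C(2)[of z] z r by simp
      finally show "max 0 (Re (poly \<alpha> z)) \<le> C * r ^ degree \<alpha>" using C r by simp
    qed (use r in \<open>auto intro!: continuous_intros\<close>)
    thus "proximity (\<lambda>z. exp (poly \<alpha> z)) r \<le> C * r ^ degree \<alpha>" by simp
  qed
qed

text \<open>Avoids studying the sign of \<open>Re (poly \<alpha> z)\<close> along the circle. The
  proximity is the mean of its positive part, so the mean of its modulus is twice the proximity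
  minus \<open>Re (poly \<alpha> 0)\<close>. By \<open>deriv_bound_by_Re_mean\<close> at a point of
  modulus \<open>r / 2\<close>, that mean is at least \<open>r / 8\<close> times the modulus of the
  derivative of \<open>\<alpha>\<close> there, which has order
  \<open>r ^ (degree \<alpha> - 1)\<close>.\<close>

lemma proximity_exp_poly_ge:
  fixes \<alpha> :: "complex poly"
  assumes d: "degree \<alpha> \<ge> 1"
  obtains c k R where "c > 0" "\<And>r. r \<ge> R \<Longrightarrow> c * r ^ degree \<alpha> - k \<le> proximity (\<lambda>z. exp (poly \<alpha> z)) r"
proof -
  define D where "D = degree \<alpha> - 1"
  have D: "degree \<alpha> = Suc D" using d by (simp add: D_def)
  have "pderiv \<alpha> \<noteq> 0" "degree (pderiv \<alpha>) = D" using d by (auto simp: pderiv_eq_0_iff degree_pderiv D_def)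
  then obtain c0 R0 where c0: "c0 > 0" "R0 \<ge> 1" "\<And>z. cmod z \<ge> R0 \<Longrightarrow> c0 * cmod z ^ D \<le> cmod (poly (pderiv \<alpha>) z)"
    using norm_poly_ge[of "pderiv \<alpha>"] by metis
  have "c0 / (2 ^ D * 16) * r ^ degree \<alpha> - (- Re (poly \<alpha> 0) / 2) \<le> proximity (\<lambda>z. exp (poly \<alpha> z)) r"
    if r: "r \<ge> 2 * R0" for r
  proof -
    have r0: "r > 0" using r c0 by linarith
    define z :: complex where "z = of_real (r / 2)"
    have z: "cmod z = r / 2" using r0 by (simp add: z_def)
    have hol: "(\<lambda>z. poly \<alpha> z) holomorphic_on cball 0 r"
      by (rule analytic_imp_holomorphic[OF analytic_on_poly_fun])
    have "c0 * (r / 2) ^ D \<le> cmod (poly (pderiv \<alpha>) z)" using c0(3)[of z] z r by simp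
    also have "poly (pderiv \<alpha>) z = deriv (\<lambda>z. poly \<alpha> z) z"
      by (rule DERIV_imp_deriv[symmetric]) (rule poly_DERIV)
    also have "cmod \<dots> \<le> 2 * r / (r - cmod z)\<^sup>2 * circ_mean (\<lambda>w. \<bar>Re (poly \<alpha> w)\<bar>) r"
      using z r0 by (intro deriv_bound_by_Re_mean hol) simp
    also have "2 * r / (r - cmod z)\<^sup>2 = 8 / r" using r0 by (simp add: z power2_eq_square field_simps)
    finally have "c0 * (r / 2) ^ D * r / 8 \<le> circ_mean (\<lambda>w. \<bar>Re (poly \<alpha> w)\<bar>) r"
      using r0 by (simp add: field_simps)
    also have "circ_mean (\<lambda>w. \<bar>Re (poly \<alpha> w)\<bar>) r = circ_mean (\<lambda>w. 2 * max 0 (Re (poly \<alpha> w)) - Re (poly \<alpha> w)) r"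
      by (rule circ_mean_cong) (use r0 in \<open>auto simp: max_def abs_if\<close>)
    also have "\<dots> = circ_mean (\<lambda>w. 2 * max 0 (Re (poly \<alpha> w))) r - circ_mean (\<lambda>w. Re (poly \<alpha> w)) r"
      using r0 by (intro circ_mean_diff continuous_intros continuous_on_poly_fun) auto
    also have "circ_mean (\<lambda>w. Re (poly \<alpha> w)) r = Re (poly \<alpha> 0)"
      using hol r0 by (intro circ_mean_Re_holomorphic)
    also have "circ_mean (\<lambda>w. 2 * max 0 (Re (poly \<alpha> w))) r = 2 * proximity (\<lambda>z. exp (poly \<alpha> z)) r"
      by (simp only: circ_mean_cmult proximity_eq_circ_mean log_plus_norm_exp)
    finally show ?thesis using c0 by (simp add: D power_divide field_simps)
  qed
  moreover have "c0 / (2 ^ D * 16) > 0" using c0 by simp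
  ultimately show ?thesis using that by blast
qed

text \<open>The upper bound uses \<open>f = q * exp \<alpha>\<close>, the lower one
  \<open>exp \<alpha> = f / q\<close>; the rational factors cost a multiple of \<open>ln r\<close>,
  which the power of \<open>r\<close> absorbs because
  \<open>degree \<alpha> \<ge> 1\<close>.\<close>

lemma char_T_exp_growth:
  assumes q: "rational_function q" and d: "degree \<alpha> \<ge> 1" and f: "f meromorphic_on UNIV" "\<forall>\<^sub>\<approx>z\<in>UNIV. f z \<noteq> 0"
    and eq: "\<forall>\<^sub>\<approx>z\<in>UNIV. f z = q z * exp (poly \<alpha> z)"
  obtains c C where "c > 0" "C > 0"
    "eventually (\<lambda>r. c * r ^ degree \<alpha> \<le> char_T f r) nev_filter" "eventually (\<lambda>r. char_T f r \<le> C * r ^ degree \<alpha>) nev_filter"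
proof -
  define g where "g = (\<lambda>z. exp (poly \<alpha> z))"
  define q' where "q' = (\<lambda>z. inverse (q z))"
  have q': "rational_function q'" unfolding q'_def by (rule rational_function_inverse[OF q])
  have g_an: "g analytic_on UNIV" unfolding g_def by (intro analytic_intros analytic_on_poly_fun)
  have g: "g meromorphic_on UNIV" using g_an by (rule analytic_on_imp_meromorphic_on)
  have qm: "q meromorphic_on UNIV" "q' meromorphic_on UNIV" using rational_function_meromorphic q q' by blast+
  obtain M1 where M1: "M1 > 0" "eventually (\<lambda>r. norm (char_T q r) \<le> M1 * norm (ln r)) nev_filter"
    using rational_function_char_T[OF q] by (elim landau_o.bigE)
  obtain M2 where M2: "M2 > 0" "eventually (\<lambda>r. norm (char_T q' r) \<le> M2 * norm (ln r)) nev_filter"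
    using rational_function_char_T[OF q'] by (elim landau_o.bigE)
  obtain C where C: "C \<ge> 0" "\<And>r. r \<ge> 1 \<Longrightarrow> proximity g r \<le> C * r ^ degree \<alpha>"
    by (rule proximity_exp_poly_le[where \<alpha> = \<alpha>, folded g_def]) (rule that)
  obtain c k R where c: "c > 0" "\<And>r. r \<ge> R \<Longrightarrow> c * r ^ degree \<alpha> - k \<le> proximity g r"
    by (rule proximity_exp_poly_ge[OF d, folded g_def]) (rule that)
  have ln_le: "ln r \<le> r ^ degree \<alpha>" if "r \<ge> 1" for r :: real
  proof -
    have "ln r \<le> r ^ 1" using ln_le_minus_one[of r] that by simp
    also have "\<dots> \<le> r ^ degree \<alpha>" using that d by (intro power_increasing) auto
    finally show ?thesis .
  qed
  have Nf: "N_count f r \<le> N_count q r" if "r \<ge> 1" for r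
    using N_count_cong_cosparse[OF eq] N_count_mult[OF qm(1) g that] N_count_analytic[OF g_an] by (simp add: g_def)
  have "eventually (\<lambda>r. char_T f r \<le> (M1 + C + 1) * r ^ degree \<alpha>) nev_filter"
    using M1(2) eventually_nev_ge[of 1] proximity_cong_cosparse[OF eq] eventually_analytic_circle[OF qm(1)] eventually_analytic_circle[OF g]
  proof eventually_elim
    case (elim r)
    have "char_T f r \<le> proximity q r + proximity g r + N_count q r"
      using proximity_mult[OF elim(4,5)] Nf[OF elim(2)] elim(3) by (simp add: char_T_def g_def)
    also have "\<dots> = char_T q r + proximity g r" by (simp add: char_T_def)
    also have "char_T q r \<le> M1 * ln r" using elim by simp
    also have "M1 * ln r \<le> M1 * r ^ degree \<alpha>" using ln_le[OF elim(2)] M1 by (intro mult_left_mono) auto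
    also have "proximity g r \<le> C * r ^ degree \<alpha>" by (rule C(2)[OF elim(2)])
    finally show ?case using elim by (simp add: distrib_right add_increasing2)
  qed
  moreover have "eventually (\<lambda>r. c / 2 * r ^ degree \<alpha> \<le> char_T f r) nev_filter"
  proof -
    have "((\<lambda>r::real. ln r / r) \<longlongrightarrow> 0) at_top" by (rule ln_x_over_x_tendsto_0)
    hence "eventually (\<lambda>r::real. ln r / r < c / (4 * M2)) at_top"
      using c M2 by (intro order_tendstoD) auto
    note ev1 = eventually_nev_filter_at_top[OF this]
    have "\<forall>\<^sub>\<approx>z\<in>UNIV. g z = q' z * f z" using eq f(2) by eventually_elim (auto simp: g_def q'_def)
    from M2(2) eventually_nev_ge[of 1] proximity_cong_cosparse[OF this] eventually_analytic_circle[OF qm(2)]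
      eventually_analytic_circle[OF f(1)] ev1 eventually_nev_ge[of R] eventually_nev_ge[of "4 * \<bar>k\<bar> / c"]
    show ?thesis
    proof eventually_elim
      case (elim r)
      have "c * r ^ degree \<alpha> - k \<le> proximity g r" by (rule c(2)[OF elim(7)])
      also have "proximity g r \<le> proximity q' r + proximity f r" unfolding elim(3) by (rule proximity_mult[OF elim(4,5)])
      also have "proximity q' r \<le> char_T q' r" using N_count_nonneg[OF qm(2) elim(2)] by (simp add: char_T_def)
      also have "\<dots> \<le> M2 * ln r" using elim by simp
      also have "\<dots> \<le> c / 4 * r" using elim M2 by (simp add: field_simps)
      also have "proximity f r \<le> char_T f r" using N_count_nonneg[OF f(1) elim(2)] by (simp add: char_T_def)
      finally have "c * r ^ degree \<alpha> - k \<le> c / 4 * r + char_T f r" by simp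
      moreover have "k \<le> c / 4 * r" using elim(8) c by (simp add: field_simps)
      moreover have "c / 4 * r ^ 1 \<le> c / 4 * r ^ degree \<alpha>" using elim c d by (intro mult_left_mono power_increasing) auto
      ultimately show ?case by simp
    qed
  qed
  ultimately show ?thesis using that[of "c / 2" "M1 + C + 1"] c M1 C by auto
qed

text \<open>The two hypotheses use different filters on purpose: bounding a limsup from above needs
  all large radii, while for the bound from below arbitrarily large ones suffice, and those exist
  off any exceptional set of finite measure.\<close>

lemma nev_order_eqI:
  assumes c: "c > 0" "eventually (\<lambda>r. c * r ^ d \<le> char_T h r) nev_filter"
    and C: "eventually (\<lambda>r. 0 \<le> char_T h r \<and> char_T h r \<le> C * r ^ d) at_top"
  shows "nev_order h = ereal (real d)"
proof -
  define X where "X = (\<lambda>r. ereal (ln (char_T h r) / ln r))"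
  have lim: "((\<lambda>r. ereal (real d + K / ln r)) \<longlongrightarrow> ereal (real d)) at_top" for K
  proof -
    have "((\<lambda>r::real. K / ln r) \<longlongrightarrow> 0) at_top"
      by (rule tendsto_divide_0[OF tendsto_const filterlim_at_top_imp_at_infinity[OF ln_at_top]])
    hence "((\<lambda>r::real. real d + K / ln r) \<longlongrightarrow> real d + 0) at_top" by (intro tendsto_intros)
    thus ?thesis by simp
  qed
  have "Limsup at_top X \<le> ereal (real d)"
  proof -
    \<comment> \<open>Makes \<open>ln C'\<close> nonnegative, so that the bound also covers
      \<open>char_T h r = 0\<close>, where \<open>ln\<close> returns 0.\<close>
    define C' where "C' = max 1 C"
    have "eventually (\<lambda>r. X r \<le> ereal (real d + ln C' / ln r)) at_top"
      using C eventually_gt_at_top[of 1]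
    proof eventually_elim
      case (elim r)
      have lnr: "ln r > 0" using elim by simp
      have "C * r ^ d \<le> C' * r ^ d" using elim by (intro mult_right_mono) (auto simp: C'_def)
      hence T: "0 \<le> char_T h r" "char_T h r \<le> C' * r ^ d" using elim by linarith+
      have ln_eq: "ln (C' * r ^ d) = ln C' + real d * ln r"
        using elim by (simp add: C'_def ln_mult_pos ln_realpow)
      have "ln (char_T h r) \<le> ln C' + real d * ln r"
      proof (cases "char_T h r = 0")
        case True
        thus ?thesis using lnr by (simp add: C'_def)
      next
        case False
        hence "ln (char_T h r) \<le> ln (C' * r ^ d)" using T by (intro ln_mono) auto
        thus ?thesis by (simp add: ln_eq)
      qed
      hence "ln (char_T h r) / ln r \<le> (ln C' + real d * ln r) / ln r" using lnr by (intro divide_right_mono) auto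
      also have "\<dots> = real d + ln C' / ln r" using lnr by (simp add: field_simps)
      finally show ?case by (simp add: X_def)
    qed
    hence "Limsup at_top X \<le> Limsup at_top (\<lambda>r. ereal (real d + ln C' / ln r))" by (rule Limsup_mono)
    also have "\<dots> = ereal (real d)" by (rule lim_imp_Limsup[OF _ lim]) simp
    finally show ?thesis .
  qed
  moreover have "\<not> Limsup at_top X < ereal (real d)"
  proof
    assume "Limsup at_top X < ereal (real d)"
    then obtain y where y: "Limsup at_top X < y" "y < ereal (real d)" using dense by blast
    have "eventually (\<lambda>r. X r < y) at_top" using y(1) by (rule Limsup_lessD)
    moreover have "eventually (\<lambda>r. y < ereal (real d + ln c / ln r)) at_top"
      using lim y(2) by (rule order_tendstoD)
    ultimately have "eventually (\<lambda>r. X r < ereal (real d + ln c / ln r) \<and> r > 1) at_top"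
      using eventually_gt_at_top[of 1] by eventually_elim auto
    hence "eventually (\<lambda>r. X r < ereal (real d + ln c / ln r) \<and> r > 1) nev_filter"
      by (rule eventually_nev_filter_at_top)
    with c(2) have "eventually (\<lambda>r. False) nev_filter"
    proof eventually_elim
      case (elim r)
      have lnr: "ln r > 0" using elim by simp
      have "ln (c * r ^ d) \<le> ln (char_T h r)" using elim c(1) by (intro ln_mono) auto
      hence "(ln c + real d * ln r) / ln r \<le> ln (char_T h r) / ln r"
        using elim c(1) lnr by (intro divide_right_mono) (auto simp: ln_mult_pos ln_realpow)
      moreover have "(ln c + real d * ln r) / ln r = real d + ln c / ln r" using lnr by (simp add: field_simps)
      ultimately show False using elim by (simp add: X_def)
    qed
    thus False by simp
  qed
  ultimately have "Limsup at_top X = ereal (real d)" by (simp add: antisym_conv2)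
  thus ?thesis by (simp add: nev_order_def X_def)
qed

text \<open>The estimate \<open>3 * proximity H R\<close> for \<open>H\<close> on the disc of radius \<open>R / 2\<close> removes the
  exceptional set.\<close>

lemma char_T_power_bound_no_exception:
  assumes h: "h nicely_meromorphic_on UNIV" and h_nz: "\<forall>\<^sub>\<approx>z\<in>UNIV. h z \<noteq> 0"
    and fin: "finite {z. is_pole h z}" and d: "d \<ge> 1"
    and bd: "eventually (\<lambda>r. char_T h r \<le> C * r ^ d) nev_filter"
  obtains C' where "eventually (\<lambda>r. 0 \<le> char_T h r \<and> char_T h r \<le> C' * r ^ d) at_top"
proof -
  have hm: "h meromorphic_on UNIV" using h by (simp add: nicely_meromorphic_on_def)
  obtain p H where pH: "p \<noteq> 0" "\<And>z. poly p z = 0 \<Longrightarrow> is_pole h z" "H analytic_on UNIV"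
    "\<And>z. h analytic_on {z} \<Longrightarrow> H z = h z * poly p z" using clear_poles[OF hm fin] by blast
  have "\<forall>\<^sub>\<approx>z\<in>UNIV. H z = h z * poly p z"
    using meromorphic_on_imp_analytic_cosparse[OF hm] by eventually_elim (rule pH(4))
  hence H_nz: "\<forall>\<^sub>\<approx>z\<in>UNIV. H z \<noteq> 0"
    using h_nz poly_nonzero_cosparse[OF pH(1)] by eventually_elim simp
  have Hm: "H meromorphic_on UNIV" using pH(3) by (rule analytic_on_imp_meromorphic_on)
  obtain M1 R1 where M1: "M1 \<ge> 0" "\<And>r. r \<ge> R1 \<Longrightarrow> proximity (\<lambda>z. poly 1 z / poly p z) r \<le> M1 * ln r"
    using proximity_quotient_poly[OF pH(1)] by blast
  obtain M2 R2 where M2: "M2 \<ge> 0" "\<And>r. r \<ge> R2 \<Longrightarrow> proximity (\<lambda>z. poly p z / poly 1 z) r \<le> M2 * ln r"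
    using proximity_quotient_poly[of 1 p] by auto
  obtain M3 where M3: "M3 > 0" "eventually (\<lambda>r. norm (N_count h r) \<le> M3 * norm (ln r)) at_top"
    using N_count_finite_poles[OF hm fin] by (elim landau_o.bigE)
  obtain R4 where R4: "\<And>z. is_pole h z \<Longrightarrow> cmod z < R4"
  proof -
    have "bounded {z. is_pole h z}" using fin by (rule finite_imp_bounded)
    then obtain B where "\<And>z. is_pole h z \<Longrightarrow> cmod z \<le> B" by (auto simp: bounded_iff)
    thus ?thesis by (intro that[of "B + 1"]) force
  qed
  \<comment> \<open>As \<open>h\<close> is nicely meromorphic, it is analytic at every point that is
    not a pole. Hence no circle beyond \<open>R4\<close> has to be avoided.\<close>
  have an: "h analytic_on {z}" if "cmod z \<ge> R4" for z
    using nicely_meromorphic_on_imp_analytic_at[OF h, of z] R4[of z] that by auto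
  have "eventually (\<lambda>r. char_T h r \<le> C * r ^ d \<and> good_circle H r \<and> analytic_circle h r) nev_filter"
    using bd eventually_good_circle[OF Hm H_nz] eventually_analytic_circle[OF hm] by eventually_elim auto
  \<comment> \<open>A good radius \<open>s \<ge> 2 * r\<close> places the circle of radius
    \<open>r\<close> in the half disc of \<open>s\<close>, and \<open>s \<le> 3 * r\<close> costs
    only the factor \<open>3 ^ d\<close>.\<close>
  then obtain r0 where r0: "\<And>r. r \<ge> r0 \<Longrightarrow> \<exists>s. 2 * r \<le> s \<and> s \<le> 3 * r \<and> (char_T h s \<le> C * s ^ d \<and> good_circle H s \<and> analytic_circle h s)"
    by (rule eventually_nev_point_in_interval) blast
  define C1 where "C1 = M1 + 3 * (\<bar>C\<bar> * 3 ^ d + M2 * 3) + M3"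
  have "eventually (\<lambda>r. 0 \<le> char_T h r \<and> char_T h r \<le> C1 * r ^ d) at_top"
    using M3(2) eventually_ge_at_top[of r0] eventually_ge_at_top[of 1] eventually_ge_at_top[of R1]
      eventually_ge_at_top[of R2] eventually_ge_at_top[of R4]
  proof eventually_elim
    case (elim r)
    obtain s where s: "2 * r \<le> s" "s \<le> 3 * r" "char_T h s \<le> C * s ^ d" "good_circle H s" "analytic_circle h s"
      using r0[OF elim(2)] by blast
    have s1: "s \<ge> 1" using s elim by linarith
    have pnz: "poly p z \<noteq> 0" if "cmod z = r" for z using pH(2)[of z] R4[of z] elim that by auto
    have lnr: "ln r \<le> r ^ d"
    proof -
      have "ln r \<le> r ^ 1" using ln_le_minus_one[of r] elim by simp
      also have "\<dots> \<le> r ^ d" using elim d by (intro power_increasing) auto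
      finally show ?thesis .
    qed
    have lns: "ln s \<le> 3 * r ^ d"
    proof -
      have "ln s \<le> s" using ln_le_minus_one[of s] s1 by simp
      also have "\<dots> \<le> 3 * r ^ 1" using s by simp
      also have "\<dots> \<le> 3 * r ^ d" using elim d by (intro mult_left_mono power_increasing) auto
      finally show ?thesis .
    qed
    have Han: "analytic_circle H t" if "t > 0" for t
      using that pH(3) by (auto simp: analytic_circle_def intro: analytic_on_subset)
    have "proximity H r = circ_mean (\<lambda>z. log_plus (cmod (H z))) r" by (rule proximity_eq_circ_mean)
    also have "\<dots> \<le> circ_mean (\<lambda>_. 3 * proximity H s) r"
    proof (intro circ_mean_mono continuous_on_const continuous_log_plus_circle)
      show "analytic_circle H r" using elim by (intro Han) simp
      fix z :: complex assume "cmod z = r"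
      thus "log_plus (cmod (H z)) \<le> 3 * proximity H s"
        using s elim by (intro log_plus_le_proximity pH H_nz s) auto
    qed (use elim in auto)
    finally have Hr: "proximity H r \<le> 3 * proximity H s" by simp
    have "proximity H s = proximity (\<lambda>z. h z * poly p z) s"
      using s pH(4) s1 by (intro proximity_cong_circle) (auto simp: analytic_circle_def)
    also have "\<dots> \<le> proximity h s + proximity (poly p) s"
      using s s1 by (intro proximity_mult) (auto simp: analytic_circle_def analytic_on_poly_fun)
    also have "proximity h s \<le> char_T h s" using N_count_nonneg[OF hm s1] by (simp add: char_T_def)
    also have "char_T h s \<le> C * s ^ d" by fact
    also have "C * s ^ d \<le> \<bar>C\<bar> * (3 * r) ^ d" using s s1 by (intro mult_mono power_mono) auto
    also have "proximity (poly p) s \<le> M2 * ln s" using M2(2)[of s] s elim by simp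
    also have "M2 * ln s \<le> M2 * (3 * r ^ d)" using lns M2 by (intro mult_left_mono)
    finally have Hs: "proximity H s \<le> (\<bar>C\<bar> * 3 ^ d + M2 * 3) * r ^ d"
      by (simp add: power_mult_distrib algebra_simps)
    have "proximity h r = proximity (\<lambda>z. H z * (poly 1 z / poly p z)) r"
      using pH(4)[OF an] pnz elim by (intro proximity_cong_circle) auto
    also have "\<dots> \<le> proximity H r + proximity (\<lambda>z. poly 1 z / poly p z) r"
      using elim pnz by (intro proximity_mult Han) (auto simp: analytic_circle_def intro!: analytic_intros analytic_on_poly_fun)
    also have "proximity (\<lambda>z. poly 1 z / poly p z) r \<le> M1 * ln r" using M1(2) elim by simp
    also have "M1 * ln r \<le> M1 * r ^ d" using lnr M1 by (intro mult_left_mono)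
    finally have "proximity h r \<le> 3 * ((\<bar>C\<bar> * 3 ^ d + M2 * 3) * r ^ d) + M1 * r ^ d" using Hr Hs by simp
    moreover have "N_count h r \<le> M3 * r ^ d"
    proof -
      have "N_count h r \<le> M3 * ln r" using elim by simp
      also have "\<dots> \<le> M3 * r ^ d" using lnr M3 by (intro mult_left_mono) auto
      finally show ?thesis .
    qed
    ultimately have "char_T h r \<le> C1 * r ^ d" by (simp add: char_T_def C1_def algebra_simps)
    thus ?case using char_T_nonneg[OF hm] elim by simp
  qed
  thus ?thesis by (rule that)
qed

subsection \<open>The two alternatives\<close>

text \<open>Where \<open>cmod u \<ge> 1\<close>, dividing the equation by \<open>n^2 * u\<close>
  bounds \<open>cmod u\<close> by the sum of the moduli of \<open>u'/u\<close>, \<open>r1\<close>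
  and \<open>r0\<close>. If \<open>u\<close> were transcendental, all three proximities would be
  small with respect to \<open>u\<close>; with finitely many poles its characteristic would then be
  o of itself, although it tends to infinity.\<close>

lemma riccati_rational:
  assumes u: "u meromorphic_on UNIV" "finite {z. is_pole u z}" and r: "rational_function r0" "rational_function r1" and n: "n \<ge> (1::nat)"
    and eq: "\<forall>\<^sub>\<approx>z\<in>UNIV. of_nat n * deriv u z + (of_nat n * u z)\<^sup>2 + r1 z * (of_nat n * u z) + r0 z = 0"
  shows "rational_function u"
proof (rule ccontr)
  assume tr: "\<not> rational_function u"
  have nz: "\<forall>\<^sub>\<approx>z\<in>UNIV. u z \<noteq> 0"
    using meromorphic_imp_constant_or_avoid[OF u(1), of 0] rational_function_cong[OF rational_function_const, of u 0] tr by auto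
  interpret U: nev_large u
    by unfold_locales (use u nz transcendental_growth[OF u(1) nz tr] in auto)
  define v where "v = (\<lambda>z. deriv u z / u z)"
  have v: "v meromorphic_on UNIV" unfolding v_def by (intro meromorphic_intros u)
  note rm = rational_function_meromorphic(1)[OF r(1)] rational_function_meromorphic(1)[OF r(2)]
  define S where "S = (\<lambda>r. proximity v r + proximity r1 r + proximity r0 r + 2 * ln 2)"
  have "U.nev_small r0" "U.nev_small r1" "U.nev_small v"
    using rational_nev_small[OF U.nev_large_axioms] r U.nev_small_logderiv by (auto simp: v_def)
  hence S: "S \<in> o[nev_filter](char_T u)" unfolding S_def
    by (intro sum_in_smallo U.const_small) (auto simp: U.nev_small_def)
  have "eventually (\<lambda>r. proximity u r \<le> S r) nev_filter"
    using eventually_nev_circle[OF eq] eventually_good_circle[OF u(1) nz] eventually_analytic_circle[OF v]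
      eventually_analytic_circle[OF rm(1)] eventually_analytic_circle[OF rm(2)]
  proof eventually_elim
    case (elim r)
    have r0: "r \<ge> 0" using elim by (simp add: good_circle_def)
    have u_an: "analytic_circle u r" using elim by (auto simp: analytic_circle_def good_circle_def)
    note cont = continuous_log_plus_circle[OF u_an] continuous_log_plus_circle[OF elim(3)]
      continuous_log_plus_circle[OF elim(4)] continuous_log_plus_circle[OF elim(5)]
    have "proximity u r \<le> circ_mean (\<lambda>z. (log_plus (cmod (v z)) + log_plus (cmod (r1 z))) + (log_plus (cmod (r0 z)) + 2 * ln 2)) r"
      unfolding proximity_eq_circ_mean
    proof (intro circ_mean_mono continuous_on_add continuous_on_const cont)
      fix z :: complex assume z: "cmod z = r"
      have uz: "u z \<noteq> 0" using elim z by (auto simp: good_circle_def)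
      show "log_plus (cmod (u z)) \<le> (log_plus (cmod (v z)) + log_plus (cmod (r1 z))) + (log_plus (cmod (r0 z)) + 2 * ln 2)"
      proof (cases "cmod (u z) \<le> 1")
        case True
        hence "log_plus (cmod (u z)) = 0" by (simp add: log_plus_eq max_absorb1)
        thus ?thesis by simp
      next
        case False
        hence u1: "cmod (u z) \<ge> 1" by simp
        have nn: "real n * real n \<ge> real n * 1" "real n \<ge> 1" using n by (auto intro!: mult_left_mono)
        hence nn1: "1 \<le> real n * real n" by linarith
        have "of_nat n * deriv u z + (of_nat n * u z)\<^sup>2 + r1 z * (of_nat n * u z) + r0 z = 0" using elim z by blast
        hence e: "(of_nat n * of_nat n) * u z * u z = - (of_nat n * deriv u z + of_nat n * r1 z * u z + r0 z)"
          by (simp add: power2_eq_square algebra_simps eq_neg_iff_add_eq_0)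
        have dv: "deriv u z = v z * u z" using uz by (simp add: v_def)
        have "(real n * real n) * cmod (u z) * cmod (u z) = cmod ((of_nat n * of_nat n) * u z * u z)"
          by (simp add: norm_mult)
        also have "\<dots> = cmod (of_nat n * deriv u z + of_nat n * r1 z * u z + r0 z)"
          unfolding e by (rule norm_minus_cancel)
        also have "\<dots> \<le> real n * cmod (v z) * cmod (u z) + real n * cmod (r1 z) * cmod (u z) + cmod (r0 z)"
          unfolding dv by (intro norm_triangle_le add_mono) (auto simp: norm_mult)
        also have "\<dots> \<le> (real n * real n) * cmod (v z) * cmod (u z) + (real n * real n) * cmod (r1 z) * cmod (u z)
            + (real n * real n) * cmod (r0 z) * cmod (u z)"
        proof (intro add_mono mult_right_mono)
          have "1 * cmod (r0 z) * 1 \<le> (real n * real n) * cmod (r0 z) * cmod (u z)"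
            using nn1 u1 by (intro mult_mono) auto
          thus "cmod (r0 z) \<le> (real n * real n) * cmod (r0 z) * cmod (u z)" by simp
        qed (use nn in auto)
        also have "\<dots> = (real n * real n) * (cmod (v z) + cmod (r1 z) + cmod (r0 z)) * cmod (u z)"
          by (simp add: algebra_simps)
        finally have "((real n * real n) * cmod (u z)) * cmod (u z) \<le> ((real n * real n) * (cmod (v z) + cmod (r1 z) + cmod (r0 z))) * cmod (u z)" .
        hence "(real n * real n) * cmod (u z) \<le> (real n * real n) * (cmod (v z) + cmod (r1 z) + cmod (r0 z))"
          using uz by (subst (asm) mult_le_cancel_right_pos) auto
        hence "cmod (u z) \<le> cmod (v z) + cmod (r1 z) + cmod (r0 z)"
          using n by (subst (asm) mult_le_cancel_left_pos) auto
        hence "log_plus (cmod (u z)) \<le> log_plus (cmod (v z) + cmod (r1 z) + cmod (r0 z))" by (intro log_plus_mono) auto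
        also have "\<dots> \<le> log_plus (cmod (v z) + cmod (r1 z)) + log_plus (cmod (r0 z)) + ln 2" by (intro log_plus_add) auto
        also have "log_plus (cmod (v z) + cmod (r1 z)) \<le> log_plus (cmod (v z)) + log_plus (cmod (r1 z)) + ln 2" by (intro log_plus_add) auto
        finally show ?thesis by simp
      qed
    qed (use r0 in auto)
    also have "\<dots> = circ_mean (\<lambda>z. log_plus (cmod (v z)) + log_plus (cmod (r1 z))) r + circ_mean (\<lambda>z. log_plus (cmod (r0 z)) + 2 * ln 2) r"
      using r0 by (intro circ_mean_add continuous_on_add continuous_on_const cont)
    also have "circ_mean (\<lambda>z. log_plus (cmod (v z)) + log_plus (cmod (r1 z))) r = proximity v r + proximity r1 r"
      unfolding proximity_eq_circ_mean using r0 by (intro circ_mean_add cont)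
    also have "circ_mean (\<lambda>z. log_plus (cmod (r0 z)) + 2 * ln 2) r = circ_mean (\<lambda>z. log_plus (cmod (r0 z))) r + circ_mean (\<lambda>_. 2 * ln 2) r"
      using r0 by (intro circ_mean_add continuous_on_const cont)
    finally show ?case by (simp add: S_def proximity_eq_circ_mean)
  qed
  note uS = this
  have "N_count u \<in> O[nev_filter](\<lambda>r. ln r)"
    using N_count_finite_poles_nev[OF u] .
  hence "N_count u \<in> o[nev_filter](char_T u)" using U.ln_small landau_o.big_small_trans by blast
  hence SN: "(\<lambda>r. S r + N_count u r) \<in> o[nev_filter](char_T u)" using S by (intro sum_in_smallo)
  have "eventually (\<lambda>r. 0 \<le> char_T u r \<and> char_T u r \<le> S r + N_count u r) nev_filter"
    using uS eventually_nev_ge[of 1]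
    by eventually_elim (use char_T_nonneg[OF u(1)] in \<open>auto simp: char_T_def\<close>)
  hence "char_T u \<in> o[nev_filter](char_T u)" using SN by (rule smallo_mono_nonneg)
  hence "eventually (\<lambda>r. char_T u r = 0) nev_filter" by (simp only: landau_o.small_refl_iff)
  moreover have "eventually (\<lambda>r. char_T u r \<ge> 1) nev_filter" using U.T_at_top by (simp add: filterlim_at_top)
  ultimately have "eventually (\<lambda>r. False) nev_filter" by eventually_elim simp
  thus False by simp
qed

lemma not_is_pole_polynomial_fun:
  assumes "is_polynomial_fun r"
  shows "\<not>is_pole r z"
proof -
  obtain p where "\<forall>\<^sub>\<approx>z\<in>UNIV. r z = poly p z" using assms unfolding is_polynomial_fun_def by blast
  from is_pole_cong[OF cosparse_UNIV_at[OF this] refl] show ?thesis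
    using analytic_at_imp_no_pole[OF analytic_on_poly_fun] by simp
qed

context nev_large
begin

lemma ode_for_power:
  fixes n :: nat and P h r0 r1 r2 :: "complex \<Rightarrow> complex"
  assumes P: "P meromorphic_on UNIV" and eq: "\<forall>\<^sub>\<approx>z\<in>UNIV. f z ^ n + P z = h z"
    and ode: "\<forall>\<^sub>\<approx>z\<in>UNIV. deriv (deriv h) z + r1 z * deriv h z + r0 z * h z = r2 z"
  defines "u \<equiv> (\<lambda>z. deriv f z / f z)"
  defines "\<psi> \<equiv> (\<lambda>z. of_nat n * deriv u z + (of_nat n * u z)\<^sup>2 + r1 z * (of_nat n * u z) + r0 z)"
  shows "\<forall>\<^sub>\<approx>z\<in>UNIV. f z ^ n * \<psi> z = r2 z + (- 1) * (deriv (deriv P) z + r1 z * deriv P z + r0 z * P z)"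
proof -
  define F1 where "F1 = (\<lambda>z. of_nat n * u z * f z ^ n + deriv P z)"
  have um: "u meromorphic_on UNIV" unfolding u_def by (intro meromorphic_intros f)
  have dP: "deriv P meromorphic_on UNIV" by (intro meromorphic_intros P)
  have d1: "\<forall>\<^sub>\<approx>z\<in>UNIV. ((\<lambda>z. f z ^ n) has_field_derivative of_nat n * u z * f z ^ n) (at z)"
    using analytic_cosparse
  proof eventually_elim
    case (elim z)
    have "((\<lambda>z. f z ^ n) has_field_derivative of_nat n * f z ^ (n - 1) * deriv f z) (at z)"
      using analytic_DERIV[of f z] elim by (auto intro!: derivative_eq_intros)
    moreover have "of_nat n * f z ^ (n - 1) * deriv f z = of_nat n * u z * f z ^ n"
      using elim by (cases n) (auto simp: u_def)
    ultimately show ?case by (simp only:)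
  qed
  have h1: "\<forall>\<^sub>\<approx>z\<in>UNIV. deriv h z = F1 z"
    using cosparse_deriv_cong[OF eq] d1 meromorphic_on_imp_analytic_cosparse[OF P]
  proof eventually_elim
    case (elim z)
    have "((\<lambda>z. f z ^ n + P z) has_field_derivative F1 z) (at z)"
      unfolding F1_def by (intro DERIV_add elim analytic_DERIV)
    thus ?case using elim DERIV_imp_deriv by fastforce
  qed
  have h2: "\<forall>\<^sub>\<approx>z\<in>UNIV. deriv (deriv h) z = (of_nat n * deriv u z + (of_nat n * u z)\<^sup>2) * f z ^ n + deriv (deriv P) z"
    using cosparse_deriv_cong[OF h1] d1 meromorphic_on_imp_analytic_cosparse[OF dP] meromorphic_on_imp_analytic_cosparse[OF um]
  proof eventually_elim
    case (elim z)
    have "(F1 has_field_derivative (of_nat n * deriv u z * f z ^ n + of_nat n * u z * f z ^ n * (of_nat n * u z)) + deriv (deriv P) z) (at z)"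
      unfolding F1_def
      by (intro DERIV_add DERIV_mult DERIV_cmult elim analytic_DERIV)
    thus ?case using elim(1) DERIV_imp_deriv by (fastforce simp: power2_eq_square algebra_simps)
  qed
  from h1 h2 eq ode show ?thesis
  proof eventually_elim
    case (elim z)
    show ?case unfolding \<psi>_def elim(4)[symmetric] elim(1,2) elim(3)[symmetric] F1_def
      by (simp add: algebra_simps)
  qed
qed

text \<open>The first fundamental theorem bounds the proximity of \<open>1 / \<psi>\<close> by that
  of \<open>\<psi>\<close>, which is small, plus \<open>N_count \<psi>\<close>. The poles of
  \<open>u\<close> are simple and lie at zeros and poles of \<open>f\<close>, so
  \<open>deriv u\<close> and \<open>u^2\<close> count each such point at most twice; the poles of
  \<open>r0\<close> and \<open>r1\<close> contribute O(ln r). Division by \<open>j\<close> gives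
  \<open>2 / j\<close>.\<close>

lemma second_alternative:
  fixes n :: nat and r0 r1 :: "complex \<Rightarrow> complex"
  defines "u \<equiv> (\<lambda>z. deriv f z / f z)"
  defines "\<psi> \<equiv> (\<lambda>z. of_nat n * deriv u z + (of_nat n * u z)\<^sup>2 + r1 z * (of_nat n * u z) + r0 z)"
  assumes r: "rational_function r0" "rational_function r1" and nz: "\<forall>\<^sub>\<approx>z\<in>UNIV. \<psi> z \<noteq> 0"
    and Q: "small_poly d Q" and eq: "\<forall>\<^sub>\<approx>z\<in>UNIV. f z ^ (d + j) * \<psi> z = Q z" and j: "j \<ge> 1"
  shows "\<exists>s. is_S f s \<and> (\<forall>r>0.
           char_T f r \<le> 2 / real j * N_count_bar (\<lambda>z. inverse (f z)) r + N_count f r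
                              + 2 / real j * N_count_bar f r + s r)"
proof -
  note rm = rational_function_meromorphic(1)[OF r(1)] rational_function_meromorphic(1)[OF r(2)]
  have um: "u meromorphic_on UNIV" unfolding u_def by (intro meromorphic_intros f)
  have psim: "\<psi> meromorphic_on UNIV" unfolding \<psi>_def by (intro meromorphic_intros um rm)
  have fi: "(\<lambda>z. inverse (f z)) meromorphic_on UNIV" by (intro meromorphic_intros f)
  have rs: "nev_small r0" "nev_small r1" using rational_nev_small[OF nev_large_axioms] r by auto
  have us: "nev_small u" unfolding u_def by (rule nev_small_logderiv)
  have psis: "nev_small \<psi>" unfolding \<psi>_def power2_eq_square
    by (intro nev_small_add nev_small_mult nev_small_const nev_small_deriv us rs)
  let ?b = "\<lambda>z. of_bool (is_pole f z) + of_bool (is_pole (\<lambda>z. inverse (f z)) z) :: nat"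
  have pm: "pole_mult \<psi> z \<le> 2 * ?b z + pole_mult r1 z + pole_mult r0 z" for z
  proof -
    note m = meromorphic_on_UNIV_at[OF um, of z] meromorphic_on_UNIV_at[OF rm(1), of z] meromorphic_on_UNIV_at[OF rm(2), of z]
    define K where "K = 2 * ?b z + pole_mult r1 z + pole_mult r0 z"
    have c0: "pole_mult (\<lambda>_. of_nat n) z = 0" by (intro pole_mult_analytic) auto
    have cm: "(\<lambda>_. of_nat n) meromorphic_on {z}" by (intro meromorphic_intros)
    have nm: "(\<lambda>z. of_nat n * u z) meromorphic_on {z}" by (intro meromorphic_intros m)
    have b: "pole_mult u z \<le> ?b z"
      unfolding u_def by (intro pole_mult_logderiv meromorphic_on_UNIV_at[OF f] cosparse_UNIV_at[OF f_nz])
    have nu: "pole_mult (\<lambda>z. of_nat n * u z) z \<le> ?b z"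
      using pole_mult_mult[OF cm m(1)] b c0 by simp
    have 1: "pole_mult (\<lambda>z. of_nat n * deriv u z) z \<le> K"
      using pole_mult_mult[OF cm meromorphic_on_deriv[OF m(1)]] pole_mult_deriv_le_double[OF m(1)] b c0 by (simp add: K_def)
    have 2: "pole_mult (\<lambda>z. (of_nat n * u z)\<^sup>2) z \<le> K"
      unfolding power2_eq_square using pole_mult_mult[OF nm nm] nu by (simp add: K_def)
    have 3: "pole_mult (\<lambda>z. r1 z * (of_nat n * u z)) z \<le> K"
      using pole_mult_mult[OF m(3) nm] nu by (simp add: K_def)
    have 4: "pole_mult r0 z \<le> K" by (simp add: K_def)
    show ?thesis unfolding \<psi>_def K_def[symmetric]
      by (intro pole_mult_add 1 2 3 4 meromorphic_intros m)
  qed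
  have N_psi: "N_count \<psi> r \<le> 2 * N_count_bar f r + 2 * N_count_bar (\<lambda>z. inverse (f z)) r + N_count r1 r + N_count r0 r"
    if r1: "r \<ge> 1" for r
  proof -
    define w where "w = (\<lambda>z. 2 * of_bool (is_pole f z) + 2 * of_bool (is_pole (\<lambda>z. inverse (f z)) z) + real (pole_mult r1 z) + real (pole_mult r0 z))"
    note lf = locally_finite_support_add locally_finite_support_cmult locally_finite_support_pole locally_finite_support_pole_mult
    have "real (pole_mult \<psi> z) \<le> w z" for z
    proof -
      have "real (pole_mult \<psi> z) \<le> real (2 * ?b z + pole_mult r1 z + pole_mult r0 z)" using pm[of z] by (simp only: of_nat_le_iff)
      thus ?thesis by (simp add: w_def)
    qed
    hence "N_count \<psi> r \<le> log_count w r"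
      by (intro N_count_le psim r1) (auto simp: w_def intro!: lf f fi rm)
    also have "\<dots> = log_count (\<lambda>z. 2 * of_bool (is_pole f z)) r + log_count (\<lambda>z. 2 * of_bool (is_pole (\<lambda>z. inverse (f z)) z)) r
        + log_count (\<lambda>z. real (pole_mult r1 z)) r + log_count (\<lambda>z. real (pole_mult r0 z)) r"
    proof -
      have a: "locally_finite_support (\<lambda>z. 2 * of_bool (is_pole f z))"
        "locally_finite_support (\<lambda>z. 2 * of_bool (is_pole (\<lambda>z. inverse (f z)) z))"
        by (intro lf f fi)+
      show ?thesis unfolding w_def
        by (simp only: log_count_add a locally_finite_support_add locally_finite_support_pole_mult[OF rm(1)] locally_finite_support_pole_mult[OF rm(2)])
    qed
    finally show ?thesis using r1 by (simp add: N_count_eq rm N_count_bar_eq f fi log_count_cmult)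
  qed
  obtain S where S: "S \<in> o[nev_filter](T)"
    "eventually (\<lambda>r. real j * proximity f r \<le> proximity (\<lambda>z. inverse (\<psi> z)) r + S r) nev_filter"
    using clunie_type_bound[OF Q psim nz eq] by blast
  define c where "c = ln (cmod (zor_poly \<psi> 0 0))"
  define E where "E = (\<lambda>r. proximity \<psi> r + N_count r1 r + N_count r0 r - c + S r)"
  have Nr: "N_count r0 \<in> o[nev_filter](T)" "N_count r1 \<in> o[nev_filter](T)"
  proof -
    have *: "N_count a \<in> o[nev_filter](T)" if a: "rational_function a" for a
    proof -
      have "N_count a \<in> O[nev_filter](\<lambda>r. ln r)"
        using N_count_finite_poles_nev[OF rational_function_meromorphic[OF a]] .
      thus ?thesis using ln_small landau_o.big_small_trans by blast
    qed
    show "N_count r0 \<in> o[nev_filter](T)" "N_count r1 \<in> o[nev_filter](T)" by (intro * r)+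
  qed
  have E: "E \<in> o[nev_filter](T)" unfolding E_def
    using psis by (intro sum_in_smallo Nr S const_small) (auto simp: nev_small_def)
  define R where "R = (\<lambda>r. 2 / real j * N_count_bar (\<lambda>z. inverse (f z)) r + N_count f r + 2 / real j * N_count_bar f r)"
  \<comment> \<open>Exactly the excess over the main terms, so the inequality holds for every
    \<open>r > 0\<close>, exceptional radii included; only its smallness has to be proved off an
    exceptional set.\<close>
  define s where "s = (\<lambda>r. max 0 (char_T f r - R r))"
  have "eventually (\<lambda>r. 0 \<le> s r \<and> s r \<le> \<bar>E r\<bar>) nev_filter"
    using S(2) eventually_nev_ge[of 1] eventually_good_circle[OF psim nz]
  proof eventually_elim
    case (elim r)
    have pi: "(\<lambda>z. inverse (\<psi> z)) meromorphic_on UNIV" by (intro meromorphic_intros psim)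
    have "real j * proximity f r \<le> proximity (\<lambda>z. inverse (\<psi> z)) r + S r" by fact
    also have "proximity (\<lambda>z. inverse (\<psi> z)) r \<le> char_T (\<lambda>z. inverse (\<psi> z)) r"
      using N_count_nonneg[OF pi elim(2)] by (simp add: char_T_def)
    also have "\<dots> = proximity \<psi> r + N_count \<psi> r - c"
      using char_T_inverse[OF psim nz elim(3)] by (simp add: c_def char_T_def)
    finally have "real j * proximity f r \<le> 2 * N_count_bar f r + 2 * N_count_bar (\<lambda>z. inverse (f z)) r + E r"
      using N_psi[OF elim(2)] by (simp add: E_def)
    hence "proximity f r \<le> (2 * N_count_bar f r + 2 * N_count_bar (\<lambda>z. inverse (f z)) r + E r) / real j"
      using j by (simp add: field_simps)
    hence "char_T f r - R r \<le> E r / real j"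
      by (simp add: char_T_def R_def add_divide_distrib)
    also have "\<dots> \<le> \<bar>E r\<bar> / real j" by (intro divide_right_mono) auto
    also have "\<dots> \<le> \<bar>E r\<bar> / 1" using j by (intro divide_left_mono) auto
    finally show ?case by (simp add: s_def)
  qed
  moreover have "(\<lambda>r. \<bar>E r\<bar>) \<in> o[nev_filter](T)" using E by simp
  ultimately have "s \<in> o[nev_filter](T)" by (rule smallo_mono_nonneg)
  hence "is_S f s" by (rule smallo_imp_is_S[OF f])
  moreover have "char_T f r \<le> R r + s r" for r by (simp add: s_def)
  ultimately show ?thesis by (intro exI[of _ s]) (auto simp: R_def)
qed

text \<open>The integer is \<open>degree \<alpha>\<close>. Both \<open>f\<close> and
  \<open>h\<close> have finitely many poles, so their characteristics are compared through the
  proximities alone. That \<open>q\<close> is constant for polynomial \<open>r0\<close> and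
  \<open>r1\<close> follows because \<open>Z\<close> is then empty.\<close>

lemma first_alternative:
  fixes r0 r1 :: "complex \<Rightarrow> complex"
  defines "u \<equiv> (\<lambda>z. deriv f z / f z)"
  assumes r: "rational_function r0" "rational_function r1" and n: "n \<ge> 2" and tr: "\<not> rational_function f"
    and ric: "\<forall>\<^sub>\<approx>z\<in>UNIV. of_nat n * deriv u z + (of_nat n * u z)\<^sup>2 + r1 z * (of_nat n * u z) + r0 z = 0"
    and P: "small_poly d P" "d < n" and eq: "\<forall>\<^sub>\<approx>z\<in>UNIV. f z ^ n + P z = h z"
    and h: "h nicely_meromorphic_on UNIV" "finite {z. is_pole h z}"
  shows "(\<exists>m::int. nev_order h = ereal (real_of_int m))
            \<and> (\<exists>q \<alpha>. rational_function q \<and> degree \<alpha> \<ge> 1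
                 \<and> (\<forall>\<^sub>\<approx>z\<in>UNIV. f z = q z * exp (poly \<alpha> z))
                 \<and> (is_polynomial_fun r1 \<and> is_polynomial_fun r0
                      \<longrightarrow> (\<exists>c. \<forall>\<^sub>\<approx>z\<in>UNIV. q z = c)))
            \<and> (\<exists>s. is_S f s \<and> (\<forall>r>0. char_T h r = real n * char_T f r + s r))"
proof -
  note rm = rational_function_meromorphic[OF r(1)] rational_function_meromorphic[OF r(2)]
  have um: "u meromorphic_on UNIV" unfolding u_def by (intro meromorphic_intros f)
  have hm: "h meromorphic_on UNIV" using h by (simp add: nicely_meromorphic_on_def)
  define Z where "Z = {z. zorder f z \<noteq> 0}"
  have Zsub: "Z \<subseteq> {z. is_pole r0 z} \<union> {z. is_pole r1 z}"
    using riccati_zorder_0[OF f f_nz rm(1,3) _ _ n ric[unfolded u_def]] by (auto simp: Z_def)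
  hence Zfin: "finite Z" using rm by (auto intro: finite_subset)
  have "is_pole u z \<Longrightarrow> z \<in> Z" for z
  proof (rule ccontr)
    assume p: "is_pole u z" and "z \<notin> Z"
    hence z0: "zorder f z = 0" by (simp add: Z_def)
    obtain H where H: "H analytic_on {z}" "eventually (\<lambda>w. deriv f w / f w = of_int (zorder f z) / (w - z) + H w) (at z)"
      using logderiv_local_form[OF meromorphic_on_UNIV_at[OF f] cosparse_UNIV_at[OF f_nz]] by blast
    have "eventually (\<lambda>w. u w = H w) (at z)" using H(2) by (simp add: z0 u_def)
    from is_pole_cong[OF this refl] p show False using analytic_at_imp_no_pole[OF H(1)] by simp
  qed
  hence "finite {z. is_pole u z}" using Zfin by (auto intro: finite_subset)
  hence u_rat: "rational_function u" using n by (intro riccati_rational[OF um _ r _ ric]) auto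
  obtain c \<alpha> where fc: "\<forall>\<^sub>\<approx>z\<in>UNIV. f z = c * (\<Prod>a\<in>Z. (z - a) powi zorder f a) * exp (poly \<alpha> z)"
    using rational_logderiv_form[OF f f_nz Zfin _ u_rat[unfolded u_def]] by (auto simp: Z_def)
  define q where "q = (\<lambda>z. c * (\<Prod>a\<in>Z. (z - a) powi zorder f a))"
  have q: "rational_function q" unfolding q_def
    by (intro rational_function_mult rational_function_const rational_function_prod rational_function_power_int rational_function_linear)
  have fq: "\<forall>\<^sub>\<approx>z\<in>UNIV. f z = q z * exp (poly \<alpha> z)" using fc by (simp add: q_def)
  have deg: "degree \<alpha> \<ge> 1"
  proof (rule ccontr)
    assume "\<not> degree \<alpha> \<ge> 1"
    then obtain k where "\<alpha> = [:k:]" using degree_eq_zeroE[of \<alpha>] by (metis less_one not_le)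
    hence "\<forall>\<^sub>\<approx>z\<in>UNIV. f z = q z * exp k" using fq by simp
    hence "rational_function f"
      by (rule rational_function_cong[rotated]) (intro rational_function_mult q rational_function_const)
    thus False using tr by blast
  qed
  have qconst: "\<exists>c. \<forall>\<^sub>\<approx>z\<in>UNIV. q z = c" if "is_polynomial_fun r1" "is_polynomial_fun r0"
  proof -
    have "Z = {}" using Zsub not_is_pole_polynomial_fun that by blast
    thus ?thesis by (intro exI[of _ c]) (simp add: q_def)
  qed
  define s where "s = (\<lambda>r. char_T h r - real n * char_T f r)"
  have s: "s \<in> o[nev_filter](T)"
  proof -
    have lnN: "N \<in> o[nev_filter](T)" if "N \<in> O[nev_filter](\<lambda>r. ln r)" for N
      using that ln_small landau_o.big_small_trans by blast
    have "N_count h \<in> O[nev_filter](\<lambda>r. ln r)"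
      using N_count_finite_poles_nev[OF hm h(2)] .
    hence Nh: "N_count h \<in> o[nev_filter](T)" by (rule lnN)
    have "is_pole f z \<Longrightarrow> z \<in> Z" for z
      using isolated_pole_imp_neg_zorder[of f z] meromorphic_on_UNIV_at[OF f, of z] by (auto simp: Z_def meromorphic_at_iff)
    hence "finite {z. is_pole f z}" using Zfin by (auto intro: finite_subset)
    hence "N_count f \<in> O[nev_filter](\<lambda>r. ln r)"
      by (rule N_count_finite_poles_nev[OF f])
    hence "N_count f \<in> o[nev_filter](T)" by (rule lnN)
    hence "(\<lambda>r. real n * N_count f r) \<in> o[nev_filter](T)" using n by simp
    hence "(\<lambda>r. (proximity h r - real n * proximity f r) + (N_count h r - real n * N_count f r)) \<in> o[nev_filter](T)"
      by (intro sum_in_smallo proximity_leading_term[OF P eq] Nh)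
    moreover have "s = (\<lambda>r. (proximity h r - real n * proximity f r) + (N_count h r - real n * N_count f r))"
      by (simp add: s_def char_T_def fun_eq_iff algebra_simps)
    ultimately show ?thesis by simp
  qed
  obtain c1 C1 where gr: "c1 > 0" "C1 > 0"
    "eventually (\<lambda>r. c1 * r ^ degree \<alpha> \<le> char_T f r) nev_filter" "eventually (\<lambda>r. char_T f r \<le> C1 * r ^ degree \<alpha>) nev_filter"
    using char_T_exp_growth[OF q deg f f_nz fq] by blast
  have ev_s: "eventually (\<lambda>r. \<bar>s r\<bar> \<le> char_T f r) nev_filter"
    using landau_o.smallD[OF s zero_less_one] eventually_nev_ge[of 1]
    by eventually_elim (use char_T_nonneg[OF f] in auto)
  \<comment> \<open>Off an exceptional set the error is at most \<open>char_T f r\<close>, and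
    \<open>n \<ge> 2\<close> still leaves \<open>char_T h r \<ge> char_T f r\<close>.\<close>
  have lower: "eventually (\<lambda>r. c1 * r ^ degree \<alpha> \<le> char_T h r) nev_filter"
    using ev_s gr(3) eventually_nev_ge[of 1]
  proof eventually_elim
    case (elim r)
    have "2 * char_T f r \<le> real n * char_T f r" using n char_T_nonneg[OF f elim(3)] by (intro mult_right_mono) auto
    thus ?case using elim by (simp add: s_def abs_le_iff)
  qed
  have upper: "eventually (\<lambda>r. char_T h r \<le> ((real n + 1) * C1) * r ^ degree \<alpha>) nev_filter"
    using ev_s gr(4)
  proof eventually_elim
    case (elim r)
    have "char_T h r \<le> (real n + 1) * char_T f r" using elim by (simp add: s_def abs_le_iff algebra_simps)
    also have "\<dots> \<le> (real n + 1) * (C1 * r ^ degree \<alpha>)" using elim by (intro mult_left_mono) auto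
    finally show ?case by (simp add: mult.assoc)
  qed
  \<comment> \<open>If \<open>h\<close> vanished identically its characteristic would be 0, against
    the lower bound. Nonvanishing is needed to extend the upper bound to all large radii.\<close>
  have "\<forall>\<^sub>\<approx>z\<in>UNIV. h z \<noteq> 0"
  proof (rule ccontr)
    assume "\<not> ?thesis"
    hence h0: "\<forall>\<^sub>\<approx>z\<in>UNIV. h z = 0" using meromorphic_imp_constant_or_avoid[OF hm, of 0] by auto
    have N0: "N_count h r = 0" for r using N_count_cong_cosparse[OF h0] N_count_analytic[of "\<lambda>_. 0"] by simp
    have "eventually (\<lambda>r. False) nev_filter"
      using lower proximity_cong_cosparse[OF h0] eventually_nev_ge[of 1]
    proof eventually_elim
      case (elim r)
      have "char_T h r = 0" using elim N0 by (simp add: char_T_def proximity_const log_plus_def)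
      moreover have "c1 * r ^ degree \<alpha> > 0" using gr(1) elim by simp
      ultimately show False using elim by simp
    qed
    thus False by simp
  qed
  then obtain C2 where C2: "eventually (\<lambda>r. 0 \<le> char_T h r \<and> char_T h r \<le> C2 * r ^ degree \<alpha>) at_top"
    using char_T_power_bound_no_exception[OF h(1) _ h(2) deg upper] by blast
  have "nev_order h = ereal (real_of_int (int (degree \<alpha>)))"
    using nev_order_eqI[OF gr(1) lower C2] by simp
  moreover have "is_S f s" using s by (rule smallo_imp_is_S[OF f])
  moreover have "\<forall>r>0. char_T h r = real n * char_T f r + s r" by (simp add: s_def)
  ultimately show ?thesis using q deg fq qconst by blast
qed

end

theorem theorem1p1:
  fixes n l k :: nat
    and r0 r1 r2 h f :: "complex \<Rightarrow> complex"
    and a :: "nat \<Rightarrow> complex \<Rightarrow> complex"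
    and e :: "nat \<Rightarrow> nat \<Rightarrow> nat"
  assumes n2: "n \<ge> 2"
    and rat: "rational_function r0" "rational_function r1" "rational_function r2"
    and h_mero: "h nicely_meromorphic_on UNIV"
    and h_ode: "\<forall>\<^sub>\<approx>z\<in>UNIV. deriv (deriv h) z + r1 z * deriv h z + r0 z * h z = r2 z"
    and coeffs_small: "\<And>j. j < l \<Longrightarrow> small_function f (a j)"
    and f_trans: "transcendental_meromorphic f"
    and f_eq: "\<forall>\<^sub>\<approx>z\<in>UNIV. f z ^ n + diff_poly l k a e f z = h z"
  shows "(\<exists>m::int. nev_order h = ereal (real_of_int m))
            \<and> (\<exists>q \<alpha>. rational_function q \<and> degree \<alpha> \<ge> 1
                 \<and> (\<forall>\<^sub>\<approx>z\<in>UNIV. f z = q z * exp (poly \<alpha> z))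
                 \<and> (is_polynomial_fun r1 \<and> is_polynomial_fun r0
                      \<longrightarrow> (\<exists>c. \<forall>\<^sub>\<approx>z\<in>UNIV. q z = c)))
            \<and> (\<exists>s. is_S f s \<and> (\<forall>r>0. char_T h r = real n * char_T f r + s r))
         \<or> (\<forall>j::nat. j \<ge> 1 \<and> n \<ge> j + 1 \<and> diff_poly_degree l k e \<le> n - j \<longrightarrow>
              (\<exists>s. is_S f s \<and> (\<forall>r>0.
                 char_T f r \<le> 2 / real j * N_count_bar (\<lambda>z. inverse (f z)) r + N_count f r
                              + 2 / real j * N_count_bar f r + s r)))"
proof -
  have tr: "\<not> rational_function f" using f_trans by (simp add: transcendental_meromorphic_def)
  have fm: "f meromorphic_on UNIV"
    using f_trans by (simp add: transcendental_meromorphic_def nicely_meromorphic_on_def)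
  have f_nz: "\<forall>\<^sub>\<approx>z\<in>UNIV. f z \<noteq> 0"
    using meromorphic_imp_constant_or_avoid[OF fm, of 0] rational_function_cong[OF rational_function_const, of f 0] tr by auto
  interpret nev_large f
    by unfold_locales (use fm f_nz transcendental_growth[OF fm f_nz tr] in auto)
  have hm: "h meromorphic_on UNIV" using h_mero by (simp add: nicely_meromorphic_on_def)
  have a_small: "nev_small (a j)" if "j < l" for j
    using coeffs_small[OF that] is_S_imp_smallo
    by (intro nev_small_if_char_T_smallo) (auto simp: small_function_def nicely_meromorphic_on_def)
  define P where "P = diff_poly l k a e f"
  have P: "small_poly d P" if "diff_poly_degree l k e \<le> d" for d
    unfolding P_def using a_small that by (rule small_poly_diff_poly)
  have Pm: "P meromorphic_on UNIV" using small_poly_meromorphic[OF P[OF order.refl]] .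
  have eq: "\<forall>\<^sub>\<approx>z\<in>UNIV. f z ^ n + P z = h z" using f_eq by (simp add: P_def)
  define u where "u = (\<lambda>z. deriv f z / f z)"
  define \<psi> where "\<psi> = (\<lambda>z. of_nat n * deriv u z + (of_nat n * u z)\<^sup>2 + r1 z * (of_nat n * u z) + r0 z)"
  define Q where "Q = (\<lambda>z. r2 z + (- 1) * (deriv (deriv P) z + r1 z * deriv P z + r0 z * P z))"
  have key: "\<forall>\<^sub>\<approx>z\<in>UNIV. f z ^ n * \<psi> z = Q z"
    unfolding \<psi>_def u_def Q_def by (rule ode_for_power[OF Pm eq h_ode])
  have rs: "nev_small r0" "nev_small r1" "nev_small r2" using rational_nev_small[OF nev_large_axioms] rat by auto
  have Q: "small_poly d Q" if "diff_poly_degree l k e \<le> d" for d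
  proof -
    note d0 = P[OF that]
    note d1 = small_poly_deriv[OF d0]
    note d2 = small_poly_deriv[OF d1]
    note L = small_poly_add[OF small_poly_add[OF d2 small_poly_mult_small[OF rs(2) d1]] small_poly_mult_small[OF rs(1) d0]]
    show ?thesis
      unfolding Q_def by (rule small_poly_add[OF small_poly_small[OF rs(3)] small_poly_mult_small[OF nev_small_const L]])
  qed
  have psim: "\<psi> meromorphic_on UNIV" unfolding \<psi>_def u_def
    by (intro meromorphic_intros fm rational_function_meromorphic rat)
  \<comment> \<open>\<open>\<psi>\<close> does not depend on \<open>j\<close>, so the first case
    yields the second alternative for all \<open>j\<close> at once. For \<open>\<psi> = 0\<close>
    the degree must be below \<open>n\<close> in order to compare \<open>h\<close> with
    \<open>f ^ n\<close>; otherwise no \<open>j \<ge> 1\<close> has degree at most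
    \<open>n - j\<close>, and the second alternative is vacuous.\<close>
  consider "\<forall>\<^sub>\<approx>z\<in>UNIV. \<psi> z \<noteq> 0" | "\<forall>\<^sub>\<approx>z\<in>UNIV. \<psi> z = 0" "diff_poly_degree l k e < n"
    | "diff_poly_degree l k e \<ge> n"
    using meromorphic_imp_constant_or_avoid[OF psim, of 0] by force
  thus ?thesis
  proof cases
    case 1
    show ?thesis
    proof (rule disjI2, intro allI impI)
      fix j :: nat assume j: "j \<ge> 1 \<and> n \<ge> j + 1 \<and> diff_poly_degree l k e \<le> n - j"
      hence nj: "n = (n - j) + j" by simp
      have "\<forall>\<^sub>\<approx>z\<in>UNIV. f z ^ ((n - j) + j) * \<psi> z = Q z" using key nj by simp
      thus "\<exists>s. is_S f s \<and> (\<forall>r>0.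
                 char_T f r \<le> 2 / real j * N_count_bar (\<lambda>z. inverse (f z)) r + N_count f r
                              + 2 / real j * N_count_bar f r + s r)"
        using j 1 rat Q unfolding \<psi>_def u_def by (intro second_alternative) auto
    qed
  next
    case 2
    have "finite {z. is_pole h z}" by (rule ode_finite_poles[OF hm rat h_ode])
    thus ?thesis
      using first_alternative[OF rat(1,2) n2 tr _ P[OF order.refl] 2(2) eq h_mero] 2(1)
      unfolding \<psi>_def u_def by blast
  next
    case 3
    thus ?thesis using n2 by (intro disjI2 allI impI) auto
  qed
qed

end
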